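(* For every $F\in\mathcal S^\sharp$, the constant $\Lambda_F$ satisfies $\Lambda_F\ge0$; equivalently, for every $t<0$ the function $\xi^F_t$ has a zero off the critical line $\Re s=\tfrac12$.
   Context: $\operatorname{Log}$ denotes the principal branch of the logarithm ($\operatorname{Log} z=\log|z|+i\operatorname{Arg} z$ with $\operatorname{Arg} z\in(-\pi,\pi]$). The extended Selberg class $\mathcal S^\sharp$ is the set of functions $F$, not identically zero, such that: (i) $F(s)=\sum_{n\ge1}a_n n^{-s}$, with the series converging absolutely for $\Re s>1$; (ii) $(s-1)^mF(s)$ extends to an entire function of finite order for some integer $m\ge0$; (iii) letting $m$ be the order of the pole of $F$ at $s=1$ ($m=0$ if there is no pole), there is a function $\gamma(s)=\alpha s^m(s-1)^mQ^s\prod_{i=1}^k\Gamma(\omega_i s+\mu_i)$ with $\alpha\in\mathbb C\setminus\{0\}$, $Q>0$, an integer $k\ge1$, $\omega_i>0$ and $\mu_i\in\mathbb C$ with $\Re\mu_i\ge0$, such that the (entire) function $\xi^F(s):=\gamma(s)F(s)$ satisfies $\xi^F(s)=\overline{\xi^F(1-\bar s)}$ for all $s$. Define $\Phi_F(u):=\frac{1}{2\pi}\int_{-\infty}^{\infty}\xi^F\!\left(\frac{1+ix}{2}\right)e^{-ixu}\,dx$ for $u\in\mathbb R$, and for $t\in\mathbb R$ define the entire function $\xi^F_t$ by $\xi^F_t\!\left(\frac{1+iz}{2}\right):=\int_{-\infty}^{\infty}e^{tu^2}\Phi_F(u)e^{izu}\,du$ (this converges for all $t$). $\Lambda_F$ is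 the (de Bruijn–Newman) constant with the property that, for $t\in\mathbb R$, all zeros of $\xi^F_t$ lie on the critical line $\Re s=\tfrac12$ if and only if $t\ge\Lambda_F$. *)

theory Defs
  imports "HOL-Analysis.Analysis"
begin

definition selberg_gamma ::
  "complex \<Rightarrow> nat \<Rightarrow> real \<Rightarrow> nat \<Rightarrow> (nat \<Rightarrow> real) \<Rightarrow> (nat \<Rightarrow> complex) \<Rightarrow> complex \<Rightarrow> complex" where
  "selberg_gamma \<alpha> m Q k \<omega> \<mu> s =
     \<alpha> * s ^ m * (s - 1) ^ m * (complex_of_real Q powr s) *
     (\<Prod>i<k. Gamma (complex_of_real (\<omega> i) * s + \<mu> i))"

definition finite_order_entire :: "(complex \<Rightarrow> complex) \<Rightarrow> bool" where
  "finite_order_entire G \<longleftrightarrow> G holomorphic_on UNIV \<and>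
     (\<exists>\<rho> C. \<forall>z. norm (G z) \<le> C * exp (norm z powr \<rho>))"

text \<open>Membership of F in the extended Selberg class, together with the data:
  Dirichlet coefficients a, pole order m, gamma factor (alpha,Q,k,omega,mu),
  and the completed entire function Xi = xi^F (gamma(s) F(s), continued to C).
  F is only used on Re s > 1, where it is given by its Dirichlet series;
  Xi is the (unique, by the identity theorem) entire continuation of gamma*F.\<close>
definition selberg_sharp ::
  "(complex \<Rightarrow> complex) \<Rightarrow> (nat \<Rightarrow> complex) \<Rightarrow> nat \<Rightarrow> complex \<Rightarrow> real \<Rightarrow> nat \<Rightarrow>
   (nat \<Rightarrow> real) \<Rightarrow> (nat \<Rightarrow> complex) \<Rightarrow> (complex \<Rightarrow> complex) \<Rightarrow> bool" where
  "selberg_sharp F a m \<alpha> Q k \<omega> \<mu> Xi \<longleftrightarrow>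
     \<comment> \<open>(i) absolutely convergent Dirichlet series for Re s > 1\<close>
     (\<forall>s. 1 < Re s \<longrightarrow>
        summable (\<lambda>n. norm (a (Suc n) * of_nat (Suc n) powr (- s))) \<and>
        F s = (\<Sum>n. a (Suc n) * of_nat (Suc n) powr (- s))) \<and>
     \<comment> \<open>not identically zero\<close>
     (\<exists>s. 1 < Re s \<and> F s \<noteq> 0) \<and>
     \<comment> \<open>(ii) (s-1)^m F(s) extends to an entire function of finite order,
          m being the order of the pole at s = 1 (m = 0 if no pole)\<close>
     (\<exists>G. finite_order_entire G \<and>
        (\<forall>s. 1 < Re s \<longrightarrow> G s = (s - 1) ^ m * F s) \<and>
        (m = 0 \<or> G 1 \<noteq> 0)) \<and>
     \<comment> \<open>(iii) gamma factor and functional equation\<close>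
     \<alpha> \<noteq> 0 \<and> 0 < Q \<and> 1 \<le> k \<and>
     (\<forall>i<k. 0 < \<omega> i \<and> 0 \<le> Re (\<mu> i)) \<and>
     Xi holomorphic_on UNIV \<and>
     (\<forall>s. 1 < Re s \<longrightarrow> Xi s = selberg_gamma \<alpha> m Q k \<omega> \<mu> s * F s) \<and>
     (\<forall>s. Xi s = cnj (Xi (1 - cnj s)))"

definition Phi_F :: "(complex \<Rightarrow> complex) \<Rightarrow> real \<Rightarrow> complex" where
  "Phi_F Xi u = (1 / (2 * pi)) *
     (LINT x|lborel. Xi ((1 + \<i> * complex_of_real x) / 2) * exp (- \<i> * complex_of_real (x * u)))"

text \<open>xi_t^F(s), where s = (1 + i z)/2, i.e. z = -i(2s - 1):
  xi_t^F((1+iz)/2) = int_R e^{t u^2} Phi_F(u) e^{izu} du.\<close>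
definition xi_t :: "(complex \<Rightarrow> complex) \<Rightarrow> real \<Rightarrow> complex \<Rightarrow> complex" where
  "xi_t Xi t s = (let z = - \<i> * (2 * s - 1) in
     LINT u|lborel. complex_of_real (exp (t * u\<^sup>2)) * Phi_F Xi u * exp (\<i> * z * complex_of_real u))"

end

theory Submission
  imports Defs "HOL-Complex_Analysis.Complex_Analysis" "HOL-Probability.Distributions"
begin

text \<open>
  For \<open>t = -\<tau> < 0\<close> the function \<open>\<xi>\<^sub>t\<close> is the convolution of \<open>\<xi>\<close> with a Gaussian along a vertical
  line, and the line may be moved to abscissa 2, where \<open>F\<close> is given by its Dirichlet series. Near
  \<open>p = 2 + iT\<close> the gamma factor behaves like \<open>\<gamma>(p) exp (\<psi> (s - p))\<close> with \<open>Re \<psi>\<close> tending to infinity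
  with \<open>T\<close>; completing the square, \<open>\<xi>\<^sub>t (p + \<tau> \<psi> / 2 + \<zeta>)\<close> is, up to a zero-free factor, close to a
  twist of the entire Dirichlet series with coefficients \<open>a\<^sub>n n\<^bsup>-2\<^esup> exp (- \<tau> (log n)\<^sup>2 / 4)\<close>. If all zeros of
  \<open>\<xi>\<^sub>t\<close> were on the critical line, they would leave every compact set in the variable \<open>\<zeta>\<close>, so by Hurwitz
  a limit of these twists would have no zeros. A zero-free series of this kind consists of a single
  term, hence so does \<open>F\<close>; but then the poles of the gamma factor are not cancelled, although \<open>\<xi>\<close> is entire.
\<close>

section \<open>Gaussian integrals on vertical lines\<close>

text \<open>Moving the line of integration for every t < 0 requires \<open>Xi\<close> to grow in the
  strip more slowly than every Gaussian. Finite order is too weak for that by itself; combined with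
  the crude bound |Gamma z| \<le> Gamma (Re z) at the edge, the functional equation and
  Phragmen-Lindelof it gives what is required. At large heights the convergence of Digamma - Ln to 0
  plays the part of Stirling's formula: it yields both the limit of the gamma quotient and a
  majorant that is uniform in the height. The phases n^(-iT) have no limit as T grows, so
  compactness selects heights along which all of them converge. The limit twist keeps the moduli of
  the coefficients, hence their support, and this is what carries the conclusion back to
  \<open>F\<close>. In the limit the damped series has order at most 2 and approaches its leading
  term on the right, so without zeros it has a quadratic polynomial as logarithm. The final
  contradiction lies at a point of the left half-plane where a reciprocal Gamma vanishes but a
  single exponential cannot.\<close>

lemma
  fixes \<tau> :: real
  assumes "\<tau> > 0"
  shows integrable_gaussian: "integrable lborel (\<lambda>v. exp (- v\<^sup>2 / \<tau>))"
    and integral_gaussian: "(LINT v|lborel. exp (- v\<^sup>2 / \<tau>)) = sqrt (pi * \<tau>)"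
proof -
  have eq: "exp (- v\<^sup>2 / \<tau>) = sqrt (pi * \<tau>) * normal_density 0 (sqrt (\<tau> / 2)) v" for v
    using assms by (simp add: normal_density_def)
  show "integrable lborel (\<lambda>v. exp (- v\<^sup>2 / \<tau>))"
    and "(LINT v|lborel. exp (- v\<^sup>2 / \<tau>)) = sqrt (pi * \<tau>)"
    unfolding eq using assms by simp_all
qed

text \<open>Half of the quadratic term absorbs the linear one, whatever \<open>K\<close> is. This
  supplies the majorants for integrands of exponential growth.\<close>

lemma integrable_exp_abs_gaussian:
  fixes \<tau> K :: real
  assumes "\<tau> > 0"
  shows "integrable lborel (\<lambda>v. exp (K * \<bar>v\<bar> - v\<^sup>2 / \<tau>))"
proof (rule Bochner_Integration.integrable_bound)
  show "integrable lborel (\<lambda>v. exp (K\<^sup>2 * \<tau> / 2) * exp (- v\<^sup>2 / (2 * \<tau>)))"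
    using integrable_gaussian[of "2 * \<tau>"] assms by simp
  have "K * \<bar>v\<bar> - v\<^sup>2 / \<tau> \<le> K\<^sup>2 * \<tau> / 2 + - v\<^sup>2 / (2 * \<tau>)" for v
  proof -
    have "0 \<le> (\<bar>v\<bar> - K * \<tau>)\<^sup>2 / (2 * \<tau>)" using assms by simp
    also have "\<dots> = K\<^sup>2 * \<tau> / 2 + - v\<^sup>2 / (2 * \<tau>) - (K * \<bar>v\<bar> - v\<^sup>2 / \<tau>)"
      using assms by (simp add: field_simps power2_eq_square)
    finally show ?thesis by simp
  qed
  then show "AE v in lborel. norm (exp (K * \<bar>v\<bar> - v\<^sup>2 / \<tau>))
      \<le> norm (exp (K\<^sup>2 * \<tau> / 2) * exp (- v\<^sup>2 / (2 * \<tau>)))"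
    by (simp add: exp_add[symmetric])
qed simp

lemma integrable_vertical_line:
  fixes f :: "complex \<Rightarrow> complex"
  assumes "continuous_on UNIV f" and "\<delta> > 0"
    and "\<And>v. norm (f (of_real x + \<i> * of_real v)) \<le> C * exp (- \<delta> * v\<^sup>2)"
  shows "integrable lborel (\<lambda>v. f (of_real x + \<i> * of_real v))"
proof (rule Bochner_Integration.integrable_bound)
  show "integrable lborel (\<lambda>v. C * exp (- \<delta> * v\<^sup>2))"
    using integrable_gaussian[of "1 / \<delta>"] assms(2) by (simp add: mult.commute)
  have "continuous_on UNIV (\<lambda>v. f (of_real x + \<i> * of_real v))"
    by (rule continuous_on_compose2[OF assms(1)]) (auto intro!: continuous_intros)
  then show "(\<lambda>v. f (of_real x + \<i> * of_real v)) \<in> borel_measurable lborel"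
    using borel_measurable_continuous_onI by auto
  show "AE v in lborel. norm (f (of_real x + \<i> * of_real v)) \<le> norm (C * exp (- \<delta> * v\<^sup>2))"
    using order_trans[OF assms(3) abs_ge_self] by auto
qed

text \<open>Cauchy's theorem on tall rectangles, phrased through a primitive \<open>P\<close>:
  truncated integrals over vertical lines are differences of \<open>P\<close>, and the horizontal
  edges vanish in the limit because their length is fixed while \<open>f\<close> decays.\<close>

lemma integral_vertical_lines_eq:
  fixes f :: "complex \<Rightarrow> complex"
  assumes hol: "f holomorphic_on UNIV" and "\<delta> > 0" and "a \<le> b"
    and bound: "\<And>x v. x \<in> {a..b} \<Longrightarrow> norm (f (of_real x + \<i> * of_real v)) \<le> C * exp (- \<delta> * v\<^sup>2)"
  shows "(LINT v|lborel. f (of_real a + \<i> * of_real v)) = (LINT v|lborel. f (of_real b + \<i> * of_real v))"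
proof -
  have cont: "continuous_on UNIV f"
    using hol by (rule holomorphic_on_imp_continuous_on)
  obtain P where P: "\<And>z. (P has_field_derivative f z) (at z)"
    using holomorphic_convex_primitive'[OF convex_UNIV open_UNIV hol] by auto
  have cont_line: "continuous_on S (\<lambda>v. f (of_real x + \<i> * of_real v))" for S :: "real set" and x
    by (rule continuous_on_compose2[OF cont]) (auto intro!: continuous_intros)
  define J where "J x n = (LINT v|lborel. indicator {- real n..real n} v *\<^sub>R f (of_real x + \<i> * of_real v))" for x n
  have J: "J x n = (P (of_real x + \<i> * real n) - P (of_real x + \<i> * (- real n))) / \<i>" for x n
  proof -
    have "J x n = P (of_real x + \<i> * of_real (real n)) / \<i> - P (of_real x + \<i> * of_real (- real n)) / \<i>"
      unfolding J_def
    proof (rule integral_FTC_Icc)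
      fix v :: real
      have "((\<lambda>v. of_real x + \<i> * of_real v) has_vector_derivative \<i>) (at v)"
        unfolding has_vector_derivative_def by (auto intro!: derivative_eq_intros simp: scaleR_conv_of_real)
      then have "((\<lambda>v. P (of_real x + \<i> * of_real v)) has_vector_derivative (\<i> * f (of_real x + \<i> * of_real v))) (at v)"
        using field_vector_diff_chain_at[OF _ P] by (simp add: o_def)
      then have "((\<lambda>v. P (of_real x + \<i> * of_real v) / \<i>) has_vector_derivative (\<i> * f (of_real x + \<i> * of_real v)) / \<i>) (at v)"
        by (rule has_vector_derivative_divide)
      then show "((\<lambda>v. P (of_real x + \<i> * of_real v) / \<i>) has_vector_derivative f (of_real x + \<i> * of_real v))
         (at v within {- real n..real n})"
        by (auto intro: has_vector_derivative_at_within)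
    qed (auto intro!: cont_line)
    then show ?thesis by (simp add: algebra_simps)
  qed
  have lim: "(\<lambda>n. J x n) \<longlonglongrightarrow> (LINT v|lborel. f (of_real x + \<i> * of_real v))" if "x \<in> {a..b}" for x
    unfolding J_def
  proof (rule integral_dominated_convergence)
    show "integrable lborel (\<lambda>v. norm (f (of_real x + \<i> * of_real v)))"
      using integrable_vertical_line[OF cont \<open>\<delta> > 0\<close> bound[OF that]] by simp
    show meas: "(\<lambda>v. f (of_real x + \<i> * of_real v)) \<in> borel_measurable lborel"
      using cont_line borel_measurable_continuous_onI by auto
    show "(\<lambda>v. indicat_real {- real i..real i} v *\<^sub>R f (of_real x + \<i> * of_real v)) \<in> borel_measurable lborel" for i
      using meas by measurable
    show "AE v in lborel. (\<lambda>n. indicat_real {- real n..real n} v *\<^sub>R f (of_real x + \<i> * of_real v))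
         \<longlonglongrightarrow> f (of_real x + \<i> * of_real v)"
    proof (intro AE_I2)
      fix v :: real
      have "\<forall>\<^sub>F n in sequentially. f (of_real x + \<i> * of_real v)
          = indicat_real {- real n..real n} v *\<^sub>R f (of_real x + \<i> * of_real v)"
        using eventually_ge_at_top[of "nat \<lceil>\<bar>v\<bar>\<rceil>"] by eventually_elim (auto simp: indicator_def)
      then show "(\<lambda>n. indicat_real {- real n..real n} v *\<^sub>R f (of_real x + \<i> * of_real v))
         \<longlonglongrightarrow> f (of_real x + \<i> * of_real v)"
        by (rule Lim_transform_eventually[OF tendsto_const])
    qed
  qed (auto simp: indicator_def)
  have P_diff: "norm (P (of_real b + \<i> * of_real v) - P (of_real a + \<i> * of_real v)) \<le> C * exp (- \<delta> * v\<^sup>2) * (b - a)" for v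
  proof -
    have "norm (P (of_real b + \<i> * of_real v) - P (of_real a + \<i> * of_real v))
        \<le> C * exp (- \<delta> * v\<^sup>2) * norm (of_real b + \<i> * of_real v - (of_real a + \<i> * of_real v))"
    proof (rule field_differentiable_bound)
      show "convex (closed_segment (of_real a + \<i> * of_real v) (of_real b + \<i> * of_real v))" by simp
      fix z assume "z \<in> closed_segment (of_real a + \<i> * of_real v) (of_real b + \<i> * of_real v)"
      then obtain u where u: "0 \<le> u" "u \<le> 1"
        and z: "z = (1 - u) *\<^sub>R (of_real a + \<i> * of_real v) + u *\<^sub>R (of_real b + \<i> * of_real v)"
        unfolding closed_segment_def by blast
      have "z = of_real ((1 - u) * a + u * b) + \<i> * of_real v"
        unfolding z by (simp add: scaleR_conv_of_real algebra_simps)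
      moreover have "(1 - u) * a + u * b \<in> {a..b}"
        using convexD_alt[of "{a..b}" a b u] u \<open>a \<le> b\<close> by simp
      ultimately show "norm (f z) \<le> C * exp (- \<delta> * v\<^sup>2)" using bound by metis
      show "(P has_field_derivative f z) (at z within closed_segment (of_real a + \<i> * of_real v) (of_real b + \<i> * of_real v))"
        using P has_field_derivative_at_within by blast
    qed auto
    also have "norm (of_real b + \<i> * of_real v - (of_real a + \<i> * of_real v)) = b - a"
      using \<open>a \<le> b\<close> by (simp flip: of_real_diff)
    finally show ?thesis .
  qed
  have "(\<lambda>n. J b n - J a n) \<longlonglongrightarrow> 0"
  proof (rule Lim_null_comparison)
    show "\<forall>\<^sub>F n in sequentially. norm (J b n - J a n) \<le> 2 * (C * exp (- \<delta> * (real n)\<^sup>2) * (b - a))"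
    proof (intro always_eventually allI)
      fix n
      have "J b n - J a n = ((P (of_real b + \<i> * of_real (real n)) - P (of_real a + \<i> * of_real (real n)))
         - (P (of_real b + \<i> * of_real (- real n)) - P (of_real a + \<i> * of_real (- real n)))) / \<i>"
        unfolding J by (simp add: diff_divide_distrib algebra_simps)
      also have "norm \<dots> = norm ((P (of_real b + \<i> * of_real (real n)) - P (of_real a + \<i> * of_real (real n)))
         - (P (of_real b + \<i> * of_real (- real n)) - P (of_real a + \<i> * of_real (- real n))))"
        by (simp add: norm_divide norm_mult)
      also have "\<dots> \<le> 2 * (C * exp (- \<delta> * (real n)\<^sup>2) * (b - a))"
        using P_diff[of "real n"] P_diff[of "- real n"] norm_triangle_ineq4 by (smt (verit) power2_minus)
      finally show "norm (J b n - J a n) \<le> 2 * (C * exp (- \<delta> * (real n)\<^sup>2) * (b - a))" .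
    qed
    have "(\<lambda>n. exp (- \<delta> * (real n)\<^sup>2)) \<longlonglongrightarrow> 0"
      using \<open>\<delta> > 0\<close> by real_asymp
    then have "(\<lambda>n. 2 * (C * exp (- \<delta> * (real n)\<^sup>2) * (b - a))) \<longlonglongrightarrow> 2 * (C * 0 * (b - a))"
      by (intro tendsto_intros)
    then show "(\<lambda>n. 2 * (C * exp (- \<delta> * (real n)\<^sup>2) * (b - a))) \<longlonglongrightarrow> 0" by simp
  qed
  moreover have "(\<lambda>n. J b n - J a n) \<longlonglongrightarrow> (LINT v|lborel. f (of_real b + \<i> * of_real v)) - (LINT v|lborel. f (of_real a + \<i> * of_real v))"
    using \<open>a \<le> b\<close> by (intro tendsto_diff lim) auto
  ultimately show ?thesis
    using LIMSEQ_unique by fastforce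
qed

section \<open>The Gaussian kernel with complex centre\<close>

lemma norm_gaussian_kernel:
  "norm (exp ((\<i> * of_real v - \<zeta>)\<^sup>2 / of_real \<tau>)) = exp (((Re \<zeta>)\<^sup>2 - (v - Im \<zeta>)\<^sup>2) / \<tau>)"
  by (simp add: Re_divide_of_real power2_eq_square)

text \<open>Giving up half of the decay in \<open>v\<close> absorbs the cross term with the
  imaginary part of \<zeta>. The result is uniform over a disc, as the locally uniform limit needs
  later.\<close>

lemma norm_gaussian_kernel_le:
  assumes "\<tau> > 0" and "norm \<zeta> \<le> R"
  shows "norm (exp ((\<i> * of_real v - \<zeta>)\<^sup>2 / of_real \<tau>)) \<le> exp (R\<^sup>2 / \<tau>) * exp (- v\<^sup>2 / (2 * \<tau>))"
proof -
  have "0 \<le> (v / 2 - Im \<zeta>)\<^sup>2 * 2" by simp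
  then have "- (v - Im \<zeta>)\<^sup>2 \<le> (Im \<zeta>)\<^sup>2 - v\<^sup>2 / 2"
    by (simp add: power2_eq_square algebra_simps)
  moreover have "(Re \<zeta>)\<^sup>2 + (Im \<zeta>)\<^sup>2 \<le> R\<^sup>2"
    using assms(2) by (metis cmod_power2 norm_ge_zero power_mono)
  ultimately have "((Re \<zeta>)\<^sup>2 - (v - Im \<zeta>)\<^sup>2) / \<tau> \<le> (R\<^sup>2 - v\<^sup>2 / 2) / \<tau>"
    using assms(1) by (intro divide_right_mono) auto
  also have "\<dots> = R\<^sup>2 / \<tau> + - v\<^sup>2 / (2 * \<tau>)" by (simp add: diff_divide_distrib)
  finally show ?thesis unfolding norm_gaussian_kernel exp_add[symmetric] by simp
qed

lemma borel_measurable_gaussian_kernel [measurable]: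
  "(\<lambda>v. exp ((\<i> * of_real v - \<zeta>)\<^sup>2 / of_real \<tau>)) \<in> borel_measurable borel"
  by measurable

lemma integrable_gaussian_kernel_mult:
  fixes \<phi> :: "real \<Rightarrow> complex"
  assumes "\<tau> > 0" and [measurable]: "\<phi> \<in> borel_measurable borel"
    and \<phi>: "\<And>v. norm (\<phi> v) \<le> M * exp (K * \<bar>v\<bar>)"
  shows "integrable lborel (\<lambda>v. \<phi> v * exp ((\<i> * of_real v - \<zeta>)\<^sup>2 / of_real \<tau>))"
proof (rule Bochner_Integration.integrable_bound)
  show "integrable lborel (\<lambda>v. M * exp ((norm \<zeta>)\<^sup>2 / \<tau>) * exp (K * \<bar>v\<bar> - v\<^sup>2 / (2 * \<tau>)))"
    using integrable_exp_abs_gaussian[of "2 * \<tau>" K] assms(1) by simp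
  show "AE v in lborel. norm (\<phi> v * exp ((\<i> * of_real v - \<zeta>)\<^sup>2 / of_real \<tau>))
      \<le> norm (M * exp ((norm \<zeta>)\<^sup>2 / \<tau>) * exp (K * \<bar>v\<bar> - v\<^sup>2 / (2 * \<tau>)))"
  proof (intro AE_I2)
    fix v :: real
    have "norm (\<phi> v * exp ((\<i> * of_real v - \<zeta>)\<^sup>2 / of_real \<tau>))
       \<le> (M * exp (K * \<bar>v\<bar>)) * (exp ((norm \<zeta>)\<^sup>2 / \<tau>) * exp (- v\<^sup>2 / (2 * \<tau>)))"
      unfolding norm_mult
      by (rule mult_mono[OF \<phi> norm_gaussian_kernel_le[OF assms(1) order_refl]])
        (use order_trans[OF norm_ge_zero \<phi>] in auto)
    also have "\<dots> = M * exp ((norm \<zeta>)\<^sup>2 / \<tau>) * exp (K * \<bar>v\<bar> - v\<^sup>2 / (2 * \<tau>))"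
      by (simp add: exp_diff exp_minus field_simps)
    also have "\<dots> \<le> norm \<dots>" by simp
    finally show "norm (\<phi> v * exp ((\<i> * of_real v - \<zeta>)\<^sup>2 / of_real \<tau>))
      \<le> norm (M * exp ((norm \<zeta>)\<^sup>2 / \<tau>) * exp (K * \<bar>v\<bar> - v\<^sup>2 / (2 * \<tau>)))" .
  qed
qed measurable

text \<open>The value does not depend on the complex centre \<zeta>: its imaginary part is removed
  by translating along the line, its real part by moving the line.\<close>

lemma
  assumes "\<tau> > 0"
  shows integrable_gaussian_kernel: "integrable lborel (\<lambda>v. exp ((\<i> * of_real v - \<zeta>)\<^sup>2 / of_real \<tau>))"
    and integral_gaussian_kernel:
      "(LINT v|lborel. exp ((\<i> * of_real v - \<zeta>)\<^sup>2 / of_real \<tau>)) = of_real (sqrt (pi * \<tau>))"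
proof -
  show "integrable lborel (\<lambda>v. exp ((\<i> * of_real v - \<zeta>)\<^sup>2 / of_real \<tau>))"
    using integrable_gaussian_kernel_mult[OF assms, of "\<lambda>_. 1" 1 0] by simp
  define f where "f z = exp (z\<^sup>2 / complex_of_real \<tau>)" for z
  have bound: "norm (f (of_real x + \<i> * of_real v)) \<le> exp (r\<^sup>2 / \<tau>) * exp (- (1 / \<tau>) * v\<^sup>2)"
    if "\<bar>x\<bar> \<le> \<bar>r\<bar>" for x v r
  proof -
    have "norm (f (of_real x + \<i> * of_real v)) = exp ((x\<^sup>2 - v\<^sup>2) / \<tau>)"
      by (simp add: f_def Re_divide_of_real power2_eq_square)
    also have "\<dots> \<le> exp ((r\<^sup>2 - v\<^sup>2) / \<tau>)"
      using that assms by (simp add: divide_right_mono abs_le_square_iff)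
    finally show ?thesis by (simp add: diff_divide_distrib exp_diff exp_minus field_simps)
  qed
  have hol: "f holomorphic_on UNIV"
    unfolding f_def using assms by (intro holomorphic_intros) auto
  have "(LINT v|lborel. exp ((\<i> * of_real v - \<zeta>)\<^sup>2 / of_real \<tau>))
      = (LINT v|lborel. f (of_real (- Re \<zeta>) + \<i> * of_real (- Im \<zeta> + 1 * v)))"
    unfolding f_def by (intro Bochner_Integration.integral_cong refl arg_cong[of _ _ exp] arg_cong2[of _ _ _ _ "(/)"]
        arg_cong[of _ _ "\<lambda>z. z\<^sup>2"]) (simp_all add: complex_eq_iff)
  also have "\<dots> = (LINT v|lborel. f (of_real (- Re \<zeta>) + \<i> * of_real v))"
    by (subst (2) lborel_integral_real_affine[of 1 _ "- Im \<zeta>"]) auto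
  also have "\<dots> = (LINT v|lborel. f (of_real 0 + \<i> * of_real v))"
  proof (cases "Re \<zeta> \<ge> 0")
    case True
    show ?thesis
      by (rule integral_vertical_lines_eq[OF hol, of "1 / \<tau>" _ _ "exp ((Re \<zeta>)\<^sup>2 / \<tau>)"])
        (use assms True in \<open>auto intro!: bound[simplified]\<close>)
  next
    case False
    show ?thesis
      by (rule integral_vertical_lines_eq[OF hol, of "1 / \<tau>" _ _ "exp ((Re \<zeta>)\<^sup>2 / \<tau>)", symmetric])
        (use assms False in \<open>auto intro!: bound[simplified]\<close>)
  qed
  also have "\<dots> = (LINT v|lborel. complex_of_real (exp (- v\<^sup>2 / \<tau>)))"
    by (intro Bochner_Integration.integral_cong refl) (simp add: f_def power_mult_distrib flip: exp_of_real)
  also have "\<dots> = of_real (sqrt (pi * \<tau>))"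
    using integral_gaussian[OF assms] by (simp only: integral_complex_of_real)
  finally show "(LINT v|lborel. exp ((\<i> * of_real v - \<zeta>)\<^sup>2 / of_real \<tau>)) = of_real (sqrt (pi * \<tau>))" .
qed

text \<open>Expanding the exponential gives a power series in the parameter that converges everywhere.\<close>

lemma holomorphic_exp_integral:
  fixes \<psi> :: "real \<Rightarrow> complex" and c :: complex
  assumes [measurable]: "\<psi> \<in> borel_measurable borel"
    and int: "\<And>A. integrable lborel (\<lambda>v. norm (\<psi> v) * exp (A * \<bar>v\<bar>))"
  shows "(\<lambda>\<zeta>. LINT v|lborel. \<psi> v * exp (c * of_real v * \<zeta>)) holomorphic_on UNIV"
proof -
  define f where "f \<zeta> n v = \<psi> v * ((c * of_real v * \<zeta>) ^ n / fact n)" for \<zeta> n v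
  define b where "b n = (LINT v|lborel. \<psi> v * ((c * of_real v) ^ n / fact n))" for n
  have meas [measurable]: "f \<zeta> n \<in> borel_measurable borel" for \<zeta> n
    unfolding f_def[abs_def] by measurable
  have norm_f: "norm (f \<zeta> n v) = norm (\<psi> v) * ((norm (c * \<zeta>) * \<bar>v\<bar>) ^ n / fact n)" for \<zeta> n v
    by (simp add: f_def norm_mult norm_divide norm_power power_mult_distrib field_simps)
  have exp_sums: "(\<lambda>n. x ^ n / fact n) sums exp x" for x :: real
    using exp_converges[of x] by (simp add: divide_inverse mult.commute)
  \<comment> \<open>Gives the integrability of each term as well as a common bound for the partial
    sums of the L1 norms, so that sum and integral may be exchanged.\<close>
  have partial: "(\<Sum>n<N. norm (f \<zeta> n v)) \<le> norm (\<psi> v) * exp (norm (c * \<zeta>) * \<bar>v\<bar>)" for \<zeta> v N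
    unfolding norm_f sum_distrib_left[symmetric]
    using sum_le_suminf[OF sums_summable[OF exp_sums], of "{..<N}" "norm (c * \<zeta>) * \<bar>v\<bar>"] exp_sums
    by (intro mult_left_mono) (auto simp: sums_iff)
  have int_f: "integrable lborel (f \<zeta> n)" for \<zeta> n
  proof (rule Bochner_Integration.integrable_bound[OF int[of "norm (c * \<zeta>)"]])
    show "AE v in lborel. norm (f \<zeta> n v) \<le> norm (norm (\<psi> v) * exp (norm (c * \<zeta>) * \<bar>v\<bar>))"
      using order_trans[OF member_le_sum[of n "{..<Suc n}" "\<lambda>n. norm (f \<zeta> n _)"] partial]
      by (auto intro!: AE_I2)
  qed simp
  have "(\<lambda>n. b n * (\<zeta> - 0) ^ n) sums (LINT v|lborel. \<psi> v * exp (c * of_real v * \<zeta>))" for \<zeta>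
  proof -
    have "(\<lambda>n. integral\<^sup>L lborel (f \<zeta> n)) sums (LINT v|lborel. (\<Sum>n. f \<zeta> n v))"
    proof (rule sums_integral[OF int_f])
      show "AE v in lborel. summable (\<lambda>n. norm (f \<zeta> n v))"
        unfolding norm_f by (intro AE_I2 summable_mult sums_summable[OF exp_sums])
      show "summable (\<lambda>n. LINT v|lborel. norm (f \<zeta> n v))"
      proof (rule summableI_nonneg_bounded)
        fix N
        have "(\<Sum>n<N. LINT v|lborel. norm (f \<zeta> n v)) = (LINT v|lborel. (\<Sum>n<N. norm (f \<zeta> n v)))"
          using int_f by (subst Bochner_Integration.integral_sum) auto
        also have "\<dots> \<le> (LINT v|lborel. norm (\<psi> v) * exp (norm (c * \<zeta>) * \<bar>v\<bar>))"
          using int_f int partial by (intro integral_mono Bochner_Integration.integrable_sum) auto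
        finally show "(\<Sum>n<N. LINT v|lborel. norm (f \<zeta> n v))
          \<le> (LINT v|lborel. norm (\<psi> v) * exp (norm (c * \<zeta>) * \<bar>v\<bar>))" .
      qed auto
    qed
    moreover have "(\<Sum>n. f \<zeta> n v) = \<psi> v * exp (c * of_real v * \<zeta>)" for v
    proof -
      have "(\<lambda>n. f \<zeta> n v) sums (\<psi> v * exp (c * of_real v * \<zeta>))"
        unfolding f_def using exp_converges[of "c * of_real v * \<zeta>"]
        by (intro sums_mult) (simp add: scaleR_conv_of_real divide_inverse mult.commute)
      then show ?thesis by (simp add: sums_iff)
    qed
    moreover have "integral\<^sup>L lborel (f \<zeta> n) = b n * (\<zeta> - 0) ^ n" for n
    proof -
      have "f \<zeta> n = (\<lambda>v. (\<psi> v * ((c * of_real v) ^ n / fact n)) * \<zeta> ^ n)"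
        by (simp add: f_def fun_eq_iff power_mult_distrib)
      then show ?thesis by (simp add: b_def)
    qed
    ultimately show ?thesis by simp
  qed
  then have "(\<lambda>\<zeta>. LINT v|lborel. \<psi> v * exp (c * of_real v * \<zeta>)) holomorphic_on (\<Union>r. ball 0 (real r))"
    by (intro holomorphic_on_UN_open power_series_holomorphic) auto
  also have "(\<Union>r. ball (0::complex) (real r)) = UNIV"
    using reals_Archimedean2 by auto
  finally show ?thesis .
qed

text \<open>Expanding the square splits off exp (\<zeta>^2/\<tau>) and a Gaussian weight in
  \<open>v\<close>. What remains of \<zeta> is a linear exponent, which
  \<open>holomorphic_exp_integral\<close> handles.\<close>

lemma holomorphic_gaussian_kernel_integral:
  fixes \<phi> :: "real \<Rightarrow> complex"
  assumes "\<tau> > 0" and [measurable]: "\<phi> \<in> borel_measurable borel"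
    and \<phi>: "\<And>v. norm (\<phi> v) \<le> M * exp (K * \<bar>v\<bar>)"
  shows "(\<lambda>\<zeta>. LINT v|lborel. \<phi> v * exp ((\<i> * of_real v - \<zeta>)\<^sup>2 / of_real \<tau>)) holomorphic_on UNIV"
proof -
  define \<psi> where "\<psi> v = \<phi> v * exp (- (of_real v)\<^sup>2 / of_real \<tau>)" for v
  have [measurable]: "\<psi> \<in> borel_measurable borel"
    unfolding \<psi>_def[abs_def] by measurable
  have "integrable lborel (\<lambda>v. norm (\<psi> v) * exp (A * \<bar>v\<bar>))" for A
  proof (rule Bochner_Integration.integrable_bound)
    show "integrable lborel (\<lambda>v. M * exp ((K + A) * \<bar>v\<bar> - v\<^sup>2 / \<tau>))"
      using integrable_exp_abs_gaussian[OF assms(1)] by simp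
    show "AE v in lborel. norm (norm (\<psi> v) * exp (A * \<bar>v\<bar>)) \<le> norm (M * exp ((K + A) * \<bar>v\<bar> - v\<^sup>2 / \<tau>))"
    proof (intro AE_I2)
      fix v :: real
      have "norm (\<psi> v) * exp (A * \<bar>v\<bar>) = norm (\<phi> v) * (exp (- v\<^sup>2 / \<tau>) * exp (A * \<bar>v\<bar>))"
        by (simp add: \<psi>_def norm_mult Re_divide_of_real flip: of_real_power)
      also have "\<dots> \<le> M * exp (K * \<bar>v\<bar>) * (exp (- v\<^sup>2 / \<tau>) * exp (A * \<bar>v\<bar>))"
        by (intro mult_right_mono \<phi>) auto
      also have "\<dots> = M * exp ((K + A) * \<bar>v\<bar> - v\<^sup>2 / \<tau>)"
        by (simp add: algebra_simps flip: exp_add)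
      finally show "norm (norm (\<psi> v) * exp (A * \<bar>v\<bar>)) \<le> norm (M * exp ((K + A) * \<bar>v\<bar> - v\<^sup>2 / \<tau>))"
        by simp
    qed
  qed measurable
  then have "(\<lambda>\<zeta>. exp (\<zeta>\<^sup>2 / of_real \<tau>) * (LINT v|lborel. \<psi> v * exp (- 2 * \<i> / of_real \<tau> * of_real v * \<zeta>))) holomorphic_on UNIV"
    using assms(1) by (intro holomorphic_intros holomorphic_exp_integral) auto
  also have "(\<lambda>\<zeta>. exp (\<zeta>\<^sup>2 / of_real \<tau>) * (LINT v|lborel. \<psi> v * exp (- 2 * \<i> / of_real \<tau> * of_real v * \<zeta>)))
     = (\<lambda>\<zeta>. LINT v|lborel. \<phi> v * exp ((\<i> * of_real v - \<zeta>)\<^sup>2 / of_real \<tau>))"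
  proof
    fix \<zeta>
    have "\<phi> v * exp ((\<i> * of_real v - \<zeta>)\<^sup>2 / of_real \<tau>)
       = exp (\<zeta>\<^sup>2 / of_real \<tau>) * (\<psi> v * exp (- 2 * \<i> / of_real \<tau> * of_real v * \<zeta>))" for v
    proof -
      have "(\<i> * of_real v - \<zeta>)\<^sup>2 / of_real \<tau> = \<zeta>\<^sup>2 / of_real \<tau> + - (of_real v)\<^sup>2 / of_real \<tau> + - 2 * \<i> / of_real \<tau> * of_real v * \<zeta>"
        using assms(1) by (simp add: field_simps power2_eq_square)
      then show ?thesis by (simp only: \<psi>_def exp_add mult_ac)
    qed
    then show "exp (\<zeta>\<^sup>2 / of_real \<tau>) * (LINT v|lborel. \<psi> v * exp (- 2 * \<i> / of_real \<tau> * of_real v * \<zeta>))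
      = (LINT v|lborel. \<phi> v * exp ((\<i> * of_real v - \<zeta>)\<^sup>2 / of_real \<tau>))"
      by simp
  qed
  finally show ?thesis .
qed

section \<open>The Gamma function on vertical lines\<close>

lemma norm_pochhammer_ge:
  fixes z :: complex
  assumes "Re z > 0"
  shows "pochhammer (Re z) n \<le> norm (pochhammer z n)"
  unfolding pochhammer_prod prod_norm[symmetric]
proof (rule prod_mono)
  fix i
  show "0 \<le> Re z + real i \<and> Re z + real i \<le> cmod (z + of_nat i)"
    using assms complex_Re_le_cmod[of "z + of_nat i"] by simp
qed

text \<open>Termwise in Gauss's product: the numerator depends in norm on Re z alone, and leaving
  the real axis only enlarges the Pochhammer symbol in the denominator.\<close>

lemma norm_Gamma_le_Gamma_Re:
  fixes z :: complex
  assumes "Re z > 0"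
  shows "norm (Gamma z) \<le> Gamma (Re z)"
proof (rule LIMSEQ_le)
  show "(\<lambda>n. norm (Gamma_series z n)) \<longlonglongrightarrow> norm (Gamma z)"
    by (intro tendsto_intros Gamma_series_LIMSEQ)
  show "(\<lambda>n. Gamma_series (Re z) n) \<longlonglongrightarrow> Gamma (Re z)"
    by (rule Gamma_series_LIMSEQ)
  have "norm (Gamma_series z n) \<le> Gamma_series (Re z) n" for n
  proof -
    have "norm (Gamma_series z n) = fact n * exp (Re z * ln n) / norm (pochhammer z (n + 1))"
      by (simp add: Gamma_series_def norm_mult norm_divide)
    also have "\<dots> \<le> fact n * exp (Re z * ln n) / pochhammer (Re z) (n + 1)"
      using norm_pochhammer_ge[OF assms, of "n + 1"] pochhammer_pos[OF assms, of "n + 1"]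
      by (intro divide_left_mono mult_pos_pos) auto
    finally show ?thesis by (simp add: Gamma_series_def)
  qed
  then show "\<exists>N. \<forall>n\<ge>N. norm (Gamma_series z n) \<le> Gamma_series (Re z) n" by blast
qed

section \<open>Digamma compared with the principal logarithm\<close>

lemma norm_Ln_diff_le:
  assumes "convex S" and "a > 0" and "\<And>z. z \<in> S \<Longrightarrow> z \<notin> \<real>\<^sub>\<le>\<^sub>0 \<and> a \<le> norm z" and "z \<in> S" "w \<in> S"
  shows "norm (Ln z - Ln w) \<le> norm (z - w) / a"
proof -
  have "norm (Ln z - Ln w) \<le> (1 / a) * norm (z - w)"
  proof (rule field_differentiable_bound[OF assms(1)])
    fix u assume u: "u \<in> S"
    show "(Ln has_field_derivative inverse u) (at u within S)"
      using assms(3)[OF u] by (intro has_field_derivative_Ln DERIV_subset[OF _ subset_UNIV]) auto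
    show "norm (inverse u) \<le> 1 / a"
      using assms(2) assms(3)[OF u] by (simp add: norm_divide inverse_eq_divide frac_le)
  qed fact+
  then show ?thesis by simp
qed

text \<open>One step of the telescoping in \<open>norm_Digamma_minus_Ln_le\<close>: from z to z + 1
  Digamma grows by exactly 1/z, and Ln by nearly as much, since on the way the derivatives of Ln (z
  + s) and s/z differ by at most 1/|z|^2.\<close>

lemma norm_Ln_step_le:
  assumes "Re z > 0"
  shows "norm (1 / z - (Ln (z + 1) - Ln z)) \<le> 1 / (norm z)\<^sup>2"
proof -
  define f where "f s = Ln (z + s) - s / z" for s
  have "norm (f 1 - f 0) \<le> 1 / (norm z)\<^sup>2 * norm (1 - 0 :: complex)"
  proof (rule field_differentiable_bound)
    fix s :: complex assume "s \<in> closed_segment 0 1"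
    then obtain u where u: "0 \<le> u" "u \<le> 1" and s: "s = of_real u"
      by (auto simp: closed_segment_def scaleR_conv_of_real)
    have "z + s \<notin> \<real>\<^sub>\<le>\<^sub>0"
      using assms u by (auto simp: complex_nonpos_Reals_iff s)
    moreover have nz: "z \<noteq> 0" "z + s \<noteq> 0" using assms u by (auto simp: complex_eq_iff s)
    ultimately show "(f has_field_derivative (1 / (z + s) - 1 / z)) (at s within closed_segment 0 1)"
      unfolding f_def by (auto intro!: derivative_eq_intros simp: divide_inverse)
    have "1 / (z + s) - 1 / z = - s / (z * (z + s))"
      using nz by (simp add: field_simps)
    then have "norm (1 / (z + s) - 1 / z) = u / (norm z * norm (z + s))"
      using u by (simp add: norm_divide norm_mult s)
    also have "\<dots> \<le> 1 / (norm z * norm z)"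
    proof (rule frac_le)
      show "norm z * norm z \<le> norm z * norm (z + s)"
        using assms u by (intro mult_left_mono) (auto simp: cmod_def s intro!: power_mono)
    qed (use nz u in auto)
    finally show "norm (1 / (z + s) - 1 / z) \<le> 1 / (norm z)\<^sup>2" by (simp add: power2_eq_square)
  qed auto
  moreover have "f 1 - f 0 = - (1 / z - (Ln (z + 1) - Ln z))" by (simp add: f_def)
  ultimately show ?thesis by (simp only: norm_minus_cancel) simp
qed

text \<open>The sum of 1/|x + iy + n|^2, that is, the accumulated step errors; it serves as explicit
  remainder in the asymptotics of Digamma.\<close>

definition gamma_tail :: "real \<Rightarrow> real \<Rightarrow> real"
  where "gamma_tail x y = (\<Sum>n. 1 / ((x + real n)\<^sup>2 + y\<^sup>2))"

lemma summable_inverse_shift_squares: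
  fixes x :: real
  assumes "x > 0"
  shows "summable (\<lambda>n. 1 / (x + real n)\<^sup>2)"
proof (rule summable_comparison_test_ev)
  show "summable (\<lambda>n. inverse (real n ^ 2))" by (rule inverse_power_summable) auto
  show "\<forall>\<^sub>F n in sequentially. norm (1 / (x + real n)\<^sup>2) \<le> inverse (real n ^ 2)"
    using eventually_gt_at_top[of 0]
    by eventually_elim (use assms in \<open>auto simp: divide_inverse intro!: le_imp_inverse_le power_mono\<close>)
qed

lemma gamma_tail_term_le:
  fixes x :: real
  assumes "x > 0"
  shows "1 / ((x + real n)\<^sup>2 + y\<^sup>2) \<le> 1 / (x + real n)\<^sup>2"
  using assms by (intro divide_left_mono mult_pos_pos) (auto intro!: add_pos_nonneg)

lemma summable_gamma_tail:
  fixes x :: real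
  assumes "x > 0"
  shows "summable (\<lambda>n. 1 / ((x + real n)\<^sup>2 + y\<^sup>2))"
  by (rule summable_comparison_test[OF _ summable_inverse_shift_squares[OF assms]])
    (use gamma_tail_term_le[OF assms] in auto)

lemma gamma_tail_antimono:
  assumes "x > 0" and "\<bar>y\<bar> \<le> \<bar>y'\<bar>"
  shows "gamma_tail x y' \<le> gamma_tail x y"
  unfolding gamma_tail_def
proof (intro suminf_le summable_gamma_tail assms)
  fix n
  show "1 / ((x + real n)\<^sup>2 + y'\<^sup>2) \<le> 1 / ((x + real n)\<^sup>2 + y\<^sup>2)"
    using assms by (intro divide_left_mono add_left_mono mult_pos_pos)
      (auto intro!: add_pos_nonneg simp: abs_le_square_iff)
qed

lemma gamma_tail_tendsto_0:
  assumes "x > 0"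
  shows "(gamma_tail x \<longlongrightarrow> 0) at_top"
proof -
  have "((\<lambda>y. \<Sum>n. 1 / ((x + real n)\<^sup>2 + y\<^sup>2)) \<longlongrightarrow> (\<Sum>n. 0)) at_top"
  proof (rule tannerys_theorem[THEN conjunct2, THEN conjunct2])
    show "((\<lambda>y. 1 / ((x + real n)\<^sup>2 + y\<^sup>2)) \<longlongrightarrow> 0) at_top" for n
      by real_asymp
    show "\<forall>\<^sub>F (k, n) in sequentially \<times>\<^sub>F at_top. norm (1 / ((x + real k)\<^sup>2 + n\<^sup>2)) \<le> 1 / (x + real k)\<^sup>2"
      using gamma_tail_term_le[OF assms] by (intro always_eventually) auto
  qed (use summable_inverse_shift_squares[OF assms] in auto)
  then show ?thesis unfolding gamma_tail_def[abs_def] by simp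
qed

text \<open>The difference at z + N tends to 0 as N grows, and going back to z costs the sum of the
  step errors.\<close>

lemma norm_Digamma_minus_Ln_le:
  assumes "Re z > 0"
  shows "norm (Digamma z - Ln z) \<le> gamma_tail (Re z) (Im z)"
proof -
  define r where "r N = Digamma (z + of_nat N) - Ln (z + of_nat N)" for N
  have nz: "z + of_nat N \<noteq> 0" for N
    using assms by (auto simp: complex_eq_iff)
  have step: "norm (r (Suc N) - r N) \<le> 1 / ((Re z + real N)\<^sup>2 + (Im z)\<^sup>2)" for N
  proof -
    have "r (Suc N) - r N = 1 / (z + of_nat N) - (Ln (z + of_nat N + 1) - Ln (z + of_nat N))"
      using Digamma_plus1[OF nz] by (simp add: r_def algebra_simps)
    then show ?thesis
      using norm_Ln_step_le[of "z + of_nat N"] assms by (simp add: cmod_power2)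
  qed
  have Dig: "Digamma (z + of_nat N) = Digamma z + (\<Sum>n<N. inverse (z + of_nat n))" for N
  proof (induction N)
    case (Suc N)
    then show ?case using Digamma_plus1[OF nz[of N]] by (simp add: algebra_simps inverse_eq_divide)
  qed simp
  \<comment> \<open>\<open>Digamma_LIMSEQ\<close> says that ln N minus the first N reciprocals
    converges to Digamma z, so Digamma (z + N) - ln N vanishes in the limit; and Ln (z + N) is
    within |z|/N of ln N.\<close>
  have r0: "r \<longlonglongrightarrow> 0"
  proof -
    have "(\<lambda>N. Digamma z - (of_real (ln (real N)) - (\<Sum>n<N. inverse (z + of_nat n)))) \<longlonglongrightarrow> Digamma z - Digamma z"
      using nz[of 0] by (intro tendsto_intros Digamma_LIMSEQ) auto
    moreover have "(\<lambda>N. Ln (z + of_nat N) - of_real (ln (real N))) \<longlonglongrightarrow> 0"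
    proof (rule Lim_null_comparison)
      show "\<forall>\<^sub>F N in sequentially. norm (Ln (z + of_nat N) - of_real (ln (real N))) \<le> norm z / real N"
        using eventually_gt_at_top[of 0]
      proof eventually_elim
        case (elim N)
        have "norm (Ln (z + of_nat N) - Ln (of_nat N)) \<le> norm (z + of_nat N - of_nat N) / real N"
        proof (rule norm_Ln_diff_le[of "{w. real N \<le> Re w}"])
          show "convex {w. real N \<le> Re w}" by (rule convex_halfspace_Re_ge)
          fix w assume "w \<in> {w. real N \<le> Re w}"
          then show "w \<notin> \<real>\<^sub>\<le>\<^sub>0 \<and> real N \<le> norm w"
            using elim complex_Re_le_cmod[of w] by (auto simp: complex_nonpos_Reals_iff)
        qed (use assms elim in auto)
        then show ?case using elim by (simp add: Ln_of_nat)
      qed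
      show "(\<lambda>N. norm z / real N) \<longlonglongrightarrow> 0" by real_asymp
    qed
    ultimately have "(\<lambda>N. (Digamma z - (of_real (ln (real N)) - (\<Sum>n<N. inverse (z + of_nat n))))
        - (Ln (z + of_nat N) - of_real (ln (real N)))) \<longlonglongrightarrow> (Digamma z - Digamma z) - 0"
      by (rule tendsto_diff)
    then show ?thesis by (simp add: r_def[abs_def] Dig algebra_simps)
  qed
  have "norm (r 0) \<le> norm (r N) + gamma_tail (Re z) (Im z)" for N
  proof -
    have "r 0 = r N - (\<Sum>n<N. r (Suc n) - r n)" by (simp add: sum_lessThan_telescope)
    also have "norm \<dots> \<le> norm (r N) + norm (\<Sum>n<N. r (Suc n) - r n)" by (rule norm_triangle_ineq4)
    also have "norm (\<Sum>n<N. r (Suc n) - r n) \<le> (\<Sum>n<N. 1 / ((Re z + real n)\<^sup>2 + (Im z)\<^sup>2))"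
      by (rule order_trans[OF norm_sum sum_mono[OF step]])
    also have "\<dots> \<le> gamma_tail (Re z) (Im z)"
      unfolding gamma_tail_def by (intro sum_le_suminf summable_gamma_tail assms) auto
    finally show ?thesis by simp
  qed
  moreover have "(\<lambda>N. norm (r N) + gamma_tail (Re z) (Im z)) \<longlonglongrightarrow> norm (0::complex) + gamma_tail (Re z) (Im z)"
    by (intro tendsto_intros r0)
  ultimately have "norm (r 0) \<le> norm (0::complex) + gamma_tail (Re z) (Im z)"
    by (intro LIMSEQ_le_const) auto
  then show ?thesis by (simp add: r_def)
qed

lemma DERIV_ln_Gamma_vertical:
  assumes "Re W > 0"
  shows "((\<lambda>s. ln_Gamma (W + \<i> * s) - \<i> * s * c) has_field_derivative (\<i> * (Digamma (W + \<i> * of_real h) - c)))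
     (at (of_real h) within S)"
proof -
  have "W + \<i> * of_real h \<notin> \<real>\<^sub>\<le>\<^sub>0" using assms by (auto simp: complex_nonpos_Reals_iff)
  then show ?thesis by (auto intro!: derivative_eq_intros simp: algebra_simps)
qed

text \<open>The factor by which the Gamma quotient along a vertical line deviates from its
  leading Stirling term.\<close>

definition gamma_ratio :: "complex \<Rightarrow> real \<Rightarrow> complex"
  where "gamma_ratio W h = Gamma (W + \<i> * of_real h) / Gamma W * exp (- (\<i> * of_real h * Ln W))"

lemma gamma_ratio_eq_exp:
  assumes "Re W > 0"
  shows "gamma_ratio W h = exp ((ln_Gamma (W + \<i> * of_real h) - \<i> * of_real h * Ln W) - ln_Gamma W)"
proof -
  have "W + \<i> * of_real h \<notin> \<int>\<^sub>\<le>\<^sub>0" "W \<notin> \<int>\<^sub>\<le>\<^sub>0"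
    using assms by (auto elim!: nonpos_Ints_cases simp: complex_eq_iff)
  then show ?thesis
    by (simp add: gamma_ratio_def Gamma_complex_altdef exp_diff exp_minus exp_add field_simps)
qed

text \<open>Absolute values retain only the imaginary part of Digamma - Ln W in the logarithmic
  derivative, so growth of the logarithm drops out: arguments differ by at most 2 pi, and the tail
  is largest on the real axis. The rate is thus independent of the imaginary part of
  \<open>W\<close>, which makes it a majorant for all heights.\<close>

lemma norm_gamma_ratio_le:
  assumes "Re W > 0"
  shows "norm (gamma_ratio W h) \<le> exp ((gamma_tail (Re W) 0 + 2 * pi) * \<bar>h\<bar>)"
proof -
  define f where "f u = Re (ln_Gamma (W + \<i> * of_real u) - \<i> * of_real u * Ln W)" for u
  have "norm (f h - f 0) \<le> (gamma_tail (Re W) 0 + 2 * pi) * norm (h - 0)"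
  proof (rule field_differentiable_bound)
    fix u :: real
    have "((\<lambda>s. ln_Gamma (W + \<i> * of_real s) - \<i> * of_real s * Ln W) has_vector_derivative
        (\<i> * (Digamma (W + \<i> * of_real u) - Ln W))) (at u)"
      using DERIV_ln_Gamma_vertical[OF assms] by (rule has_vector_derivative_real_field)
    then show "(f has_field_derivative Re (\<i> * (Digamma (W + \<i> * of_real u) - Ln W))) (at u within UNIV)"
      unfolding f_def[abs_def] has_real_derivative_iff_has_vector_derivative
      by (rule bounded_linear.has_vector_derivative[OF bounded_linear_Re])
    have "norm (Re (\<i> * (Digamma (W + \<i> * of_real u) - Ln W)))
       = \<bar>Im (Digamma (W + \<i> * of_real u) - Ln (W + \<i> * of_real u)) + Im (Ln (W + \<i> * of_real u)) - Im (Ln W)\<bar>"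
      by simp
    also have "\<dots> \<le> gamma_tail (Re W) 0 + 2 * pi"
    proof -
      have "\<bar>Im (Digamma (W + \<i> * of_real u) - Ln (W + \<i> * of_real u))\<bar> \<le> gamma_tail (Re W) (Im W + u)"
        using norm_Digamma_minus_Ln_le[of "W + \<i> * of_real u"] assms abs_Im_le_cmod order_trans by fastforce
      moreover have "gamma_tail (Re W) (Im W + u) \<le> gamma_tail (Re W) 0"
        using assms by (intro gamma_tail_antimono) auto
      moreover have "\<bar>Im (Ln z)\<bar> \<le> pi" if "Re z > 0" for z
        using that mpi_less_Im_Ln[of z] Im_Ln_le_pi[of z] by fastforce
      from this[of W] this[of "W + \<i> * of_real u"]
      have "\<bar>Im (Ln W)\<bar> \<le> pi" "\<bar>Im (Ln (W + \<i> * of_real u))\<bar> \<le> pi" using assms by auto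
      ultimately show ?thesis by linarith
    qed
    finally show "norm (Re (\<i> * (Digamma (W + \<i> * of_real u) - Ln W))) \<le> gamma_tail (Re W) 0 + 2 * pi" .
  qed auto
  moreover have "norm (gamma_ratio W h) = exp (f h - f 0)"
    by (simp add: gamma_ratio_eq_exp[OF assms] f_def)
  ultimately show ?thesis by (simp add: abs_le_iff)
qed

text \<open>On a segment of fixed length the derivative of the logarithm, a unit times Digamma (W +
  iu) - Ln W, tends to 0 uniformly: Digamma is close to Ln by the tail estimate, and Ln changes
  little far from the origin.\<close>

lemma gamma_ratio_tendsto_1:
  assumes "x > 0"
  shows "((\<lambda>y. gamma_ratio (Complex x y) h) \<longlongrightarrow> 1) at_top"
proof -
  define L where "L y = (ln_Gamma (Complex x y + \<i> * of_real h) - \<i> * of_real h * Ln (Complex x y)) - ln_Gamma (Complex x y)" for y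
  have "(L \<longlongrightarrow> 0) at_top"
  proof (rule Lim_null_comparison)
    show "\<forall>\<^sub>F y in at_top. norm (L y) \<le> (gamma_tail x (y - \<bar>h\<bar>) + \<bar>h\<bar> / (y - \<bar>h\<bar>)) * \<bar>h\<bar>"
      using eventually_gt_at_top[of "\<bar>h\<bar>"]
    proof eventually_elim
      case (elim y)
      define W where "W = Complex x y"
      define f where "f s = ln_Gamma (W + \<i> * s) - \<i> * s * Ln W" for s
      have "norm (f (of_real h) - f 0) \<le> (gamma_tail x (y - \<bar>h\<bar>) + \<bar>h\<bar> / (y - \<bar>h\<bar>)) * norm (complex_of_real h - 0)"
      proof (rule field_differentiable_bound)
        fix s assume "s \<in> closed_segment 0 (complex_of_real h)"
        then obtain c where c: "0 \<le> c" "c \<le> 1" "s = of_real (c * h)"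
          by (auto simp: closed_segment_def scaleR_conv_of_real)
        define u where "u = c * h"
        have u: "\<bar>u\<bar> \<le> \<bar>h\<bar>" "s = of_real u"
          using c by (auto simp: u_def abs_mult mult_left_le_one_le)
        show "(f has_field_derivative (\<i> * (Digamma (W + \<i> * s) - Ln W))) (at s within closed_segment 0 (of_real h))"
          unfolding f_def u(2) using assms by (intro DERIV_ln_Gamma_vertical) (simp add: W_def)
        have "norm (\<i> * (Digamma (W + \<i> * s) - Ln W))
           = norm ((Digamma (W + \<i> * of_real u) - Ln (W + \<i> * of_real u)) + (Ln (W + \<i> * of_real u) - Ln W))"
          by (simp add: norm_mult u(2))
        also have "\<dots> \<le> norm (Digamma (W + \<i> * of_real u) - Ln (W + \<i> * of_real u)) + norm (Ln (W + \<i> * of_real u) - Ln W)"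
          by (rule norm_triangle_ineq)
        also have "norm (Digamma (W + \<i> * of_real u) - Ln (W + \<i> * of_real u)) \<le> gamma_tail x (y + u)"
          using norm_Digamma_minus_Ln_le[of "W + \<i> * of_real u"] assms by (simp add: W_def)
        also have "gamma_tail x (y + u) \<le> gamma_tail x (y - \<bar>h\<bar>)"
          using assms u elim by (intro gamma_tail_antimono) auto
        also have "norm (Ln (W + \<i> * of_real u) - Ln W) \<le> norm (W + \<i> * of_real u - W) / (y - \<bar>h\<bar>)"
        \<comment> \<open>This half-plane is convex, contains both points, avoids the branch cut and
          keeps distance \<open>y - \<bar>h\<bar>\<close> from 0.\<close>
        proof (rule norm_Ln_diff_le[of "{w. y - \<bar>h\<bar> \<le> Im w}"])
          show "convex {w. y - \<bar>h\<bar> \<le> Im w}" by (rule convex_halfspace_Im_ge)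
          fix w assume "w \<in> {w. y - \<bar>h\<bar> \<le> Im w}"
          then show "w \<notin> \<real>\<^sub>\<le>\<^sub>0 \<and> y - \<bar>h\<bar> \<le> norm w"
            using elim abs_Im_le_cmod[of w] by (auto simp: complex_nonpos_Reals_iff)
        qed (use elim u in \<open>auto simp: W_def\<close>)
        also have "norm (W + \<i> * of_real u - W) / (y - \<bar>h\<bar>) \<le> \<bar>h\<bar> / (y - \<bar>h\<bar>)"
          using elim u by (auto simp: norm_mult intro!: divide_right_mono)
        finally show "norm (\<i> * (Digamma (W + \<i> * s) - Ln W)) \<le> gamma_tail x (y - \<bar>h\<bar>) + \<bar>h\<bar> / (y - \<bar>h\<bar>)"
          by simp
      qed auto
      then show ?case by (simp add: L_def f_def W_def)
    qed
    have "filterlim (\<lambda>y. y - \<bar>h\<bar>) at_top at_top" by real_asymp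
    then have "((\<lambda>y. gamma_tail x (y - \<bar>h\<bar>)) \<longlongrightarrow> 0) at_top"
      by (rule filterlim_compose[OF gamma_tail_tendsto_0[OF assms]])
    moreover have "((\<lambda>y. \<bar>h\<bar> / (y - \<bar>h\<bar>)) \<longlongrightarrow> 0) at_top" by real_asymp
    ultimately have "((\<lambda>y. (gamma_tail x (y - \<bar>h\<bar>) + \<bar>h\<bar> / (y - \<bar>h\<bar>)) * \<bar>h\<bar>) \<longlongrightarrow> (0 + 0) * \<bar>h\<bar>) at_top"
      by (intro tendsto_intros)
    then show "((\<lambda>y. (gamma_tail x (y - \<bar>h\<bar>) + \<bar>h\<bar> / (y - \<bar>h\<bar>)) * \<bar>h\<bar>) \<longlongrightarrow> 0) at_top" by simp
  qed
  then have "((\<lambda>y. exp (L y)) \<longlongrightarrow> exp 0) at_top" by (rule tendsto_exp)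
  moreover have "gamma_ratio (Complex x y) h = exp (L y)" for y
    using assms by (simp add: gamma_ratio_eq_exp L_def)
  ultimately show ?thesis by simp
qed

section \<open>Growth of entire functions\<close>

text \<open>The real part is cos (Re z) cosh (Im z), and cos (Re z) stays away from 0 here. This
  exponential growth drives the damping in \<open>phragmen_lindelof_strip\<close>.\<close>

lemma Re_cos_strip_ge:
  assumes "\<bar>Re z\<bar> \<le> pi / 4"
  shows "cos (pi / 4) * exp \<bar>Im z\<bar> / 2 \<le> Re (cos z)"
proof -
  have cos_le: "cos (pi / 4) \<le> cos (Re z)"
    using cos_monotone_0_pi_le[of "\<bar>Re z\<bar>" "pi / 4"] assms by simp
  have "0 < cos (pi / 4 :: real)" by (simp add: cos_45)
  with cos_le have "0 \<le> cos (Re z)" by linarith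
  with cos_le have "cos (pi / 4) * (exp \<bar>Im z\<bar> / 2) \<le> cos (Re z) * ((exp (Im z) + exp (- Im z)) / 2)"
    by (intro mult_mono) (simp_all add: abs_if)
  then show ?thesis by (simp add: Re_cos)
qed

text \<open>Multiplying by exp (- \<epsilon> h), with \<open>h\<close> a rescaled cosine, gives
  doubly exponential decay, which beats every finite order. The maximum principle on a large
  rectangle applies, and finally \<epsilon> tends to 0.\<close>

lemma phragmen_lindelof_strip:
  fixes f :: "complex \<Rightarrow> complex"
  assumes hol: "f holomorphic_on UNIV" and "a < b" and "A > 0" and "\<rho> > 0"
    and growth: "\<And>z. a \<le> Re z \<Longrightarrow> Re z \<le> b \<Longrightarrow> norm (f z) \<le> C * exp ((A + A * \<bar>Im z\<bar>) powr \<rho>)"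
    and bdry: "\<And>z. Re z = a \<or> Re z = b \<Longrightarrow> norm (f z) \<le> B"
    and z: "a \<le> Re z" "Re z \<le> b"
  shows "norm (f z) \<le> B"
proof -
  \<comment> \<open>Sends the half-width (b - a)/2 of the strip to pi/4, the range of
    \<open>Re_cos_strip_ge\<close>.\<close>
  define c where "c = pi / (2 * (b - a))"
  define m where "m = (a + b) / 2"
  define \<kappa> where "\<kappa> = cos (pi / 4) / 2"
  define h where "h z = cos (of_real c * (z - of_real m))" for z :: complex
  have c: "c > 0" and \<kappa>: "\<kappa> > 0"
    using \<open>a < b\<close> by (auto simp: c_def \<kappa>_def cos_45)
  have h_ge: "\<kappa> * exp (c * \<bar>Im z\<bar>) \<le> Re (h z)" if "a \<le> Re z" "Re z \<le> b" for z
  proof -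
    have "\<bar>Re z - m\<bar> \<le> (b - a) / 2"
      unfolding abs_le_iff using that by (auto simp: m_def field_simps)
    then have "c * \<bar>Re z - m\<bar> \<le> c * ((b - a) / 2)"
      using c by (intro mult_left_mono) auto
    also have "\<dots> = pi / 4" using \<open>a < b\<close> by (simp add: c_def field_simps)
    finally have "\<bar>Re (of_real c * (z - of_real m))\<bar> \<le> pi / 4"
      using c by (simp add: abs_mult)
    from Re_cos_strip_ge[OF this] show ?thesis
      using c by (simp add: h_def \<kappa>_def abs_mult)
  qed
  have B0: "0 \<le> B" using order_trans[OF norm_ge_zero bdry[of "of_real a"]] by simp
  have C0: "0 \<le> C"
  proof -
    have "0 \<le> C * exp ((A + A * \<bar>Im z\<bar>) powr \<rho>)" using growth[OF z] norm_ge_zero order_trans by blast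
    then show ?thesis by (simp add: zero_le_mult_iff not_le[symmetric])
  qed
  \<comment> \<open>The strict gap between \<open>B\<close> and \<open>B'\<close> serves the
    horizontal edges: there the damped function tends to 0, while \<open>B\<close> itself may be
    0.\<close>
  have key: "norm (f z) \<le> B' * exp (\<epsilon> * Re (h z))" if "\<epsilon> > 0" "B' > B" for \<epsilon> B'
  proof -
    define g where "g z = f z * exp (- of_real \<epsilon> * h z)" for z
    have norm_g: "norm (g z) = norm (f z) * exp (- \<epsilon> * Re (h z))" for z
      by (simp add: g_def norm_mult)
    have "((\<lambda>Y. C * exp ((A + A * Y) powr \<rho> - k * exp (c * Y))) \<longlongrightarrow> 0) at_top" if "k > 0" for k
      using that c \<open>A > 0\<close> \<open>\<rho> > 0\<close> by real_asymp
    from this[of "\<epsilon> * \<kappa>"] have "((\<lambda>Y. C * exp ((A + A * Y) powr \<rho> - \<epsilon> * (\<kappa> * exp (c * Y)))) \<longlongrightarrow> 0) at_top"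
      using that(1) \<kappa> by (simp add: mult.assoc)
    from order_tendstoD(2)[OF this, of B']
    have "\<forall>\<^sub>F Y in at_top. C * exp ((A + A * Y) powr \<rho> - \<epsilon> * (\<kappa> * exp (c * Y))) < B'"
      using B0 that(2) by simp
    then have "\<forall>\<^sub>F Y in at_top. Y > \<bar>Im z\<bar> \<and> C * exp ((A + A * Y) powr \<rho> - \<epsilon> * (\<kappa> * exp (c * Y))) < B'"
      using eventually_gt_at_top by (rule eventually_conj[rotated])
    from eventually_happens'[OF trivial_limit_at_top_linorder this]
    obtain Y where Y: "Y > \<bar>Im z\<bar>" "C * exp ((A + A * Y) powr \<rho> - \<epsilon> * (\<kappa> * exp (c * Y))) < B'"
      by blast
    define S where "S = cbox (Complex a (- Y)) (Complex b Y)"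
    have "norm (g z) \<le> B'"
    proof (rule maximum_modulus_frontier[of g S])
      have "g holomorphic_on UNIV"
        unfolding g_def h_def by (intro holomorphic_intros hol)
      then show "g holomorphic_on interior S" "continuous_on (closure S) g"
        by (auto intro: holomorphic_on_subset holomorphic_on_imp_continuous_on)
      show "bounded S" by (simp add: S_def)
      show "z \<in> S" using Y z by (auto simp: S_def in_cbox_complex_iff)
      fix w assume "w \<in> frontier S"
      then have w: "w \<in> S" "w \<notin> box (Complex a (- Y)) (Complex b Y)"
        unfolding S_def frontier_cbox by auto
      then have wS: "a \<le> Re w" "Re w \<le> b" "\<bar>Im w\<bar> \<le> Y"
        by (auto simp: S_def in_cbox_complex_iff)
      have hw: "\<epsilon> * Re (h w) \<ge> \<epsilon> * (\<kappa> * exp (c * \<bar>Im w\<bar>))"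
        using h_ge[OF wS(1,2)] that by simp
      consider "Re w = a \<or> Re w = b" | "\<bar>Im w\<bar> = Y"
        using w wS by (auto simp: in_box_complex_iff)
      then show "norm (g w) \<le> B'"
      proof cases
        case 1
        have "0 \<le> \<epsilon> * (\<kappa> * exp (c * \<bar>Im w\<bar>))" using that \<kappa> by auto
        then have "norm (g w) \<le> norm (f w) * 1"
          unfolding norm_g using hw by (intro mult_left_mono) auto
        then show ?thesis using bdry[OF 1] that by simp
      next
        case 2
        have "norm (g w) \<le> (C * exp ((A + A * Y) powr \<rho>)) * exp (- \<epsilon> * (\<kappa> * exp (c * Y)))"
          unfolding norm_g using growth[OF wS(1,2)] hw C0 unfolding 2 by (intro mult_mono) auto
        also have "\<dots> = C * exp ((A + A * Y) powr \<rho> - \<epsilon> * (\<kappa> * exp (c * Y)))"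
          by (simp add: exp_diff exp_minus divide_inverse)
        finally show ?thesis using Y by simp
      qed
    qed
    then show ?thesis by (simp add: norm_g exp_minus field_simps)
  qed
  have "norm (f z) \<le> B'" if "B' > B" for B'
  proof (rule tendsto_lowerbound)
    have "((\<lambda>\<epsilon>. B' * exp (\<epsilon> * Re (h z))) \<longlongrightarrow> B' * exp (0 * Re (h z))) (at_right 0)"
      by (intro tendsto_intros)
    then show "((\<lambda>\<epsilon>. B' * exp (\<epsilon> * Re (h z))) \<longlongrightarrow> B') (at_right 0)" by simp
    show "\<forall>\<^sub>F \<epsilon> in at_right 0. norm (f z) \<le> B' * exp (\<epsilon> * Re (h z))"
      using eventually_at_right_less[of 0] by eventually_elim (use key that in auto)
  qed auto
  then show ?thesis by (rule dense_ge)
qed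

text \<open>As Re w < M, the point w is closer to 0 than to 2M, so w/(2M - w) maps the disc of
  radius 2R, rescaled to the unit disc, into the unit disc. Schwarz's lemma at half the radius
  bounds this quotient by 1/2.\<close>

lemma borel_caratheodory:
  assumes hol: "g holomorphic_on UNIV" and R: "R > 0"
    and Re_less: "\<And>z. norm z < 2 * R \<Longrightarrow> Re (g z - g 0) < M" and z: "norm z = R"
  shows "norm (g z - g 0) \<le> 2 * M"
proof -
  have M: "M > 0" using Re_less[of 0] R by simp
  define w where "w \<zeta> = g (of_real (2 * R) * \<zeta>) - g 0" for \<zeta>
  define \<phi> where "\<phi> \<zeta> = w \<zeta> / (of_real (2 * M) - w \<zeta>)" for \<zeta>
  have w_less: "Re (w \<zeta>) < M" if "norm \<zeta> < 1" for \<zeta>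
    unfolding w_def using Re_less[of "of_real (2 * R) * \<zeta>"] that R by (simp add: norm_mult)
  have nz: "of_real (2 * M) - w \<zeta> \<noteq> 0" if "norm \<zeta> < 1" for \<zeta>
    using w_less[OF that] M by (auto simp: complex_eq_iff)
  have less: "norm (\<phi> \<zeta>) < 1" if "norm \<zeta> < 1" for \<zeta>
  proof -
    have "0 < 4 * M * (M - Re (w \<zeta>))" using w_less[OF that] M by simp
    also have "\<dots> = (norm (of_real (2 * M) - w \<zeta>))\<^sup>2 - (norm (w \<zeta>))\<^sup>2"
      unfolding cmod_power2 by (simp add: power2_eq_square algebra_simps)
    finally have "norm (w \<zeta>) < norm (of_real (2 * M) - w \<zeta>)"
      by (simp add: power2_less_imp_less)
    then show ?thesis using nz[OF that] by (simp add: \<phi>_def norm_divide)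
  qed
  have "norm (\<phi> (z / of_real (2 * R))) \<le> norm (z / of_real (2 * R))"
  proof (rule Schwarz_Lemma(1))
    show "\<phi> holomorphic_on ball 0 1"
      unfolding \<phi>_def w_def using nz
      by (intro holomorphic_intros holomorphic_on_compose_gen[OF _ hol, unfolded o_def]) (auto simp: w_def)
    show "\<phi> 0 = 0" by (simp add: \<phi>_def w_def)
  qed (use less z R in \<open>auto simp: norm_divide norm_mult\<close>)
  also have "\<dots> = 1 / 2" using z R by (simp add: norm_divide norm_mult)
  finally have "norm (g z - g 0) / norm (of_real (2 * M) - (g z - g 0)) \<le> 1 / 2"
    using R by (simp add: \<phi>_def w_def norm_divide)
  moreover have "of_real (2 * M) - (g z - g 0) \<noteq> 0"
    using nz[of "z / of_real (2 * R)"] z R by (simp add: w_def norm_divide norm_mult)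
  ultimately have "2 * norm (g z - g 0) \<le> norm (of_real (2 * M) - (g z - g 0))"
    by (simp add: field_simps)
  also have "\<dots> \<le> 2 * M + norm (g z - g 0)"
    using norm_triangle_ineq4[of "of_real (2 * M)" "g z - g 0"] M by simp
  finally show ?thesis by simp
qed

lemma bounded_quadratic_coeffs:
  fixes p q s :: real
  assumes "\<And>r. r \<ge> 0 \<Longrightarrow> \<bar>p + q * r + s * r\<^sup>2\<bar> \<le> B"
  shows "q = 0" and "s = 0"
proof -
  have *: "c = 0" if "\<And>r. r \<ge> 0 \<Longrightarrow> \<bar>c\<bar> * r \<le> K" for c K :: real
  proof (rule ccontr)
    assume "c \<noteq> 0"
    then show False
      using that[of "(\<bar>K\<bar> + 1) / \<bar>c\<bar>"] by (auto simp: abs_if split: if_splits)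
  qed
  show s: "s = 0"
  proof (rule *)
    fix r :: real assume r: "r \<ge> 0"
    define X where "X t = p + q * t + s * t\<^sup>2" for t
    \<comment> \<open>The second difference cancels \<open>p\<close> and \<open>q\<close>.\<close>
    have "X (2 * r) - 2 * X r + X 0 = 2 * (s * r\<^sup>2)"
      by (simp add: X_def power2_eq_square)
    moreover have "\<bar>X (2 * r)\<bar> \<le> B" "\<bar>X r\<bar> \<le> B" "\<bar>X 0\<bar> \<le> B"
      unfolding X_def by (rule assms, use r in simp)+
    ultimately have "\<bar>s * r\<^sup>2\<bar> \<le> 2 * B" by linarith
    then have "\<bar>s\<bar> * r\<^sup>2 \<le> 2 * B" by (simp add: abs_mult)
    moreover have "\<bar>s\<bar> * r \<le> \<bar>s\<bar> * r\<^sup>2 + \<bar>s\<bar>"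
    proof -
      have "r \<le> r\<^sup>2 + 1" using sum_squares_ge_zero[of "r - 1/2" 0] by (simp add: power2_eq_square algebra_simps)
      from mult_left_mono[OF this, of "\<bar>s\<bar>"] show ?thesis by (simp add: algebra_simps)
    qed
    ultimately show "\<bar>s\<bar> * r \<le> 2 * B + \<bar>s\<bar>" by linarith
  qed
  show "q = 0"
  proof (rule *)
    fix r :: real assume r: "r \<ge> 0"
    have "\<bar>q\<bar> * r = \<bar>(p + q * r + s * r\<^sup>2) - (p + q * 0 + s * 0\<^sup>2)\<bar>"
      using s r by (simp add: abs_mult)
    also have "\<dots> \<le> 2 * B" using assms[of r] assms[of 0] r by linarith
    finally show "\<bar>q\<bar> * r \<le> 2 * B" .
  qed
qed

text \<open>Borel-Caratheodory turns the one-sided bound into quadratic growth of \<open>g\<close>,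
  so \<open>g\<close> is a polynomial of degree at most 2. Boundedness along three rays in the
  half-plane then removes the non-constant coefficients.\<close>

lemma constant_if_Re_quadratic_growth:
  assumes hol: "g holomorphic_on UNIV" and A: "A \<ge> 0" and growth: "\<And>z. Re (g z) \<le> A + A * (norm z)\<^sup>2"
    and half: "\<And>z. \<sigma> \<le> Re z \<Longrightarrow> \<bar>Re (g z)\<bar> \<le> B"
  shows "g z = g w"
proof -
  define C where "C = 10 * A + 3 * norm (g 0) + 2"
  have poly: "g \<xi> = (\<Sum>k\<le>2. (deriv ^^ k) g 0 / fact k * \<xi> ^ k)" for \<xi>
  proof (rule Liouville_polynomial[OF hol])
    fix z :: complex assume z: "1 \<le> norm z"
    define M where "M = A + A * (2 * norm z)\<^sup>2 + norm (g 0) + 1"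
    have "norm (g z - g 0) \<le> 2 * M"
    proof (rule borel_caratheodory[OF hol, of "norm z"])
      fix u :: complex assume "norm u < 2 * norm z"
      then have "Re (g u) \<le> A + A * (2 * norm z)\<^sup>2"
        using growth[of u] A by (smt (verit) mult_left_mono norm_ge_zero power_mono)
      then show "Re (g u - g 0) < M"
        using abs_Re_le_cmod[of "g 0"] by (simp add: M_def)
    qed (use z in auto)
    then have "norm (g z) \<le> 2 * M + norm (g 0)"
      using norm_triangle_sub[of "g z" "g 0"] by linarith
    also have "\<dots> = 8 * A * (norm z)\<^sup>2 + (2 * A + 3 * norm (g 0) + 2) * 1"
      by (simp add: M_def power_mult_distrib algebra_simps)
    also have "\<dots> \<le> 8 * A * (norm z)\<^sup>2 + (2 * A + 3 * norm (g 0) + 2) * (norm z)\<^sup>2"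
      using A z by (intro add_left_mono mult_left_mono) auto
    also have "\<dots> = C * (norm z)\<^sup>2" by (simp add: C_def algebra_simps)
    finally show "norm (g z) \<le> C * (norm z)\<^sup>2" .
  qed
  define c where "c k = (deriv ^^ k) g 0 / fact k" for k
  have g: "g \<xi> = c 0 + c 1 * \<xi> + c 2 * \<xi>\<^sup>2" for \<xi>
    using poly[of \<xi>] by (simp add: c_def numeral_2_eq_2)
  define d where "d = c 1 + 2 * c 2 * of_real \<sigma>"
  define e where "e = g (of_real \<sigma>)"
  have shift: "g (of_real \<sigma> + \<zeta>) = e + d * \<zeta> + c 2 * \<zeta>\<^sup>2" for \<zeta>
    unfolding e_def d_def g by (simp add: power2_eq_square algebra_simps)
  have bd: "\<bar>Re (e + d * \<zeta> + c 2 * \<zeta>\<^sup>2)\<bar> \<le> B" if "Re \<zeta> \<ge> 0" for \<zeta>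
    using half[of "of_real \<sigma> + \<zeta>"] that by (simp add: shift)
  \<comment> \<open>Rays from \<sigma> in the directions 1, i and 1 + i. As i^2 = -1 and (1 + i)^2 =
    2i, they isolate in turn the real parts of \<open>d\<close> and \<open>c 2\<close>, the
    imaginary part of \<open>d\<close>, and that of \<open>c 2\<close>.\<close>
  have b1: "\<bar>Re e + Re d * r + Re (c 2) * r\<^sup>2\<bar> \<le> B"
    and b2: "\<bar>Re e + (- Im d) * r + (- Re (c 2)) * r\<^sup>2\<bar> \<le> B"
    and b3: "\<bar>Re e + (Re d - Im d) * r + (- 2 * Im (c 2)) * r\<^sup>2\<bar> \<le> B" if "r \<ge> 0" for r
  proof -
    have "Re (e + d * of_real r + c 2 * (of_real r)\<^sup>2) = Re e + Re d * r + Re (c 2) * r\<^sup>2"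
      "Re (e + d * (\<i> * of_real r) + c 2 * (\<i> * of_real r)\<^sup>2) = Re e + (- Im d) * r + (- Re (c 2)) * r\<^sup>2"
      "Re (e + d * ((1 + \<i>) * of_real r) + c 2 * ((1 + \<i>) * of_real r)\<^sup>2)
        = Re e + (Re d - Im d) * r + (- 2 * Im (c 2)) * r\<^sup>2"
      by (simp_all add: power2_eq_square algebra_simps)
    with bd[of "of_real r"] bd[of "\<i> * of_real r"] bd[of "(1 + \<i>) * of_real r"] that
    show "\<bar>Re e + Re d * r + Re (c 2) * r\<^sup>2\<bar> \<le> B"
      "\<bar>Re e + (- Im d) * r + (- Re (c 2)) * r\<^sup>2\<bar> \<le> B"
      "\<bar>Re e + (Re d - Im d) * r + (- 2 * Im (c 2)) * r\<^sup>2\<bar> \<le> B"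
      by (simp_all only:) simp_all
  qed
  have 1: "Re d = 0" "Re (c 2) = 0"
    using bounded_quadratic_coeffs[OF b1] by auto
  have 2: "Im d = 0"
    using bounded_quadratic_coeffs(1)[OF b2] by simp
  have "- 2 * Im (c 2) = 0"
    by (rule bounded_quadratic_coeffs(2)[OF b3])
  then have "c 2 = 0" using 1 by (simp add: complex_eq_iff)
  moreover from this have "c 1 = 0" using 1 2 by (simp add: complex_eq_iff d_def)
  ultimately show ?thesis by (simp add: g)
qed

section \<open>Zero-free Dirichlet series\<close>

definition dirichlet_sum :: "(nat \<Rightarrow> complex) \<Rightarrow> complex \<Rightarrow> complex"
  where "dirichlet_sum b \<zeta> = (\<Sum>n. b n * exp (- \<zeta> * of_real (ln (real (Suc n)))))"

lemma norm_dirichlet_term: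
  "norm (b n * exp (- \<zeta> * of_real (ln (real (Suc n))))) = norm (b n) * exp (- Re \<zeta> * ln (real (Suc n)))"
  by (simp add: norm_mult)

lemma dirichlet_sum_sums:
  assumes "\<And>\<sigma>. summable (\<lambda>n. norm (b n) * exp (\<sigma> * ln (real (Suc n))))"
  shows "(\<lambda>n. b n * exp (- \<zeta> * of_real (ln (real (Suc n))))) sums dirichlet_sum b \<zeta>"
  unfolding dirichlet_sum_def
  by (rule summable_sums, rule summable_norm_cancel) (unfold norm_dirichlet_term, rule assms)

text \<open>After multiplication by (N + 1)^\<zeta> each later term decays at least at the rate
  given by the gap ln (N + 2) - ln (N + 1), uniformly in the imaginary part of \<zeta>.\<close>

lemma dirichlet_sum_leading_term:
  assumes sb: "\<And>\<sigma>. summable (\<lambda>n. norm (b n) * exp (\<sigma> * ln (real (Suc n))))"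
    and n0: "\<And>n. n < N \<Longrightarrow> b n = 0" and "Re \<zeta> \<ge> 0"
  shows "norm (dirichlet_sum b \<zeta> * exp (\<zeta> * of_real (ln (real (Suc N)))) - b N)
    \<le> (\<Sum>n. norm (b n)) * exp (- (ln (real (Suc (Suc N))) - ln (real (Suc N))) * Re \<zeta>)"
proof -
  define l where "l n = ln (real (Suc n))" for n
  define d where "d = l (Suc N) - l N"
  have sb0: "summable (\<lambda>n. norm (b n))" using sb[of 0] by simp
  have "(\<lambda>n. b n * exp (- \<zeta> * of_real (l n)) * exp (\<zeta> * of_real (l N))) sums (dirichlet_sum b \<zeta> * exp (\<zeta> * of_real (l N)))"
    unfolding l_def by (intro sums_mult2 dirichlet_sum_sums sb)
  moreover have "(\<lambda>n. if n = N then b N else 0) sums b N"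
    by (rule sums_single)
  ultimately have "(\<lambda>n. b n * exp (- \<zeta> * of_real (l n)) * exp (\<zeta> * of_real (l N)) - (if n = N then b N else 0))
      sums (dirichlet_sum b \<zeta> * exp (\<zeta> * of_real (l N)) - b N)"
    by (rule sums_diff)
  note X_sums = this
  have le: "norm (b n * exp (- \<zeta> * of_real (l n)) * exp (\<zeta> * of_real (l N)) - (if n = N then b N else 0))
     \<le> norm (b n) * exp (- d * Re \<zeta>)" for n
  proof (cases n N rule: linorder_cases)
    case less
    then show ?thesis using n0 by simp
  next
    case equal
    have "b N * exp (- \<zeta> * of_real (l N)) * exp (\<zeta> * of_real (l N)) = b N"
      by (simp add: exp_minus)
    then have "b n * exp (- \<zeta> * of_real (l n)) * exp (\<zeta> * of_real (l N)) - (if n = N then b N else 0) = 0"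
      unfolding equal by simp
    then show ?thesis by (simp only: norm_zero) simp
  next
    case greater
    then have "l (Suc N) \<le> l n" by (simp add: l_def)
    then have "d * Re \<zeta> \<le> (l n - l N) * Re \<zeta>"
      using assms(3) by (intro mult_right_mono) (auto simp: d_def)
    then have "exp (- Re \<zeta> * l n + Re \<zeta> * l N) \<le> exp (- d * Re \<zeta>)"
      by (simp add: algebra_simps)
    then have "norm (b n) * exp (- Re \<zeta> * l n + Re \<zeta> * l N) \<le> norm (b n) * exp (- d * Re \<zeta>)"
      by (intro mult_left_mono) auto
    then have "norm (b n) * (exp (- Re \<zeta> * l n) * exp (Re \<zeta> * l N)) \<le> norm (b n) * exp (- d * Re \<zeta>)"
      by (simp only: exp_add)
    then show ?thesis using greater by (simp add: norm_mult mult.assoc)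
  qed
  have sum_le: "summable (\<lambda>n. norm (b n) * exp (- d * Re \<zeta>))" by (rule summable_mult2[OF sb0])
  have sum_norm: "summable (\<lambda>n. norm (b n * exp (- \<zeta> * of_real (l n)) * exp (\<zeta> * of_real (l N)) - (if n = N then b N else 0)))"
    by (rule summable_comparison_test[OF _ sum_le]) (use le in auto)
  have "norm (dirichlet_sum b \<zeta> * exp (\<zeta> * of_real (l N)) - b N)
     \<le> (\<Sum>n. norm (b n * exp (- \<zeta> * of_real (l n)) * exp (\<zeta> * of_real (l N)) - (if n = N then b N else 0)))"
    unfolding sums_unique[OF X_sums] by (rule summable_norm[OF sum_norm])
  also have "\<dots> \<le> (\<Sum>n. norm (b n) * exp (- d * Re \<zeta>))"
    by (rule suminf_le[OF le sum_norm sum_le])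
  also have "\<dots> = (\<Sum>n. norm (b n)) * exp (- d * Re \<zeta>)"
    by (rule suminf_mult2[OF sb0, symmetric])
  finally show ?thesis by (simp add: l_def d_def)
qed

lemma dirichlet_sum_leading_eventually:
  assumes sb: "\<And>\<sigma>. summable (\<lambda>n. norm (b n) * exp (\<sigma> * ln (real (Suc n))))"
    and n0: "\<And>n. n < N \<Longrightarrow> b n = 0" and "\<epsilon> > 0"
  obtains \<sigma> where "\<sigma> \<ge> 0"
    "\<And>\<zeta>. \<sigma> \<le> Re \<zeta> \<Longrightarrow> norm (dirichlet_sum b \<zeta> * exp (\<zeta> * of_real (ln (real (Suc N)))) - b N) < \<epsilon>"
proof -
  define d where "d = ln (real (Suc (Suc N))) - ln (real (Suc N))"
  define S where "S = (\<Sum>n. norm (b n))"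
  have d: "d > 0" by (simp add: d_def)
  have "S \<ge> 0" unfolding S_def using sb[of 0] by (intro suminf_nonneg) auto
  have "((\<lambda>x. S * exp (- d * x)) \<longlongrightarrow> 0) at_top" using d by real_asymp
  from order_tendstoD(2)[OF this \<open>\<epsilon> > 0\<close>] obtain \<sigma>0 where \<sigma>0: "\<And>x. x \<ge> \<sigma>0 \<Longrightarrow> S * exp (- d * x) < \<epsilon>"
    by (auto simp: eventually_at_top_linorder)
  show thesis
  proof
    show "0 \<le> max \<sigma>0 0" by simp
    fix \<zeta> assume "max \<sigma>0 0 \<le> Re \<zeta>"
    then show "norm (dirichlet_sum b \<zeta> * exp (\<zeta> * of_real (ln (real (Suc N)))) - b N) < \<epsilon>"
      using dirichlet_sum_leading_term[OF sb n0, of N \<zeta>] \<sigma>0[of "Re \<zeta>"] by (simp add: S_def d_def)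
  qed
qed

text \<open>Uniqueness of coefficients: the earliest non-zero one would dominate far to the
  right.\<close>

lemma dirichlet_sum_eq_0_imp:
  assumes sb: "\<And>\<sigma>. summable (\<lambda>n. norm (b n) * exp (\<sigma> * ln (real (Suc n))))"
    and "\<And>\<zeta>. dirichlet_sum b \<zeta> = 0"
  shows "b n = 0"
proof (induction n rule: less_induct)
  case (less n)
  show ?case
  proof (rule ccontr)
    assume "b n \<noteq> 0"
    then obtain \<sigma> where "\<And>\<zeta>. \<sigma> \<le> Re \<zeta> \<Longrightarrow>
        norm (dirichlet_sum b \<zeta> * exp (\<zeta> * of_real (ln (real (Suc n)))) - b n) < norm (b n)"
      using dirichlet_sum_leading_eventually[OF sb less.IH, of n "norm (b n)"] by auto
    from this[of "of_real \<sigma>"] assms(2) show False by simp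
  qed
qed

text \<open>A zero-free series of this kind is, up to its leading term, the exponential of a polynomial
  that is bounded on a half-plane, hence a constant.\<close>

lemma zero_free_dirichlet_sum:
  assumes sb: "\<And>\<sigma>. summable (\<lambda>n. norm (b n) * exp (\<sigma> * ln (real (Suc n))))"
    and hol: "dirichlet_sum b holomorphic_on UNIV"
    and nz: "\<And>\<zeta>. dirichlet_sum b \<zeta> \<noteq> 0"
    and growth: "\<And>\<zeta>. norm (dirichlet_sum b \<zeta>) \<le> M * exp (c * (norm \<zeta>)\<^sup>2)" and "c \<ge> 0"
  obtains N where "b N \<noteq> 0" "\<And>n. n \<noteq> N \<Longrightarrow> b n = 0"
proof -
  define N where "N = (LEAST n. b n \<noteq> 0)"
  have "\<exists>n. b n \<noteq> 0"
  proof (rule ccontr)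
    assume "\<nexists>n. b n \<noteq> 0"
    then show False using nz[of 0] by (simp add: dirichlet_sum_def)
  qed
  then have N: "b N \<noteq> 0" unfolding N_def by (rule LeastI_ex)
  have below: "b n = 0" if "n < N" for n
    using not_less_Least[OF that[unfolded N_def]] by simp
  define l where "l = ln (real (Suc N))"
  have l: "l \<ge> 0" by (simp add: l_def)
  \<comment> \<open>Normalised to tend to 1 as the real part grows, so that its logarithm has
    bounded real part on some half-plane.\<close>
  define E where "E \<zeta> = dirichlet_sum b \<zeta> * exp (\<zeta> * of_real l) / b N" for \<zeta>
  have "E holomorphic_on UNIV" unfolding E_def using N by (intro holomorphic_intros hol)
  moreover have E_nz: "E \<zeta> \<noteq> 0" for \<zeta> using nz N by (simp add: E_def)
  ultimately obtain g where g: "g holomorphic_on UNIV" "\<And>\<zeta>. exp (g \<zeta>) = E \<zeta>"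
    using holomorphic_logarithm_exists[OF convex_UNIV open_UNIV, of E 0] by auto
  have Re_g: "Re (g \<zeta>) = ln (norm (E \<zeta>))" for \<zeta>
    unfolding g(2)[symmetric] by simp
  have E_lim: "\<exists>\<sigma>\<ge>0. \<forall>\<zeta>. \<sigma> \<le> Re \<zeta> \<longrightarrow> norm (E \<zeta> - 1) < \<epsilon>" if "\<epsilon> > 0" for \<epsilon>
  proof -
    have pos: "\<epsilon> * norm (b N) > 0" using that N by simp
    obtain \<sigma> where \<sigma>: "\<sigma> \<ge> 0"
      "\<And>\<zeta>. \<sigma> \<le> Re \<zeta> \<Longrightarrow> norm (dirichlet_sum b \<zeta> * exp (\<zeta> * of_real l) - b N) < \<epsilon> * norm (b N)"
      unfolding l_def using dirichlet_sum_leading_eventually[OF sb below pos] by blast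
    have "norm (E \<zeta> - 1) < \<epsilon>" if "\<sigma> \<le> Re \<zeta>" for \<zeta>
    proof -
      have "E \<zeta> - 1 = (dirichlet_sum b \<zeta> * exp (\<zeta> * of_real l) - b N) / b N"
        using N by (simp add: E_def field_simps)
      then have "norm (E \<zeta> - 1) = norm (dirichlet_sum b \<zeta> * exp (\<zeta> * of_real l) - b N) / norm (b N)"
        by (simp only: norm_divide)
      also have "\<dots> < \<epsilon>" using \<sigma>(2)[OF that] N by (simp add: pos_divide_less_eq)
      finally show ?thesis .
    qed
    with \<sigma>(1) show ?thesis by blast
  qed
  have M: "M > 0"
    using less_le_trans[OF _ growth[of 0], of 0] nz[of 0] by simp
  \<comment> \<open>One constant for the constant, quadratic and linear parts; the linear one is
    absorbed by |\<zeta>| \<le> 1 + |\<zeta>|^2.\<close>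
  define A where "A = \<bar>ln (M / norm (b N))\<bar> + c + l"
  have g_growth: "Re (g \<zeta>) \<le> A + A * (norm \<zeta>)\<^sup>2" for \<zeta>
  proof -
    have "norm (E \<zeta>) \<le> (M * exp (c * (norm \<zeta>)\<^sup>2)) * exp (l * norm \<zeta>) / norm (b N)"
      unfolding E_def norm_divide norm_mult
    proof (intro divide_right_mono mult_mono growth)
      have "Re \<zeta> * l \<le> l * norm \<zeta>"
        using mult_left_mono[OF complex_Re_le_cmod l] by (simp add: mult.commute)
      then show "norm (exp (\<zeta> * of_real l)) \<le> exp (l * norm \<zeta>)" by simp
    qed (use M in auto)
    also have "\<dots> = exp (ln (M / norm (b N)) + c * (norm \<zeta>)\<^sup>2 + l * norm \<zeta>)"
      using M N by (simp add: exp_add)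
    finally have "Re (g \<zeta>) \<le> ln (M / norm (b N)) + c * (norm \<zeta>)\<^sup>2 + l * norm \<zeta>"
      unfolding g(2)[symmetric] norm_exp_eq_Re exp_le_cancel_iff .
    also have "\<dots> \<le> A + A * (norm \<zeta>)\<^sup>2"
    proof -
      have "norm \<zeta> \<le> 1 + (norm \<zeta>)\<^sup>2"
        using sum_squares_ge_zero[of "norm \<zeta> - 1/2" 0] by (simp add: power2_eq_square algebra_simps)
      then have "l * norm \<zeta> \<le> l * (1 + (norm \<zeta>)\<^sup>2)" using l by (rule mult_left_mono)
      moreover have "ln (M / norm (b N)) \<le> \<bar>ln (M / norm (b N))\<bar> * (1 + (norm \<zeta>)\<^sup>2)"
        using abs_ge_self[of "ln (M / norm (b N))"] by (simp add: algebra_simps add_increasing2)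
      moreover have "c * (norm \<zeta>)\<^sup>2 \<le> c * (1 + (norm \<zeta>)\<^sup>2)" using \<open>c \<ge> 0\<close> by (intro mult_left_mono) auto
      ultimately show ?thesis by (simp add: A_def algebra_simps)
    qed
    finally show ?thesis .
  qed
  obtain \<sigma> where \<sigma>: "\<And>\<zeta>. \<sigma> \<le> Re \<zeta> \<Longrightarrow> norm (E \<zeta> - 1) < 1 / 2"
    using E_lim[of "1 / 2"] by auto
  have half: "\<bar>Re (g \<zeta>)\<bar> \<le> ln 2" if "\<sigma> \<le> Re \<zeta>" for \<zeta>
  proof -
    have "norm (E \<zeta>) \<le> 2" "1 / 2 \<le> norm (E \<zeta>)"
      using \<sigma>[OF that] norm_triangle_sub[of "E \<zeta>" 1] norm_triangle_sub[of 1 "E \<zeta>"]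
      by (simp_all add: norm_minus_commute)
    then have "ln (norm (E \<zeta>)) \<le> ln 2" "ln (1 / 2) \<le> ln (norm (E \<zeta>))"
      using E_nz[of \<zeta>] by (simp_all del: ln_div)
    then show ?thesis unfolding Re_g by (simp add: ln_div abs_le_iff)
  qed
  have "g \<zeta> = g 0" for \<zeta>
    by (rule constant_if_Re_quadratic_growth[OF g(1) _ g_growth half]) (use \<open>c \<ge> 0\<close> l in \<open>auto simp: A_def\<close>)
  then have E_const: "E \<zeta> = E 0" for \<zeta>
    unfolding g(2)[symmetric] by (rule arg_cong[of _ _ exp])
  have "norm (E 0 - 1) < \<epsilon>" if \<epsilon>: "\<epsilon> > 0" for \<epsilon>
  proof -
    obtain s where "\<And>\<zeta>. s \<le> Re \<zeta> \<Longrightarrow> norm (E \<zeta> - 1) < \<epsilon>" using E_lim[OF \<epsilon>] by blast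
    from this[of "of_real s"] show ?thesis by (simp add: E_const[of "of_real s"])
  qed
  from this[of "norm (E 0 - 1)"] have "E 0 = 1" by auto
  then have D: "dirichlet_sum b \<zeta> = b N * exp (- \<zeta> * of_real l)" for \<zeta>
    using E_const[of \<zeta>] N by (simp add: E_def exp_minus field_simps)
  \<comment> \<open>Removing the leading term leaves a series that vanishes identically, and
    uniqueness of coefficients applies to it.\<close>
  define b' where "b' = b(N := 0)"
  have sb': "summable (\<lambda>n. norm (b' n) * exp (\<sigma> * ln (real (Suc n))))" for \<sigma>
    by (rule summable_comparison_test[OF _ sb[of \<sigma>]]) (auto simp: b'_def)
  have "dirichlet_sum b' \<zeta> = 0" for \<zeta>
  proof -
    have "(\<lambda>n. b n * exp (- \<zeta> * of_real (ln (real (Suc n)))) - (if n = N then b N * exp (- \<zeta> * of_real l) else 0))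
       sums (dirichlet_sum b \<zeta> - b N * exp (- \<zeta> * of_real l))"
      by (intro sums_diff dirichlet_sum_sums sb sums_single)
    also have "(\<lambda>n. b n * exp (- \<zeta> * of_real (ln (real (Suc n)))) - (if n = N then b N * exp (- \<zeta> * of_real l) else 0))
       = (\<lambda>n. b' n * exp (- \<zeta> * of_real (ln (real (Suc n)))))"
      by (auto simp: b'_def l_def)
    finally have "(\<lambda>n. b' n * exp (- \<zeta> * of_real (ln (real (Suc n))))) sums 0" by (simp add: D)
    then show ?thesis by (rule sums_unique2[OF dirichlet_sum_sums[OF sb']])
  qed
  from dirichlet_sum_eq_0_imp[OF sb' this] have "b' n = 0" for n .
  then have "b n = 0" if "n \<noteq> N" for n using \<open>\<And>n. b' n = 0\<close>[of n] that by (simp add: b'_def)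
  with N show thesis by (rule that)
qed

section \<open>Growth of the completed function\<close>

lemma power_gaussian_bounded:
  fixes \<delta> :: real
  assumes "\<delta> > 0"
  obtains K where "\<And>v. (3 + \<bar>v\<bar>) ^ N * exp (- \<delta> * v\<^sup>2) \<le> K"
proof -
  have "(3 + \<bar>v\<bar>) ^ N * exp (- \<delta> * v\<^sup>2) \<le> 3 ^ N * exp ((real N)\<^sup>2 / (4 * \<delta>))" for v :: real
  proof -
    have "3 + \<bar>v\<bar> \<le> 3 * exp \<bar>v\<bar>" using exp_ge_add_one_self[of "\<bar>v\<bar>"] abs_ge_zero[of v] by linarith
    then have "(3 + \<bar>v\<bar>) ^ N \<le> (3 * exp \<bar>v\<bar>) ^ N" by (intro power_mono) auto
    also have "\<dots> = 3 ^ N * exp (real N * \<bar>v\<bar>)" by (simp add: power_mult_distrib exp_of_nat_mult)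
    finally have "(3 + \<bar>v\<bar>) ^ N * exp (- \<delta> * v\<^sup>2) \<le> 3 ^ N * exp (real N * \<bar>v\<bar>) * exp (- \<delta> * v\<^sup>2)"
      by (intro mult_right_mono) auto
    also have "\<dots> = 3 ^ N * exp (real N * \<bar>v\<bar> - \<delta> * v\<^sup>2)"
      by (simp add: exp_diff exp_minus divide_inverse)
    also have "real N * \<bar>v\<bar> - \<delta> * v\<^sup>2 \<le> (real N)\<^sup>2 / (4 * \<delta>)"
    proof -
      have "0 \<le> (2 * \<delta> * \<bar>v\<bar> - real N)\<^sup>2 / (4 * \<delta>)" using assms by simp
      also have "\<dots> = (real N)\<^sup>2 / (4 * \<delta>) - (real N * \<bar>v\<bar> - \<delta> * v\<^sup>2)"
        using assms by (simp add: field_simps power2_eq_square)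
      finally show ?thesis by simp
    qed
    finally show ?thesis by simp
  qed
  then show thesis by (rule that)
qed

text \<open>The exponent in \<open>finite_order_entire\<close> is an arbitrary real, possibly
  negative; r \<ge> 1/2 then bounds 1/r by 2 \<le> Y. The added 1 makes the new exponent positive,
  as \<open>phragmen_lindelof_strip\<close> demands.\<close>

lemma powr_le_powr_abs:
  fixes r Y \<rho> :: real
  assumes "1 / 2 \<le> r" "r \<le> Y" "2 \<le> Y"
  shows "r powr \<rho> \<le> Y powr (\<bar>\<rho>\<bar> + 1)"
proof -
  have "r powr \<rho> \<le> Y powr \<bar>\<rho>\<bar>"
  proof (cases "\<rho> \<ge> 0")
    case True
    then show ?thesis using assms by (simp add: powr_mono2)
  next
    case False
    have "r powr \<rho> = (1 / r) powr (- \<rho>)"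
      using assms by (simp add: powr_minus powr_divide)
    also have "\<dots> \<le> Y powr (- \<rho>)"
    proof (rule powr_mono2)
      have "1 / r \<le> 2" using assms by (simp add: field_simps)
      then show "1 / r \<le> Y" using assms by linarith
    qed (use False assms in auto)
    finally show ?thesis using False by simp
  qed
  also have "\<dots> \<le> Y powr (\<bar>\<rho>\<bar> + 1)" using assms by (intro powr_mono) auto
  finally show ?thesis .
qed

section \<open>Consequences of membership in the extended Selberg class\<close>

locale selberg_data =
  fixes F :: "complex \<Rightarrow> complex" and a :: "nat \<Rightarrow> complex" and m :: nat
    and \<alpha> :: complex and Q :: real and k :: nat
    and \<omega> :: "nat \<Rightarrow> real" and \<mu> :: "nat \<Rightarrow> complex" and Xi :: "complex \<Rightarrow> complex"
  assumes selberg: "selberg_sharp F a m \<alpha> Q k \<omega> \<mu> Xi"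
begin

abbreviation "\<gamma> \<equiv> selberg_gamma \<alpha> m Q k \<omega> \<mu>"

abbreviation "\<gamma>_arg i s \<equiv> of_real (\<omega> i) * s + \<mu> i"

lemma alpha_nonzero: "\<alpha> \<noteq> 0"
  using selberg unfolding selberg_sharp_def by (elim conjE)

lemma Q_pos: "0 < Q"
  using selberg unfolding selberg_sharp_def by (elim conjE)

lemma Xi_holomorphic: "Xi holomorphic_on UNIV"
  using selberg unfolding selberg_sharp_def by (elim conjE)

lemma k_pos: "0 < k"
proof -
  have "1 \<le> k" using selberg unfolding selberg_sharp_def by (elim conjE)
  then show ?thesis by simp
qed

lemma omega_pos: "i < k \<Longrightarrow> 0 < \<omega> i" and Re_mu_nonneg: "i < k \<Longrightarrow> 0 \<le> Re (\<mu> i)"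
proof -
  have "\<forall>i<k. 0 < \<omega> i \<and> 0 \<le> Re (\<mu> i)" using selberg unfolding selberg_sharp_def by (elim conjE)
  then show "i < k \<Longrightarrow> 0 < \<omega> i" "i < k \<Longrightarrow> 0 \<le> Re (\<mu> i)" by blast+
qed

lemma Xi_eq: "1 < Re s \<Longrightarrow> Xi s = \<gamma> s * F s"
proof -
  have "\<forall>s. 1 < Re s \<longrightarrow> Xi s = \<gamma> s * F s" using selberg unfolding selberg_sharp_def by (elim conjE)
  then show "1 < Re s \<Longrightarrow> Xi s = \<gamma> s * F s" by blast
qed

lemma Xi_reflect: "Xi s = cnj (Xi (1 - cnj s))"
proof -
  have "\<forall>s. Xi s = cnj (Xi (1 - cnj s))" using selberg unfolding selberg_sharp_def by (elim conjE)
  then show ?thesis by (rule spec)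
qed

lemma F_summable: "1 < Re s \<Longrightarrow> summable (\<lambda>n. norm (a (Suc n) * of_nat (Suc n) powr (- s)))"
  and F_eq: "1 < Re s \<Longrightarrow> F s = (\<Sum>n. a (Suc n) * of_nat (Suc n) powr (- s))"
proof -
  have "\<forall>s. 1 < Re s \<longrightarrow> summable (\<lambda>n. norm (a (Suc n) * of_nat (Suc n) powr (- s))) \<and>
        F s = (\<Sum>n. a (Suc n) * of_nat (Suc n) powr (- s))"
    using selberg unfolding selberg_sharp_def by (elim conjE)
  then show "1 < Re s \<Longrightarrow> summable (\<lambda>n. norm (a (Suc n) * of_nat (Suc n) powr (- s)))"
    "1 < Re s \<Longrightarrow> F s = (\<Sum>n. a (Suc n) * of_nat (Suc n) powr (- s))" by blast+
qed

lemma F_nonzero: "\<exists>s. 1 < Re s \<and> F s \<noteq> 0"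
  using selberg unfolding selberg_sharp_def by (elim conjE)

lemma entire_multiple:
  obtains G where "finite_order_entire G" "\<And>s. 1 < Re s \<Longrightarrow> G s = (s - 1) ^ m * F s"
proof -
  have "\<exists>G. finite_order_entire G \<and> (\<forall>s. 1 < Re s \<longrightarrow> G s = (s - 1) ^ m * F s) \<and> (m = 0 \<or> G 1 \<noteq> 0)"
    using selberg unfolding selberg_sharp_def by (elim conjE)
  then show thesis using that by blast
qed

lemma Re_gamma_arg_pos: "i < k \<Longrightarrow> 0 < Re s \<Longrightarrow> 0 < Re (\<gamma>_arg i s)"
  using omega_pos Re_mu_nonneg by (simp add: add_pos_nonneg)

lemma prod_Gamma_rGamma:
  assumes "0 < Re s"
  shows "(\<Prod>i<k. Gamma (\<gamma>_arg i s)) * (\<Prod>i<k. rGamma (\<gamma>_arg i s)) = 1"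
proof -
  have "Gamma (\<gamma>_arg i s) * rGamma (\<gamma>_arg i s) = 1" if "i < k" for i
  proof -
    have "\<gamma>_arg i s \<notin> \<int>\<^sub>\<le>\<^sub>0"
    proof
      assume "\<gamma>_arg i s \<in> \<int>\<^sub>\<le>\<^sub>0"
      then have "Re (\<gamma>_arg i s) \<le> 0" by (elim nonpos_Ints_cases) simp
      with Re_gamma_arg_pos[OF that assms] show False by simp
    qed
    then show ?thesis by (simp add: Gamma_def rGamma_eq_zero_iff)
  qed
  then show ?thesis by (simp add: prod.distrib[symmetric])
qed

text \<open>Reciprocal Gammas have no poles, so both sides are entire and the identity theorem
  applies. \<open>G\<close> is left arbitrary because \<open>not_single_term\<close> later inserts
  an explicit one.\<close>

lemma completed_continuation:
  assumes G: "G holomorphic_on UNIV" "\<And>s. 1 < Re s \<Longrightarrow> G s = (s - 1) ^ m * F s"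
  shows "Xi s * (\<Prod>i<k. rGamma (\<gamma>_arg i s)) = \<alpha> * s ^ m * of_real Q powr s * G s"
proof (rule analytic_continuation_open[of "{s. 1 < Re s}" UNIV
    "\<lambda>s. Xi s * (\<Prod>i<k. rGamma (\<gamma>_arg i s))" "\<lambda>s. \<alpha> * s ^ m * of_real Q powr s * G s"])
  show "open {s. 1 < Re s}" by (rule open_halfspace_Re_gt)
  show "{s. 1 < Re s} \<noteq> {}" by (auto intro!: exI[of _ 2])
  show "(\<lambda>s. Xi s * (\<Prod>i<k. rGamma (\<gamma>_arg i s))) holomorphic_on UNIV"
    by (intro holomorphic_intros Xi_holomorphic)
  show "(\<lambda>s. \<alpha> * s ^ m * of_real Q powr s * G s) holomorphic_on UNIV"
    using Q_pos by (intro holomorphic_intros G(1)) auto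
  fix s assume "s \<in> {s. 1 < Re s}"
  then have s: "1 < Re s" by simp
  have "Xi s * (\<Prod>i<k. rGamma (\<gamma>_arg i s))
     = \<alpha> * s ^ m * of_real Q powr s * ((s - 1) ^ m * F s)
       * ((\<Prod>i<k. Gamma (\<gamma>_arg i s)) * (\<Prod>i<k. rGamma (\<gamma>_arg i s)))"
    unfolding Xi_eq[OF s] selberg_gamma_def by (simp only: mult_ac)
  also have "\<dots> = \<alpha> * s ^ m * of_real Q powr s * G s"
    using prod_Gamma_rGamma s G(2) by simp
  finally show "Xi s * (\<Prod>i<k. rGamma (\<gamma>_arg i s)) = \<alpha> * s ^ m * of_real Q powr s * G s" .
qed auto

text \<open>To the right of 0 the Gammas can be restored, their arguments having positive real part.
  This covers the abscissas from 1/2 to 1, which the Dirichlet series does not reach.\<close>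

lemma Xi_eq_half_plane:
  assumes G: "G holomorphic_on UNIV" "\<And>s. 1 < Re s \<Longrightarrow> G s = (s - 1) ^ m * F s" and "0 < Re s"
  shows "Xi s = \<alpha> * s ^ m * of_real Q powr s * (\<Prod>i<k. Gamma (\<gamma>_arg i s)) * G s"
proof -
  have "Xi s = Xi s * ((\<Prod>i<k. Gamma (\<gamma>_arg i s)) * (\<Prod>i<k. rGamma (\<gamma>_arg i s)))"
    using prod_Gamma_rGamma[OF assms(3)] by simp
  also have "\<dots> = (Xi s * (\<Prod>i<k. rGamma (\<gamma>_arg i s))) * (\<Prod>i<k. Gamma (\<gamma>_arg i s))"
    by (simp only: mult_ac)
  also have "\<dots> = \<alpha> * s ^ m * of_real Q powr s * G s * (\<Prod>i<k. Gamma (\<gamma>_arg i s))"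
    by (simp only: completed_continuation[OF G])
  finally show ?thesis by (simp only: mult_ac)
qed

definition F_bound :: real
  where "F_bound = (\<Sum>n. norm (a (Suc n)) * exp (- 2 * ln (real (Suc n))))"

lemma coeff_term_eq_exp: "(of_nat (Suc n) :: complex) powr (- s) = exp (- s * of_real (ln (real (Suc n))))"
  unfolding powr_def by (subst Ln_of_nat) (simp_all del: of_nat_Suc)

lemma norm_coeff_term:
  "norm (a (Suc n) * of_nat (Suc n) powr (- s)) = norm (a (Suc n)) * exp (- Re s * ln (real (Suc n)))"
  unfolding coeff_term_eq_exp norm_mult by simp

lemma coeff_summable: "summable (\<lambda>n. norm (a (Suc n)) * exp (- 2 * ln (real (Suc n))))"
  using F_summable[of 2] unfolding norm_coeff_term by simp

lemma F_bound_nonneg: "0 \<le> F_bound"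
  unfolding F_bound_def by (intro suminf_nonneg coeff_summable) auto

lemma norm_F_le:
  assumes "Re s = 2"
  shows "norm (F s) \<le> F_bound"
proof -
  have s: "1 < Re s" using assms by simp
  show ?thesis
    unfolding F_eq[OF s] F_bound_def
    using summable_norm[OF F_summable[OF s]] by (simp only: norm_coeff_term assms)
qed

text \<open>Bounded by a Gaussian of arbitrarily slow growth: on the line of abscissa 2 this is read off
  the Dirichlet series, on the reflected line it is the functional equation, and Phragmen--Lindelof
  fills in the strip.\<close>

lemma Xi_gaussian_bound:
  assumes "\<delta> > 0"
  obtains B where "\<And>s. -1 \<le> Re s \<Longrightarrow> Re s \<le> 2 \<Longrightarrow> norm (Xi s) \<le> B * exp (\<delta> * (Im s)\<^sup>2)"
proof -
  obtain G where G: "finite_order_entire G" "\<And>s. 1 < Re s \<Longrightarrow> G s = (s - 1) ^ m * F s"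
    using entire_multiple by blast
  then have G_hol: "G holomorphic_on UNIV" by (simp add: finite_order_entire_def)
  obtain \<rho> C where G_le: "\<And>z. norm (G z) \<le> C * exp (norm z powr \<rho>)"
    using G(1) unfolding finite_order_entire_def by blast
  have C: "0 \<le> C"
    using order_trans[OF norm_ge_zero G_le[of 0]] by (simp add: zero_le_mult_iff)
  \<comment> \<open>Majorant of the non-polynomial part of the gamma factor that depends on the real
    part only; continuity on a compact interval gives the constant \<open>K\<close>.\<close>
  define \<kappa> where "\<kappa> x = norm \<alpha> * Q powr x * (\<Prod>i<k. Gamma (\<omega> i * x + Re (\<mu> i)))" for x
  have "continuous_on {1 / 2..2} \<kappa>"
    unfolding \<kappa>_def
  proof (intro continuous_on_mult continuous_on_prod continuous_on_powr continuous_on_const continuous_on_id)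
    fix i assume i: "i \<in> {..<k}"
    have "\<omega> i * x + Re (\<mu> i) \<notin> \<int>\<^sub>\<le>\<^sub>0" if "x \<in> {1 / 2..2}" for x
    proof -
      have "0 < \<omega> i * x + Re (\<mu> i)"
        using omega_pos[of i] Re_mu_nonneg[of i] i that by (intro add_pos_nonneg mult_pos_pos) auto
      then show ?thesis by (auto elim!: nonpos_Ints_cases)
    qed
    then show "continuous_on {1 / 2..2} (\<lambda>x. Gamma (\<omega> i * x + Re (\<mu> i)))"
      by (intro continuous_at_imp_continuous_on ballI isCont_Gamma continuous_intros) auto
  qed (use Q_pos in auto)
  then have "bounded (\<kappa> ` {1 / 2..2})"
    by (intro compact_imp_bounded compact_continuous_image) auto
  then obtain K where "\<forall>x\<in>{1 / 2..2}. \<bar>\<kappa> x\<bar> \<le> K"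
    unfolding bounded_iff by auto
  then have K: "\<And>x. x \<in> {1 / 2..2} \<Longrightarrow> \<bar>\<kappa> x\<bar> \<le> K" by blast
  have K0: "0 \<le> K" using K[of 1] by simp
  have Xi_le: "norm (Xi s) \<le> K * norm s ^ m * norm (G s)" if "1 / 2 \<le> Re s" "Re s \<le> 2" for s
  proof -
    have "norm (\<Prod>i<k. Gamma (\<gamma>_arg i s)) \<le> (\<Prod>i<k. Gamma (\<omega> i * Re s + Re (\<mu> i)))"
      unfolding prod_norm[symmetric]
      using norm_Gamma_le_Gamma_Re[OF Re_gamma_arg_pos, of _ s] that by (intro prod_mono) auto
    then have "norm \<alpha> * Q powr Re s * norm (\<Prod>i<k. Gamma (\<gamma>_arg i s)) \<le> \<kappa> (Re s)"
      unfolding \<kappa>_def by (intro mult_left_mono) auto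
    also have "\<dots> \<le> K" using K[of "Re s"] that by auto
    finally have "norm \<alpha> * Q powr Re s * norm (\<Prod>i<k. Gamma (\<gamma>_arg i s)) * (norm s ^ m * norm (G s))
      \<le> K * (norm s ^ m * norm (G s))" by (intro mult_right_mono) auto
    moreover have "norm (Xi s) = norm \<alpha> * Q powr Re s * norm (\<Prod>i<k. Gamma (\<gamma>_arg i s)) * (norm s ^ m * norm (G s))"
      using that Q_pos Xi_eq_half_plane[OF G_hol G(2), of s]
      by (simp add: norm_mult norm_power norm_powr_real_powr)
    ultimately show ?thesis by (simp add: mult.assoc)
  qed
  \<comment> \<open>The symmetry keeps Im s and sends Re s to 1 - Re s. It is used with
    \<open>S = {2}\<close> for the edge at -1 and with \<open>S = {1/2..2}\<close> for the left half
    of the strip.\<close>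
  have reflect: "norm (Xi s) \<le> h (Im s)"
    if "\<And>s. Re s \<in> S \<Longrightarrow> norm (Xi s) \<le> h (Im s)" "Re s \<in> S \<or> 1 - Re s \<in> S" for h S s
  proof -
    have "norm (Xi s) = norm (Xi (1 - cnj s))"
      using arg_cong[OF Xi_reflect[of s], of norm] by (simp only: complex_mod_cnj)
    then show ?thesis using that(1)[of s] that(1)[of "1 - cnj s"] that(2) by auto
  qed
  have norm_le: "norm s \<le> 2 + \<bar>Im s\<bar>" "norm s \<le> 3 + \<bar>Im s\<bar>" "norm (s - 1) \<le> 3 + \<bar>Im s\<bar>" if "1 / 2 \<le> Re s" "Re s \<le> 2" for s
    using cmod_le[of s] cmod_le[of "s - 1"] that by auto
  obtain P where P: "\<And>v. (3 + \<bar>v\<bar>) ^ (m + m) * exp (- \<delta> * v\<^sup>2) \<le> P"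
    using power_gaussian_bounded[OF assms] by blast
  obtain P' where P': "\<And>v. (3 + \<bar>v\<bar>) ^ m * exp (- \<delta> * v\<^sup>2) \<le> P'"
    using power_gaussian_bounded[OF assms] by blast
  \<comment> \<open>The factor has modulus exp (\<delta> (Re s)^2 - \<delta> (Im s)^2), so the claim
    becomes boundedness of an entire function, to which the strip theorem applies.\<close>
  define f where "f s = Xi s * exp (of_real \<delta> * s\<^sup>2)" for s
  have norm_f: "norm (f s) = norm (Xi s) * exp (- \<delta> * (Im s)\<^sup>2) * exp (\<delta> * (Re s)\<^sup>2)" for s
    by (simp add: f_def norm_mult power2_eq_square algebra_simps flip: exp_add)
  have sq: "exp (\<delta> * (Re s)\<^sup>2) \<le> exp (\<delta> * 4)" if "-1 \<le> Re s" "Re s \<le> 2" for s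
  proof -
    have "\<bar>Re s\<bar> \<le> 2" using that by auto
    then have "(Re s)\<^sup>2 \<le> 2\<^sup>2" by (subst abs_le_square_iff[symmetric]) simp
    then show ?thesis using assms by simp
  qed
  have bound_f: "norm (f s) \<le> P * K * F_bound * exp (\<delta> * 4)" if "Re s = 2 \<or> Re s = -1" for s
  proof -
    have "norm (Xi s) \<le> K * (3 + \<bar>Im s\<bar>) ^ (m + m) * F_bound"
    proof (rule reflect[where S = "{2}"])
      fix s assume "Re s \<in> {2}"
      then have s: "Re s = 2" by simp
      have "norm (Xi s) \<le> K * norm s ^ m * (norm (s - 1) ^ m * norm (F s))"
        using Xi_le[of s] G(2)[of s] s by (simp add: norm_mult norm_power)
      also have "\<dots> \<le> K * (3 + \<bar>Im s\<bar>) ^ m * ((3 + \<bar>Im s\<bar>) ^ m * F_bound)"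
        using norm_le[of s] s K0 by (intro mult_mono power_mono norm_F_le) (auto intro!: mult_nonneg_nonneg)
      finally show "norm (Xi s) \<le> K * (3 + \<bar>Im s\<bar>) ^ (m + m) * F_bound"
        by (simp add: power_add mult_ac)
    qed (use that in auto)
    then have "norm (f s) \<le> K * (3 + \<bar>Im s\<bar>) ^ (m + m) * F_bound * exp (- \<delta> * (Im s)\<^sup>2) * exp (\<delta> * 4)"
      unfolding norm_f using sq[of s] that F_bound_nonneg K0 by (intro mult_mono) auto
    also have "\<dots> = ((3 + \<bar>Im s\<bar>) ^ (m + m) * exp (- \<delta> * (Im s)\<^sup>2)) * (K * F_bound * exp (\<delta> * 4))"
      by (simp only: mult_ac)
    also have "\<dots> \<le> P * (K * F_bound * exp (\<delta> * 4))"
      using F_bound_nonneg K0 by (intro mult_right_mono P) auto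
    finally show ?thesis by (simp only: mult_ac)
  qed
  \<comment> \<open>The 8 is generous: \<open>8 + 8 * \<bar>Im s\<bar>\<close> has to be at least 2
    and at least the norm of \<open>s\<close>, in the shape \<open>A + A * \<bar>Im z\<bar>\<close>
    of the strip theorem.\<close>
  have growth_f: "norm (f s) \<le> (P' * K * C * exp (\<delta> * 4)) * exp ((8 + 8 * \<bar>Im s\<bar>) powr (\<bar>\<rho>\<bar> + 1))"
    if "-1 \<le> Re s" "Re s \<le> 2" for s
  proof -
    have "norm (Xi s) \<le> K * (3 + \<bar>Im s\<bar>) ^ m * (C * exp ((8 + 8 * \<bar>Im s\<bar>) powr (\<bar>\<rho>\<bar> + 1)))"
    proof (rule reflect[where S = "{1/2..2}"])
      fix s assume "Re s \<in> {1 / 2..2}"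
      then have s: "1 / 2 \<le> Re s" "Re s \<le> 2" by auto
      have "norm s powr \<rho> \<le> (8 + 8 * \<bar>Im s\<bar>) powr (\<bar>\<rho>\<bar> + 1)"
        using complex_Re_le_cmod[of s] norm_le(1)[OF s] s by (intro powr_le_powr_abs) auto
      then have "C * exp (norm s powr \<rho>) \<le> C * exp ((8 + 8 * \<bar>Im s\<bar>) powr (\<bar>\<rho>\<bar> + 1))"
        using C by (intro mult_left_mono) auto
      with G_le[of s] have "norm (G s) \<le> C * exp ((8 + 8 * \<bar>Im s\<bar>) powr (\<bar>\<rho>\<bar> + 1))" by linarith
      moreover have "norm s ^ m \<le> (3 + \<bar>Im s\<bar>) ^ m" using norm_le[OF s] by (intro power_mono) auto
      ultimately have "K * norm s ^ m * norm (G s) \<le> K * (3 + \<bar>Im s\<bar>) ^ m * (C * exp ((8 + 8 * \<bar>Im s\<bar>) powr (\<bar>\<rho>\<bar> + 1)))"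
        using K0 by (intro mult_mono) auto
      with Xi_le[OF s] show "norm (Xi s) \<le> K * (3 + \<bar>Im s\<bar>) ^ m * (C * exp ((8 + 8 * \<bar>Im s\<bar>) powr (\<bar>\<rho>\<bar> + 1)))"
        by linarith
    qed (use that in auto)
    then have "norm (f s) \<le> K * (3 + \<bar>Im s\<bar>) ^ m * (C * exp ((8 + 8 * \<bar>Im s\<bar>) powr (\<bar>\<rho>\<bar> + 1))) * exp (- \<delta> * (Im s)\<^sup>2) * exp (\<delta> * 4)"
      unfolding norm_f using sq[OF that] C K0 by (intro mult_mono) auto
    also have "\<dots> = ((3 + \<bar>Im s\<bar>) ^ m * exp (- \<delta> * (Im s)\<^sup>2)) * (K * C * exp (\<delta> * 4) * exp ((8 + 8 * \<bar>Im s\<bar>) powr (\<bar>\<rho>\<bar> + 1)))"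
      by (simp only: mult_ac)
    also have "\<dots> \<le> P' * (K * C * exp (\<delta> * 4) * exp ((8 + 8 * \<bar>Im s\<bar>) powr (\<bar>\<rho>\<bar> + 1)))"
      using C K0 by (intro mult_right_mono P') auto
    finally show ?thesis by (simp only: mult_ac)
  qed
  show thesis
  proof
    fix s assume s: "-1 \<le> Re s" "Re s \<le> 2"
    have "norm (f s) \<le> P * K * F_bound * exp (\<delta> * 4)"
    proof (rule phragmen_lindelof_strip[of f "-1" 2 8 "\<bar>\<rho>\<bar> + 1"])
      show "f holomorphic_on UNIV" unfolding f_def by (intro holomorphic_intros Xi_holomorphic)
    qed (use s growth_f bound_f in auto)
    moreover have "norm (Xi s) * exp (- \<delta> * (Im s)\<^sup>2) \<le> norm (f s)"
    proof -
      have "norm (Xi s) * exp (- \<delta> * (Im s)\<^sup>2) * 1 \<le> norm (f s)"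
        unfolding norm_f using assms by (intro mult_left_mono) auto
      then show ?thesis by simp
    qed
    ultimately have "norm (Xi s) * exp (- \<delta> * (Im s)\<^sup>2) \<le> P * K * F_bound * exp (\<delta> * 4)" by linarith
    then show "norm (Xi s) \<le> P * K * F_bound * exp (\<delta> * 4) * exp (\<delta> * (Im s)\<^sup>2)"
      by (simp add: exp_minus field_simps)
  qed
qed

end

section \<open>The deformation as a Gaussian convolution\<close>

text \<open>Completing the square brings the Fourier weight into the form of the Gaussian kernel
  with parameter 1/\<tau>, whose integral is known.\<close>

lemma exp_gaussian_fourier_kernel:
  assumes "\<tau> > 0"
  shows "of_real (exp (- \<tau> * u\<^sup>2)) * exp (\<i> * w * of_real u)
    = exp (- w\<^sup>2 / of_real (4 * \<tau>)) * exp ((\<i> * of_real u - (- w / of_real (2 * \<tau>)))\<^sup>2 / of_real (1 / \<tau>))"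
proof -
  have "of_real (- \<tau> * u\<^sup>2) + \<i> * w * of_real u
     = - w\<^sup>2 / of_real (4 * \<tau>) + (\<i> * of_real u - (- w / of_real (2 * \<tau>)))\<^sup>2 / of_real (1 / \<tau>)"
    using assms by (simp add: field_simps power2_eq_square)
  then show ?thesis by (simp only: exp_add[symmetric] exp_of_real[symmetric])
qed

text \<open>Inserting \<open>Phi_F\<close> and exchanging the integrals leaves the Fourier transform
  of a Gaussian in \<open>u\<close>, which is again a Gaussian.\<close>

lemma xi_t_eq_gaussian_convolution:
  assumes "\<tau> > 0" and int: "integrable lborel (\<lambda>x. Xi ((1 + \<i> * of_real x) / 2))"
  shows "xi_t Xi (- \<tau>) s = of_real (1 / sqrt (pi * \<tau>)) *
    (LINT v|lborel. Xi (of_real (1 / 2) + \<i> * of_real v) * exp ((of_real (1 / 2) + \<i> * of_real v - s)\<^sup>2 / of_real \<tau>))"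
proof -
  define z where "z = - \<i> * (2 * s - 1)"
  define X where "X x = Xi ((1 + \<i> * of_real x) / 2)" for x :: real
  have int_X: "integrable lborel X" using int by (simp add: X_def[abs_def])
  then have [measurable]: "X \<in> borel_measurable borel" using borel_measurable_integrable by fastforce
  define h where "h x u = of_real (exp (- \<tau> * u\<^sup>2)) * exp (\<i> * (z - of_real x) * of_real u)" for x u :: real
  define f where "f x u = X x * h x u" for x u
  have h_eq: "h x u = exp (- (z - of_real x)\<^sup>2 / of_real (4 * \<tau>))
     * exp ((\<i> * of_real u - (- (z - of_real x) / of_real (2 * \<tau>)))\<^sup>2 / of_real (1 / \<tau>))" for x u
    unfolding h_def by (rule exp_gaussian_fourier_kernel[OF assms(1)])
  have int_h: "integrable lborel (h x)" for x
    unfolding h_eq[abs_def] using assms(1) by (intro integrable_mult_right integrable_gaussian_kernel) auto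
  have h_integral: "(LINT u|lborel. h x u) = exp (- (z - of_real x)\<^sup>2 / of_real (4 * \<tau>)) * of_real (sqrt (pi / \<tau>))" for x
    unfolding h_eq[abs_def] integral_mult_right_zero
    by (subst integral_gaussian_kernel) (use assms(1) in auto)
  \<comment> \<open>Independent of \<open>x\<close>, which only rotates the phase. Hence the double
    integral converges absolutely once \<open>X\<close> is integrable.\<close>
  have norm_h: "norm (h x u) = exp (- \<tau> * u\<^sup>2 - Im z * u)" for x u
    by (simp add: h_def norm_mult algebra_simps flip: exp_add)
  have [measurable]: "(\<lambda>p. h (fst p) (snd p)) \<in> borel_measurable (lborel \<Otimes>\<^sub>M lborel)"
    unfolding h_def by measurable
  have "integrable (lborel \<Otimes>\<^sub>M lborel) (\<lambda>p. f (fst p) (snd p))"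
  proof (rule lborel_pair.Fubini_integrable)
    show "(\<lambda>p. f (fst p) (snd p)) \<in> borel_measurable (lborel \<Otimes>\<^sub>M lborel)"
      unfolding f_def by measurable
    have "(\<lambda>x. LINT u|lborel. norm (f x u)) = (\<lambda>x. norm (X x) * (LINT u|lborel. exp (- \<tau> * u\<^sup>2 - Im z * u)))"
      by (simp add: f_def norm_mult norm_h)
    then show "integrable lborel (\<lambda>x. LINT y|lborel. norm (f (fst (x, y)) (snd (x, y))))"
      using int_X by simp
    show "AE x in lborel. integrable lborel (\<lambda>y. f (fst (x, y)) (snd (x, y)))"
      using int_h by (simp add: f_def)
  qed
  then have Fub: "integrable (lborel \<Otimes>\<^sub>M lborel) (case_prod f)"
    by (simp add: case_prod_beta')
  have "xi_t Xi (- \<tau>) s = (LINT u|lborel. of_real (1 / (2 * pi)) * (LINT x|lborel. f x u))"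
    unfolding xi_t_def Let_def z_def[symmetric]
  proof (intro Bochner_Integration.integral_cong refl)
    fix u :: real
    have "of_real (exp (- \<tau> * u\<^sup>2)) * Phi_F Xi u * exp (\<i> * z * of_real u)
       = of_real (1 / (2 * pi)) * ((of_real (exp (- \<tau> * u\<^sup>2)) * exp (\<i> * z * of_real u))
          * (LINT x|lborel. X x * exp (- \<i> * of_real (x * u))))"
      by (simp add: Phi_F_def X_def)
    also have "(of_real (exp (- \<tau> * u\<^sup>2)) * exp (\<i> * z * of_real u)) * (LINT x|lborel. X x * exp (- \<i> * of_real (x * u)))
        = (LINT x|lborel. (of_real (exp (- \<tau> * u\<^sup>2)) * exp (\<i> * z * of_real u)) * (X x * exp (- \<i> * of_real (x * u))))"
      by (rule integral_mult_right_zero[symmetric])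
    also have "\<dots> = (LINT x|lborel. f x u)"
      by (intro Bochner_Integration.integral_cong refl) (simp add: f_def h_def algebra_simps exp_diff exp_minus divide_inverse)
    finally show "of_real (exp (- \<tau> * u\<^sup>2)) * Phi_F Xi u * exp (\<i> * z * of_real u)
       = of_real (1 / (2 * pi)) * (LINT x|lborel. f x u)" .
  qed
  also have "\<dots> = of_real (1 / (2 * pi)) * (LINT u|lborel. LINT x|lborel. f x u)"
    by (rule integral_mult_right_zero)
  also have "(LINT u|lborel. LINT x|lborel. f x u) = (LINT x|lborel. LINT u|lborel. f x u)"
    by (rule lborel_pair.Fubini_integral[OF Fub])
  also have "\<dots> = (LINT x|lborel. of_real (sqrt (pi / \<tau>)) * (X x * exp (- (z - of_real x)\<^sup>2 / of_real (4 * \<tau>))))"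
    by (simp add: f_def h_integral mult_ac)
  also have "\<dots> = of_real (sqrt (pi / \<tau>)) * (LINT x|lborel. X x * exp (- (z - of_real x)\<^sup>2 / of_real (4 * \<tau>)))"
    by (rule integral_mult_right_zero)
  \<comment> \<open>Substitution x = 2v, because x parametrises the critical line as (1 +
    ix)/2.\<close>
  also have "(LINT x|lborel. X x * exp (- (z - of_real x)\<^sup>2 / of_real (4 * \<tau>)))
     = 2 * (LINT v|lborel. X (2 * v) * exp (- (z - of_real (2 * v))\<^sup>2 / of_real (4 * \<tau>)))"
    by (subst lborel_integral_real_affine[of 2 _ 0]) (auto simp: scaleR_conv_of_real)
  also have "(LINT v|lborel. X (2 * v) * exp (- (z - of_real (2 * v))\<^sup>2 / of_real (4 * \<tau>)))
    = (LINT v|lborel. Xi (of_real (1 / 2) + \<i> * of_real v) * exp ((of_real (1 / 2) + \<i> * of_real v - s)\<^sup>2 / of_real \<tau>))"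
  proof (intro Bochner_Integration.integral_cong refl arg_cong2[of _ _ _ _ "(*)"] arg_cong[of _ _ exp])
    fix v :: real
    show "X (2 * v) = Xi (of_real (1 / 2) + \<i> * of_real v)"
      by (simp add: X_def add_divide_distrib)
    have "z - of_real (2 * v) = 2 * \<i> * (of_real (1 / 2) + \<i> * of_real v - s)"
      by (simp add: z_def algebra_simps)
    then have "- (z - of_real (2 * v))\<^sup>2 = 4 * (of_real (1 / 2) + \<i> * of_real v - s)\<^sup>2"
      by (simp only: power_mult_distrib) simp
    then show "- (z - of_real (2 * v))\<^sup>2 / of_real (4 * \<tau>) = (of_real (1 / 2) + \<i> * of_real v - s)\<^sup>2 / of_real \<tau>"
      by simp
  qed
  also have "of_real (1 / (2 * pi)) * (of_real (sqrt (pi / \<tau>)) * (2 * I)) = of_real (1 / sqrt (pi * \<tau>)) * I" for I :: complex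
  proof -
    have "1 / (2 * pi) * sqrt (pi / \<tau>) * 2 = 1 / sqrt (pi * \<tau>)"
      using assms(1) by (simp add: real_sqrt_divide real_sqrt_mult field_simps)
    from arg_cong[OF this, of complex_of_real] show ?thesis
      by (simp only: of_real_mult of_real_numeral mult_ac)
  qed
  finally show ?thesis .
qed

text \<open>Decay of \<open>\<xi>\<close> on the critical line need not be proved: a non-integrable integrand has integral 0 by
  convention, which makes the deformed function vanish identically.\<close>

lemma xi_t_eq_0_if_not_integrable:
  assumes "\<not> integrable lborel (\<lambda>x. Xi ((1 + \<i> * of_real x) / 2))"
  shows "xi_t Xi t s = 0"
proof -
  have "Phi_F Xi u = 0" for u
  proof -
    have "\<not> integrable lborel (\<lambda>x. Xi ((1 + \<i> * of_real x) / 2) * exp (- \<i> * of_real (x * u)))"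
    proof
      assume "integrable lborel (\<lambda>x. Xi ((1 + \<i> * of_real x) / 2) * exp (- \<i> * of_real (x * u)))" (is "integrable _ ?g")
      note int = this
      have "integrable lborel (\<lambda>x. ?g x * exp (\<i> * of_real (x * u)))"
      proof (rule Bochner_Integration.integrable_bound[OF int])
        have "(\<lambda>x. exp (\<i> * of_real (x * u))) \<in> borel_measurable lborel" by measurable
        then show "(\<lambda>x. ?g x * exp (\<i> * of_real (x * u))) \<in> borel_measurable lborel"
          by (rule borel_measurable_times[OF borel_measurable_integrable[OF int]])
      qed (auto simp: norm_mult)
      also have "(\<lambda>x. ?g x * exp (\<i> * of_real (x * u))) = (\<lambda>x. Xi ((1 + \<i> * of_real x) / 2))"
        by (simp add: mult.assoc flip: exp_add)
      finally show False using assms by simp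
    qed
    then show ?thesis unfolding Phi_F_def by (subst not_integrable_integral_eq) auto
  qed
  then show ?thesis by (simp add: xi_t_def)
qed

section \<open>Behaviour far up the critical strip\<close>

lemma borel_measurable_Gamma_complex [measurable]: "(Gamma :: complex \<Rightarrow> complex) \<in> borel_measurable borel"
  unfolding Gamma_def[abs_def]
  by (intro borel_measurable_inverse borel_measurable_continuous_onI continuous_on_rGamma)

lemma not_nonpos_Int_if_Re_pos: "0 < Re z \<Longrightarrow> z \<notin> \<int>\<^sub>\<le>\<^sub>0"
  by (auto elim!: nonpos_Ints_cases)

lemma norm_add_imaginary_quotient_le:
  assumes "1 \<le> norm p"
  shows "norm ((p + \<i> * of_real v) / p) \<le> exp \<bar>v\<bar>"
proof -
  have "norm (p + \<i> * of_real v) \<le> norm p + \<bar>v\<bar>"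
    using norm_triangle_ineq[of p "\<i> * of_real v"] by (simp add: norm_mult)
  also have "\<dots> \<le> norm p + \<bar>v\<bar> * norm p"
    using mult_left_mono[OF assms, of "\<bar>v\<bar>"] by simp
  also have "\<dots> = (1 + \<bar>v\<bar>) * norm p" by (simp add: algebra_simps)
  also have "\<dots> \<le> exp \<bar>v\<bar> * norm p" by (intro mult_right_mono exp_ge_add_one_self) auto
  finally show ?thesis using assms by (simp add: norm_divide divide_le_eq)
qed

lemma add_imaginary_quotient_tendsto_1:
  "((\<lambda>T. (of_real c + \<i> * of_real T + \<i> * of_real v) / (of_real c + \<i> * of_real T)) \<longlongrightarrow> 1) at_top"
proof -
  have "((\<lambda>T. \<i> * of_real v / (of_real c + \<i> * of_real T)) \<longlongrightarrow> 0) at_top"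
  proof (rule Lim_null_comparison)
    show "\<forall>\<^sub>F T in at_top. norm (\<i> * of_real v / (of_real c + \<i> * of_real T)) \<le> \<bar>v\<bar> / T"
      using eventually_gt_at_top[of 0]
    proof eventually_elim
      case (elim T)
      then have "T \<le> norm (of_real c + \<i> * of_real T)"
        using abs_Im_le_cmod[of "of_real c + \<i> * of_real T"] by simp
      then show ?case using elim by (auto simp: norm_divide norm_mult intro!: divide_left_mono mult_pos_pos)
    qed
    show "((\<lambda>T. \<bar>v\<bar> / T) \<longlongrightarrow> 0) at_top" by real_asymp
  qed
  from tendsto_add[OF tendsto_const[of 1] this]
  have lim: "((\<lambda>T. 1 + \<i> * of_real v / (of_real c + \<i> * of_real T)) \<longlongrightarrow> 1) at_top" by simp
  show ?thesis
  proof (rule Lim_transform_eventually[OF lim])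
    show "\<forall>\<^sub>F T in at_top. 1 + \<i> * of_real v / (of_real c + \<i> * of_real T)
      = (of_real c + \<i> * of_real T + \<i> * of_real v) / (of_real c + \<i> * of_real T)"
      using eventually_gt_at_top[of 0]
    proof eventually_elim
      case (elim T)
      then have "of_real c + \<i> * of_real T \<noteq> 0" by (auto simp: complex_eq_iff)
      then show ?case by (simp add: field_simps)
    qed
  qed
qed

lemma filterlim_sum_at_top:
  fixes f :: "'i \<Rightarrow> 'a \<Rightarrow> real"
  assumes "finite I" "I \<noteq> {}" and "\<And>i. i \<in> I \<Longrightarrow> filterlim (f i) at_top \<F>"
  shows "filterlim (\<lambda>x. \<Sum>i\<in>I. f i x) at_top \<F>"
  using assms
proof (induction I rule: finite_ne_induct)
  case (insert i I)
  then show ?case by (simp add: filterlim_at_top_add_at_top)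
qed simp

context selberg_data
begin

lemma xi_t_eq_shifted:
  assumes "\<tau> > 0" and int: "integrable lborel (\<lambda>x. Xi ((1 + \<i> * of_real x) / 2))"
  shows "xi_t Xi (- \<tau>) s = of_real (1 / sqrt (pi * \<tau>)) *
    (LINT v|lborel. Xi (2 + \<i> * of_real v) * exp ((2 + \<i> * of_real v - s)\<^sup>2 / of_real \<tau>))"
proof -
  define f where "f w = Xi w * exp ((w - s)\<^sup>2 / of_real \<tau>)" for w
  \<comment> \<open>The choice \<delta> = 1/(4\<tau>) spends half of the decay exp (- v^2/(2\<tau>))
    that \<open>norm_gaussian_kernel_le\<close> leaves.\<close>
  obtain B where B: "\<And>s. -1 \<le> Re s \<Longrightarrow> Re s \<le> 2 \<Longrightarrow> norm (Xi s) \<le> B * exp (1 / (4 * \<tau>) * (Im s)\<^sup>2)"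
    using Xi_gaussian_bound[of "1 / (4 * \<tau>)"] assms(1) by (auto simp del: times_divide_eq_left)
  have B0: "0 \<le> B" using order_trans[OF norm_ge_zero B[of 0]] by simp
  define R where "R = norm s + 2"
  have "(LINT v|lborel. f (of_real (1 / 2) + \<i> * of_real v)) = (LINT v|lborel. f (of_real 2 + \<i> * of_real v))"
  proof (rule integral_vertical_lines_eq)
    show "f holomorphic_on UNIV"
      unfolding f_def using assms(1) by (intro holomorphic_intros Xi_holomorphic) auto
    fix x v :: real assume x: "x \<in> {1 / 2..2}"
    have "norm (s - of_real x) \<le> R"
      using norm_triangle_ineq4[of s "of_real x"] x by (simp add: R_def)
    from norm_gaussian_kernel_le[OF assms(1) this, of v]
    have "norm (exp ((of_real x + \<i> * of_real v - s)\<^sup>2 / of_real \<tau>)) \<le> exp (R\<^sup>2 / \<tau>) * exp (- v\<^sup>2 / (2 * \<tau>))"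
      by (simp add: algebra_simps)
    moreover have "norm (Xi (of_real x + \<i> * of_real v)) \<le> B * exp (1 / (4 * \<tau>) * v\<^sup>2)"
      using B[of "of_real x + \<i> * of_real v"] x by simp
    ultimately have "norm (f (of_real x + \<i> * of_real v))
      \<le> (B * exp (1 / (4 * \<tau>) * v\<^sup>2)) * (exp (R\<^sup>2 / \<tau>) * exp (- v\<^sup>2 / (2 * \<tau>)))"
      unfolding f_def norm_mult using B0 by (intro mult_mono) auto
    also have "\<dots> = B * exp (R\<^sup>2 / \<tau>) * (exp (1 / (4 * \<tau>) * v\<^sup>2) * exp (- v\<^sup>2 / (2 * \<tau>)))"
      by (simp only: mult_ac)
    also have "exp (1 / (4 * \<tau>) * v\<^sup>2) * exp (- v\<^sup>2 / (2 * \<tau>)) = exp (- (1 / (4 * \<tau>)) * v\<^sup>2)"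
      using assms(1) by (simp add: field_simps flip: exp_add)
    finally show "norm (f (of_real x + \<i> * of_real v)) \<le> B * exp (R\<^sup>2 / \<tau>) * exp (- (1 / (4 * \<tau>)) * v\<^sup>2)" .
  qed (use assms(1) in auto)
  then show ?thesis
    unfolding xi_t_eq_gaussian_convolution[OF assms] f_def by simp
qed

text \<open>What is left of \<gamma> (p + iv) / \<gamma> p once the leading exponential exp (iv
  \<open>\<gamma>_slope p\<close>) is divided out; see \<open>gamma_factor_vertical\<close>.\<close>

definition \<gamma>_quotient :: "complex \<Rightarrow> real \<Rightarrow> complex"
  where "\<gamma>_quotient p v = ((p + \<i> * of_real v) / p) ^ m * ((p - 1 + \<i> * of_real v) / (p - 1)) ^ m
    * (\<Prod>i<k. gamma_ratio (\<gamma>_arg i p) (\<omega> i * v))"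

text \<open>The logarithmic derivative of the gamma factor, up to terms that vanish at infinity.\<close>

definition \<gamma>_slope :: "complex \<Rightarrow> complex"
  where "\<gamma>_slope p = of_real (ln Q) + (\<Sum>i<k. of_real (\<omega> i) * Ln (\<gamma>_arg i p))"

lemma gamma_factor_vertical:
  assumes "Re p = 2"
  shows "\<gamma> (p + \<i> * of_real v) * exp (- (\<i> * of_real v * \<gamma>_slope p)) = \<gamma> p * \<gamma>_quotient p v"
proof -
  define q where "q = p + \<i> * of_real v"
  have nz: "p \<noteq> 0" "p - 1 \<noteq> 0" using assms by auto
  have Gamma_q: "Gamma (\<gamma>_arg i q) * exp (- (\<i> * of_real v * (of_real (\<omega> i) * Ln (\<gamma>_arg i p))))
      = Gamma (\<gamma>_arg i p) * gamma_ratio (\<gamma>_arg i p) (\<omega> i * v)" if "i < k" for i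
  proof -
    define W where "W = \<gamma>_arg i p"
    have "W \<notin> \<int>\<^sub>\<le>\<^sub>0"
      using Re_gamma_arg_pos[OF that, of p] assms by (intro not_nonpos_Int_if_Re_pos) (simp add: W_def)
    then have "Gamma W \<noteq> 0" by (simp add: Gamma_eq_zero_iff)
    moreover have "\<gamma>_arg i q = W + \<i> * of_real (\<omega> i * v)"
      by (simp add: q_def W_def algebra_simps)
    ultimately show ?thesis
      unfolding W_def[symmetric] by (simp add: gamma_ratio_def mult_ac)
  qed
  have powr_q: "of_real Q powr q * exp (- (\<i> * of_real v * of_real (ln Q))) = of_real Q powr p"
    using Q_pos by (simp add: powr_def q_def Ln_of_real algebra_simps flip: exp_add)
  have slope: "- (\<i> * of_real v * \<gamma>_slope p)
     = - (\<i> * of_real v * of_real (ln Q)) + (\<Sum>i<k. - (\<i> * of_real v * (of_real (\<omega> i) * Ln (\<gamma>_arg i p))))"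
    by (simp add: \<gamma>_slope_def distrib_left sum_distrib_left sum_negf)
  have "exp (- (\<i> * of_real v * \<gamma>_slope p))
     = exp (- (\<i> * of_real v * of_real (ln Q))) * (\<Prod>i<k. exp (- (\<i> * of_real v * (of_real (\<omega> i) * Ln (\<gamma>_arg i p)))))"
    by (simp only: slope exp_add exp_sum[OF finite_lessThan])
  then have "\<gamma> q * exp (- (\<i> * of_real v * \<gamma>_slope p))
    = \<alpha> * q ^ m * (q - 1) ^ m * (of_real Q powr q * exp (- (\<i> * of_real v * of_real (ln Q))))
      * ((\<Prod>i<k. Gamma (\<gamma>_arg i q)) * (\<Prod>i<k. exp (- (\<i> * of_real v * (of_real (\<omega> i) * Ln (\<gamma>_arg i p))))))"
    unfolding selberg_gamma_def by (simp only: mult_ac)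
  also have "(\<Prod>i<k. Gamma (\<gamma>_arg i q)) * (\<Prod>i<k. exp (- (\<i> * of_real v * (of_real (\<omega> i) * Ln (\<gamma>_arg i p)))))
    = (\<Prod>i<k. Gamma (\<gamma>_arg i p)) * (\<Prod>i<k. gamma_ratio (\<gamma>_arg i p) (\<omega> i * v))"
    unfolding prod.distrib[symmetric] using Gamma_q by (intro prod.cong) auto
  also have "q ^ m = p ^ m * ((p + \<i> * of_real v) / p) ^ m"
    using nz by (simp add: q_def flip: power_mult_distrib)
  also have "(q - 1) ^ m = (p - 1) ^ m * ((p - 1 + \<i> * of_real v) / (p - 1)) ^ m"
  proof -
    have "q - 1 = p - 1 + \<i> * of_real v" by (simp add: q_def)
    also have "\<dots> = (p - 1) * ((p - 1 + \<i> * of_real v) / (p - 1))" using nz by simp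
    finally show ?thesis by (simp only: power_mult_distrib)
  qed
  finally show ?thesis
    unfolding powr_q q_def[symmetric] selberg_gamma_def \<gamma>_quotient_def by (simp only: mult_ac)
qed

text \<open>The 2m polynomial quotients contribute rate 1 each, through 1 + |v| \<le> exp |v|; the
  rest comes from \<open>norm_gamma_ratio_le\<close>. The height does not enter, so one majorant
  serves for all T.\<close>

definition quotient_rate :: real
  where "quotient_rate = 2 * real m + (\<Sum>i<k. (gamma_tail (2 * \<omega> i + Re (\<mu> i)) 0 + 2 * pi) * \<omega> i)"

lemma norm_gamma_quotient_le:
  assumes "Re p = 2"
  shows "norm (\<gamma>_quotient p v) \<le> exp (quotient_rate * \<bar>v\<bar>)"
proof -
  have "1 \<le> norm p" "1 \<le> norm (p - 1)"
    using complex_Re_le_cmod[of p] complex_Re_le_cmod[of "p - 1"] assms by auto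
  then have "norm ((p + \<i> * of_real v) / p) \<le> exp \<bar>v\<bar>" "norm ((p - 1 + \<i> * of_real v) / (p - 1)) \<le> exp \<bar>v\<bar>"
    by (intro norm_add_imaginary_quotient_le; simp)+
  then have "norm (((p + \<i> * of_real v) / p) ^ m) \<le> exp \<bar>v\<bar> ^ m"
    "norm (((p - 1 + \<i> * of_real v) / (p - 1)) ^ m) \<le> exp \<bar>v\<bar> ^ m"
    unfolding norm_power by (intro power_mono; simp)+
  moreover have "norm (\<Prod>i<k. gamma_ratio (\<gamma>_arg i p) (\<omega> i * v))
     \<le> (\<Prod>i<k. exp ((gamma_tail (2 * \<omega> i + Re (\<mu> i)) 0 + 2 * pi) * \<omega> i * \<bar>v\<bar>))"
    unfolding prod_norm[symmetric]
  proof (intro prod_mono conjI norm_ge_zero)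
    fix i assume "i \<in> {..<k}"
    then have i: "i < k" by simp
    show "norm (gamma_ratio (\<gamma>_arg i p) (\<omega> i * v)) \<le> exp ((gamma_tail (2 * \<omega> i + Re (\<mu> i)) 0 + 2 * pi) * \<omega> i * \<bar>v\<bar>)"
      using norm_gamma_ratio_le[OF Re_gamma_arg_pos[OF i, of p], of "\<omega> i * v"] assms omega_pos[OF i]
      by (simp add: abs_mult mult_ac)
  qed
  ultimately have "norm (\<gamma>_quotient p v) \<le> exp \<bar>v\<bar> ^ m * exp \<bar>v\<bar> ^ m
     * (\<Prod>i<k. exp ((gamma_tail (2 * \<omega> i + Re (\<mu> i)) 0 + 2 * pi) * \<omega> i * \<bar>v\<bar>))"
    unfolding \<gamma>_quotient_def norm_mult by (intro mult_mono) auto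
  also have "\<dots> = exp (quotient_rate * \<bar>v\<bar>)"
    by (simp add: quotient_rate_def exp_sum[symmetric] exp_of_nat_mult[symmetric] algebra_simps sum_distrib_left
        flip: exp_add)
  finally show ?thesis .
qed

lemma gamma_arg_line: "\<gamma>_arg i (2 + \<i> * of_real T) = Complex (2 * \<omega> i + Re (\<mu> i)) (\<omega> i * T + Im (\<mu> i))"
  by (simp add: complex_eq_iff)

lemma gamma_quotient_tendsto_1: "((\<lambda>T. \<gamma>_quotient (2 + \<i> * of_real T) v) \<longlongrightarrow> 1) at_top"
proof -
  have "((\<lambda>T. gamma_ratio (\<gamma>_arg i (2 + \<i> * of_real T)) (\<omega> i * v)) \<longlongrightarrow> 1) at_top" if "i < k" for i
  proof -
    have "filterlim (\<lambda>T. \<omega> i * T + Im (\<mu> i)) at_top at_top"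
      using omega_pos[OF that] by real_asymp
    moreover have "2 * \<omega> i + Re (\<mu> i) > 0"
      using omega_pos[OF that] Re_mu_nonneg[OF that] by (simp add: add_pos_nonneg)
    ultimately show ?thesis
      unfolding gamma_arg_line by (intro filterlim_compose[OF gamma_ratio_tendsto_1])
  qed
  moreover have "((\<lambda>T. (2 + \<i> * of_real T + \<i> * of_real v) / (2 + \<i> * of_real T)) \<longlongrightarrow> 1) at_top"
    using add_imaginary_quotient_tendsto_1[of 2 v] by simp
  moreover have "((\<lambda>T. (2 + \<i> * of_real T - 1 + \<i> * of_real v) / (2 + \<i> * of_real T - 1)) \<longlongrightarrow> 1) at_top"
    using add_imaginary_quotient_tendsto_1[of 1 v] by (simp add: algebra_simps)
  ultimately have "((\<lambda>T. \<gamma>_quotient (2 + \<i> * of_real T) v) \<longlongrightarrow> 1 ^ m * 1 ^ m * (\<Prod>i<k. 1)) at_top"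
    unfolding \<gamma>_quotient_def by (intro tendsto_intros) auto
  then show ?thesis by simp
qed

text \<open>Each argument has norm at least its imaginary part, which grows linearly, and with k
  \<ge> 1 at least one positive weight \<omega> is present. This drives the saddle point to
  infinity.\<close>

lemma Re_gamma_slope_at_top: "filterlim (\<lambda>T. Re (\<gamma>_slope (2 + \<i> * of_real T))) at_top at_top"
proof -
  have "filterlim (\<lambda>T. \<omega> i * ln (norm (\<gamma>_arg i (2 + \<i> * of_real T)))) at_top at_top" if "i < k" for i
  proof -
    have "filterlim (\<lambda>T. \<omega> i * ln (\<omega> i * T + Im (\<mu> i))) at_top at_top"
      using omega_pos[OF that] by real_asymp
    then show ?thesis
    proof (rule filterlim_at_top_mono)
      have "\<forall>\<^sub>F T in at_top. 0 < \<omega> i * T + Im (\<mu> i)" using omega_pos[OF that] by real_asymp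
      then show "\<forall>\<^sub>F T in at_top. \<omega> i * ln (\<omega> i * T + Im (\<mu> i)) \<le> \<omega> i * ln (norm (\<gamma>_arg i (2 + \<i> * of_real T)))"
      proof eventually_elim
        case (elim T)
        have "\<omega> i * T + Im (\<mu> i) \<le> norm (\<gamma>_arg i (2 + \<i> * of_real T))"
          using abs_Im_le_cmod[of "\<gamma>_arg i (2 + \<i> * of_real T)"] by simp
        then show ?case using elim omega_pos[OF that] by (intro mult_left_mono ln_le_cancel_iff[THEN iffD2]) auto
      qed
    qed
  qed
  then have "filterlim (\<lambda>T. \<Sum>i<k. \<omega> i * ln (norm (\<gamma>_arg i (2 + \<i> * of_real T)))) at_top at_top"
    using k_pos by (intro filterlim_sum_at_top) auto
  then have "filterlim (\<lambda>T. ln Q + (\<Sum>i<k. \<omega> i * ln (norm (\<gamma>_arg i (2 + \<i> * of_real T))))) at_top at_top"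
    by (rule filterlim_tendsto_add_at_top[OF tendsto_const])
  also have "(\<lambda>T. ln Q + (\<Sum>i<k. \<omega> i * ln (norm (\<gamma>_arg i (2 + \<i> * of_real T))))) = (\<lambda>T. Re (\<gamma>_slope (2 + \<i> * of_real T)))"
  proof
    fix T :: real
    have "\<gamma>_arg i (2 + \<i> * of_real T) \<noteq> 0" if "i < k" for i
    proof -
      have "0 < Re (\<gamma>_arg i (2 + \<i> * of_real T))" by (rule Re_gamma_arg_pos[OF that]) simp
      then show ?thesis by (metis less_irrefl zero_complex.sel(1))
    qed
    then show "ln Q + (\<Sum>i<k. \<omega> i * ln (norm (\<gamma>_arg i (2 + \<i> * of_real T)))) = Re (\<gamma>_slope (2 + \<i> * of_real T))"
      by (simp add: \<gamma>_slope_def)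
  qed
  finally show ?thesis .
qed

text \<open>The point at which the deformed function is evaluated drifts to the right by
  half the slope of the gamma factor: this is the saddle point of the Gaussian integral.\<close>

lemma xi_t_on_moving_line:
  fixes T :: real
  assumes "\<tau> > 0" and int: "integrable lborel (\<lambda>x. Xi ((1 + \<i> * of_real x) / 2))"
  defines "p \<equiv> 2 + \<i> * of_real T"
  shows "xi_t Xi (- \<tau>) (p + of_real \<tau> * \<gamma>_slope p / 2 + \<zeta>)
    = of_real (1 / sqrt (pi * \<tau>)) * (\<gamma> p * exp (of_real \<tau> * (\<gamma>_slope p)\<^sup>2 / 4 + \<gamma>_slope p * \<zeta>))
      * (LINT v|lborel. \<gamma>_quotient p v * F (p + \<i> * of_real v) * exp ((\<i> * of_real v - \<zeta>)\<^sup>2 / of_real \<tau>))"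
proof -
  define \<psi> where "\<psi> = \<gamma>_slope p"
  define s where "s = p + of_real \<tau> * \<psi> / 2 + \<zeta>"
  have p: "Re p = 2" by (simp add: p_def)
  have "(LINT v|lborel. Xi (2 + \<i> * of_real v) * exp ((2 + \<i> * of_real v - s)\<^sup>2 / of_real \<tau>))
     = (LINT v|lborel. Xi (2 + \<i> * of_real (T + 1 * v)) * exp ((2 + \<i> * of_real (T + 1 * v) - s)\<^sup>2 / of_real \<tau>))"
    by (subst lborel_integral_real_affine[of 1 _ T]) auto
  also have "\<dots> = (LINT v|lborel. (\<gamma> p * exp (of_real \<tau> * \<psi>\<^sup>2 / 4 + \<psi> * \<zeta>))
      * (\<gamma>_quotient p v * F (p + \<i> * of_real v) * exp ((\<i> * of_real v - \<zeta>)\<^sup>2 / of_real \<tau>)))"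
  proof (intro Bochner_Integration.integral_cong refl)
    fix v :: real
    have line: "2 + \<i> * of_real (T + 1 * v) = p + \<i> * of_real v"
      by (simp add: p_def algebra_simps)
    \<comment> \<open>Here p + iv - s = (iv - \<zeta>) - \<tau> \<psi> / 2. The cross term produces
      - iv \<psi>, exactly the exponent that \<open>gamma_factor_vertical\<close> pairs with
      \<gamma>.\<close>
    have "(p + \<i> * of_real v - s)\<^sup>2 / of_real \<tau>
       = (of_real \<tau> * \<psi>\<^sup>2 / 4 + \<psi> * \<zeta>) + (- (\<i> * of_real v * \<psi>)) + (\<i> * of_real v - \<zeta>)\<^sup>2 / of_real \<tau>"
      using assms(1) by (simp add: s_def field_simps power2_eq_square)
    moreover have "Xi (p + \<i> * of_real v) = \<gamma> (p + \<i> * of_real v) * F (p + \<i> * of_real v)"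
      by (rule Xi_eq) (simp add: p)
    ultimately have "Xi (p + \<i> * of_real v) * exp ((p + \<i> * of_real v - s)\<^sup>2 / of_real \<tau>)
      = (\<gamma> (p + \<i> * of_real v) * exp (- (\<i> * of_real v * \<psi>))) * F (p + \<i> * of_real v)
        * exp (of_real \<tau> * \<psi>\<^sup>2 / 4 + \<psi> * \<zeta>) * exp ((\<i> * of_real v - \<zeta>)\<^sup>2 / of_real \<tau>)"
      by (simp only: exp_add mult_ac)
    also have "\<gamma> (p + \<i> * of_real v) * exp (- (\<i> * of_real v * \<psi>)) = \<gamma> p * \<gamma>_quotient p v"
      unfolding \<psi>_def by (rule gamma_factor_vertical[OF p])
    finally show "Xi (2 + \<i> * of_real (T + 1 * v)) * exp ((2 + \<i> * of_real (T + 1 * v) - s)\<^sup>2 / of_real \<tau>)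
      = (\<gamma> p * exp (of_real \<tau> * \<psi>\<^sup>2 / 4 + \<psi> * \<zeta>))
      * (\<gamma>_quotient p v * F (p + \<i> * of_real v) * exp ((\<i> * of_real v - \<zeta>)\<^sup>2 / of_real \<tau>))"
      unfolding line by (simp only: mult_ac)
  qed
  also have "\<dots> = (\<gamma> p * exp (of_real \<tau> * \<psi>\<^sup>2 / 4 + \<psi> * \<zeta>))
      * (LINT v|lborel. \<gamma>_quotient p v * F (p + \<i> * of_real v) * exp ((\<i> * of_real v - \<zeta>)\<^sup>2 / of_real \<tau>))"
    by (rule integral_mult_right_zero)
  finally show ?thesis
    unfolding xi_t_eq_shifted[OF assms(1) int] \<psi>_def[symmetric] s_def[symmetric] by (simp only: mult.assoc)
qed

end

section \<open>Limits of twisted Dirichlet series\<close>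

lemma borel_measurable_dirichlet_sum [measurable]:
  "(\<lambda>v. dirichlet_sum c (\<i> * of_real v)) \<in> borel_measurable borel"
  unfolding dirichlet_sum_def
  by (intro borel_measurable_suminf borel_measurable_continuous_onI continuous_intros)

lemma norm_dirichlet_sum_imaginary_le:
  assumes "summable (\<lambda>n. norm (c n))"
  shows "norm (dirichlet_sum c (\<i> * of_real v)) \<le> (\<Sum>n. norm (c n))"
proof -
  have eq: "norm (c n * exp (- (\<i> * of_real v) * of_real (ln (real (Suc n))))) = norm (c n)" for n
    by (simp add: norm_mult)
  show ?thesis
    using summable_norm[of "\<lambda>n. c n * exp (- (\<i> * of_real v) * of_real (ln (real (Suc n))))"] assms
    unfolding dirichlet_sum_def eq .
qed

lemma exp_linear_minus_quadratic_le:
  fixes \<tau> \<sigma> l :: real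
  assumes "\<tau> > 0"
  shows "exp (\<sigma> * l - \<tau> * l\<^sup>2 / 4) \<le> exp (\<sigma>\<^sup>2 / \<tau>)"
proof -
  have "0 \<le> (\<sigma> - \<tau> * l / 2)\<^sup>2 / \<tau>" using assms by simp
  also have "\<dots> = \<sigma>\<^sup>2 / \<tau> - (\<sigma> * l - \<tau> * l\<^sup>2 / 4)"
    using assms by (simp add: field_simps power2_eq_square)
  finally show ?thesis by simp
qed

definition gaussian_damping :: "real \<Rightarrow> (nat \<Rightarrow> complex) \<Rightarrow> nat \<Rightarrow> complex"
  where "gaussian_damping \<tau> c n = c n * of_real (exp (- \<tau> * (ln (real (Suc n)))\<^sup>2 / 4))"

lemma norm_gaussian_damping:
  "norm (gaussian_damping \<tau> c n) = norm (c n) * exp (- \<tau> * (ln (real (Suc n)))\<^sup>2 / 4)"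
  unfolding gaussian_damping_def norm_mult norm_of_real by simp

lemma summable_gaussian_damping:
  assumes "\<tau> > 0" and c: "summable (\<lambda>n. norm (c n))"
  shows "summable (\<lambda>n. norm (gaussian_damping \<tau> c n) * exp (\<sigma> * ln (real (Suc n))))"
proof (rule summable_comparison_test)
  show "summable (\<lambda>n. norm (c n) * exp (\<sigma>\<^sup>2 / \<tau>))" by (rule summable_mult2[OF c])
  have "norm (gaussian_damping \<tau> c n) * exp (\<sigma> * ln (real (Suc n))) \<le> norm (c n) * exp (\<sigma>\<^sup>2 / \<tau>)" for n
  proof -
    have "norm (gaussian_damping \<tau> c n) * exp (\<sigma> * ln (real (Suc n)))
      = norm (c n) * exp (\<sigma> * ln (real (Suc n)) - \<tau> * (ln (real (Suc n)))\<^sup>2 / 4)"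
      unfolding norm_gaussian_damping mult.assoc exp_add[symmetric] by simp
    also have "\<dots> \<le> norm (c n) * exp (\<sigma>\<^sup>2 / \<tau>)"
      by (intro mult_left_mono exp_linear_minus_quadratic_le assms) auto
    finally show ?thesis .
  qed
  then show "\<exists>N. \<forall>n\<ge>N. norm (norm (gaussian_damping \<tau> c n) * exp (\<sigma> * ln (real (Suc n)))) \<le> norm (c n) * exp (\<sigma>\<^sup>2 / \<tau>)"
    by auto
qed

text \<open>The oscillation of the term with frequency l = ln (n + 1) is absorbed by moving the
  centre of the kernel by \<tau> l / 2, at the cost of a factor exp (- \<tau> l^2 / 4). The integral
  itself does not depend on the centre.\<close>

lemma dirichlet_sum_gaussian_transform:
  assumes "\<tau> > 0" and c: "summable (\<lambda>n. norm (c n))"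
  shows "(LINT v|lborel. dirichlet_sum c (\<i> * of_real v) * exp ((\<i> * of_real v - \<zeta>)\<^sup>2 / of_real \<tau>))
    = of_real (sqrt (pi * \<tau>)) * dirichlet_sum (gaussian_damping \<tau> c) \<zeta>"
proof -
  define l where "l n = ln (real (Suc n))" for n
  define E where "E v = exp ((\<i> * of_real v - \<zeta>)\<^sup>2 / of_real \<tau>)" for v :: real
  define f where "f n v = (c n * exp (- (\<i> * of_real v) * of_real (l n))) * E v" for n v
  have f_eq: "f n v = gaussian_damping \<tau> c n * exp (- \<zeta> * of_real (l n))
      * exp ((\<i> * of_real v - (\<zeta> + of_real \<tau> * of_real (l n) / 2))\<^sup>2 / of_real \<tau>)" for n v
  proof -
    have "- (\<i> * of_real v) * of_real (l n) + (\<i> * of_real v - \<zeta>)\<^sup>2 / of_real \<tau>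
      = of_real (- \<tau> * (l n)\<^sup>2 / 4) + - \<zeta> * of_real (l n)
        + (\<i> * of_real v - (\<zeta> + of_real \<tau> * of_real (l n) / 2))\<^sup>2 / of_real \<tau>"
      using assms(1) by (simp add: field_simps power2_eq_square)
    then have "exp (- (\<i> * of_real v) * of_real (l n)) * exp ((\<i> * of_real v - \<zeta>)\<^sup>2 / of_real \<tau>)
       = of_real (exp (- \<tau> * (l n)\<^sup>2 / 4)) * exp (- \<zeta> * of_real (l n))
         * exp ((\<i> * of_real v - (\<zeta> + of_real \<tau> * of_real (l n) / 2))\<^sup>2 / of_real \<tau>)"
      by (simp only: exp_add[symmetric] exp_of_real[symmetric])
    then show ?thesis by (simp only: f_def E_def gaussian_damping_def l_def mult.assoc)
  qed
  have f_int: "integrable lborel (f n)" for n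
    unfolding f_eq[abs_def] using assms(1) by (intro integrable_mult_right integrable_gaussian_kernel)
  have f_integral: "integral\<^sup>L lborel (f n) = of_real (sqrt (pi * \<tau>)) * (gaussian_damping \<tau> c n * exp (- \<zeta> * of_real (l n)))" for n
    unfolding f_eq[abs_def] integral_mult_right_zero integral_gaussian_kernel[OF assms(1)] by (simp only: mult_ac)
  have int_E: "integrable lborel E"
    unfolding E_def by (rule integrable_gaussian_kernel[OF assms(1)])
  have norm_f: "norm (f n v) = norm (c n) * norm (E v)" for n v
    by (simp add: f_def norm_mult)
  have sums1: "(\<lambda>n. integral\<^sup>L lborel (f n)) sums (LINT v|lborel. (\<Sum>n. f n v))"
  proof (rule sums_integral[OF f_int])
    show "AE v in lborel. summable (\<lambda>n. norm (f n v))"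
      unfolding norm_f by (intro AE_I2 summable_mult2 c)
    show "summable (\<lambda>n. LINT v|lborel. norm (f n v))"
      unfolding norm_f integral_mult_right_zero by (intro summable_mult2 c)
  qed
  have f_sum: "(\<Sum>n. f n v) = dirichlet_sum c (\<i> * of_real v) * E v" for v
  proof -
    have "summable (\<lambda>n. c n * exp (- (\<i> * of_real v) * of_real (l n)))"
      by (rule summable_norm_cancel) (use c in \<open>simp add: norm_mult\<close>)
    then show ?thesis
      unfolding f_def dirichlet_sum_def l_def by (rule suminf_mult2[symmetric])
  qed
  have sums2: "(\<lambda>n. integral\<^sup>L lborel (f n)) sums (of_real (sqrt (pi * \<tau>)) * dirichlet_sum (gaussian_damping \<tau> c) \<zeta>)"
    unfolding f_integral l_def
    by (intro sums_mult dirichlet_sum_sums summable_gaussian_damping assms)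
  show ?thesis
    using sums_unique2[OF sums1 sums2] unfolding f_sum E_def .
qed

text \<open>Order at most 2, the growth hypothesis of \<open>zero_free_dirichlet_sum\<close>: the
  damping bounds each exponential independently of its frequency.\<close>

lemma norm_dirichlet_sum_damped_le:
  assumes "\<tau> > 0" and c: "summable (\<lambda>n. norm (c n))"
  shows "norm (dirichlet_sum (gaussian_damping \<tau> c) \<zeta>) \<le> (\<Sum>n. norm (c n)) * exp (1 / \<tau> * (norm \<zeta>)\<^sup>2)"
proof -
  have le: "norm (gaussian_damping \<tau> c n * exp (- \<zeta> * of_real (ln (real (Suc n))))) \<le> norm (c n) * exp (1 / \<tau> * (norm \<zeta>)\<^sup>2)" for n
  proof -
    have "norm (gaussian_damping \<tau> c n * exp (- \<zeta> * of_real (ln (real (Suc n)))))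
       = norm (c n) * exp (- Re \<zeta> * ln (real (Suc n)) - \<tau> * (ln (real (Suc n)))\<^sup>2 / 4)"
      unfolding norm_mult norm_gaussian_damping mult.assoc norm_exp_eq_Re exp_add[symmetric] by simp
    also have "\<dots> \<le> norm (c n) * exp ((- Re \<zeta>)\<^sup>2 / \<tau>)"
      by (intro mult_left_mono exp_linear_minus_quadratic_le assms) auto
    also have "\<dots> \<le> norm (c n) * exp ((norm \<zeta>)\<^sup>2 / \<tau>)"
    proof -
      have "(- Re \<zeta>)\<^sup>2 \<le> (norm \<zeta>)\<^sup>2" by (simp add: cmod_power2)
      then have "(- Re \<zeta>)\<^sup>2 / \<tau> \<le> (norm \<zeta>)\<^sup>2 / \<tau>" using assms(1) by (intro divide_right_mono) auto
      then show ?thesis by (intro mult_left_mono) auto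
    qed
    finally show ?thesis by simp
  qed
  have sum_c: "summable (\<lambda>n. norm (c n) * exp (1 / \<tau> * (norm \<zeta>)\<^sup>2))" by (rule summable_mult2[OF c])
  have sum_n: "summable (\<lambda>n. norm (gaussian_damping \<tau> c n * exp (- \<zeta> * of_real (ln (real (Suc n))))))"
    by (rule summable_comparison_test[OF _ sum_c]) (use le in auto)
  have "norm (dirichlet_sum (gaussian_damping \<tau> c) \<zeta>) \<le> (\<Sum>n. norm (gaussian_damping \<tau> c n * exp (- \<zeta> * of_real (ln (real (Suc n))))))"
    unfolding dirichlet_sum_def by (rule summable_norm[OF sum_n])
  also have "\<dots> \<le> (\<Sum>n. norm (c n) * exp (1 / \<tau> * (norm \<zeta>)\<^sup>2))"
    by (rule suminf_le[OF le sum_n sum_c])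
  also have "\<dots> = (\<Sum>n. norm (c n)) * exp (1 / \<tau> * (norm \<zeta>)\<^sup>2)"
    by (rule suminf_mult2[OF c, symmetric])
  finally show ?thesis .
qed

text \<open>Holomorphy is read off the integral representation instead of the series.\<close>

lemma holomorphic_dirichlet_sum_damped:
  assumes "\<tau> > 0" and c: "summable (\<lambda>n. norm (c n))"
  shows "dirichlet_sum (gaussian_damping \<tau> c) holomorphic_on UNIV"
proof -
  have "(\<lambda>\<zeta>. (LINT v|lborel. dirichlet_sum c (\<i> * of_real v) * exp ((\<i> * of_real v - \<zeta>)\<^sup>2 / of_real \<tau>))
      / of_real (sqrt (pi * \<tau>))) holomorphic_on UNIV"
    using assms(1) norm_dirichlet_sum_imaginary_le[OF c]
    by (intro holomorphic_intros holomorphic_gaussian_kernel_integral[where M = "\<Sum>n. norm (c n)" and K = 0]) auto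
  moreover have "of_real (sqrt (pi * \<tau>)) \<noteq> (0::complex)" using assms(1) by simp
  ultimately show ?thesis
    unfolding dirichlet_sum_gaussian_transform[OF assms] by simp
qed

section \<open>The Dirichlet series on the abscissa 2 and its twists\<close>

context selberg_data
begin

definition coeff2 :: "nat \<Rightarrow> complex"
  where "coeff2 n = a (Suc n) * of_real (exp (- 2 * ln (real (Suc n))))"

lemma norm_coeff2: "norm (coeff2 n) = norm (a (Suc n)) * exp (- 2 * ln (real (Suc n)))"
  unfolding coeff2_def norm_mult norm_of_real by simp

lemma summable_coeff2: "summable (\<lambda>n. norm (coeff2 n))"
  unfolding norm_coeff2 by (rule coeff_summable)

lemma F_on_line:
  "F (2 + \<i> * of_real T + \<i> * of_real v)
    = dirichlet_sum (\<lambda>n. coeff2 n * exp (- (\<i> * of_real T * of_real (ln (real (Suc n)))))) (\<i> * of_real v)"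
proof -
  have "F (2 + \<i> * of_real T + \<i> * of_real v)
    = (\<Sum>n. a (Suc n) * of_nat (Suc n) powr (- (2 + \<i> * of_real T + \<i> * of_real v)))"
    by (rule F_eq) simp
  also have "\<dots> = dirichlet_sum (\<lambda>n. coeff2 n * exp (- (\<i> * of_real T * of_real (ln (real (Suc n)))))) (\<i> * of_real v)"
    unfolding dirichlet_sum_def coeff_term_eq_exp coeff2_def exp_of_real[symmetric]
    by (intro suminf_cong) (simp add: algebra_simps exp_add[symmetric] exp_diff[symmetric] del: of_nat_Suc flip: exp_add exp_diff)
  finally show ?thesis .
qed

text \<open>The value \<open>\<theta> n\<close> stands for a limit of the phases (n + 1)^(-iT) along
  increasing heights T.\<close>

definition limit_series :: "(nat \<Rightarrow> complex) \<Rightarrow> real \<Rightarrow> complex \<Rightarrow> complex"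
  where "limit_series \<theta> \<tau> = dirichlet_sum (gaussian_damping \<tau> (\<lambda>n. coeff2 n * \<theta> n))"

lemma summable_twisted:
  assumes "\<And>n. norm (\<theta> n) = 1"
  shows "summable (\<lambda>n. norm (coeff2 n * \<theta> n))"
  using summable_coeff2 by (simp add: norm_mult assms)

lemma F_tendsto_twisted:
  assumes lim: "\<And>n. (\<lambda>j. exp (- (\<i> * of_real (T j) * of_real (ln (real (Suc n)))))) \<longlonglongrightarrow> \<theta> n"
  shows "(\<lambda>j. F (2 + \<i> * of_real (T j) + \<i> * of_real v)) \<longlonglongrightarrow> dirichlet_sum (\<lambda>n. coeff2 n * \<theta> n) (\<i> * of_real v)"
  unfolding F_on_line dirichlet_sum_def
proof (rule tannerys_theorem[THEN conjunct2, THEN conjunct2])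
  fix n
  show "(\<lambda>j. coeff2 n * exp (- (\<i> * of_real (T j) * of_real (ln (real (Suc n))))) * exp (- (\<i> * of_real v) * of_real (ln (real (Suc n)))))
    \<longlonglongrightarrow> coeff2 n * \<theta> n * exp (- (\<i> * of_real v) * of_real (ln (real (Suc n))))"
    by (intro tendsto_intros lim)
next
  show "\<forall>\<^sub>F (n, j) in sequentially \<times>\<^sub>F sequentially.
    norm (coeff2 n * exp (- (\<i> * of_real (T j) * of_real (ln (real (Suc n))))) * exp (- (\<i> * of_real v) * of_real (ln (real (Suc n)))))
    \<le> norm (coeff2 n)"
    by (intro always_eventually) (auto simp: norm_mult)
qed (use summable_coeff2 in auto)

lemma borel_measurable_gamma_quotient [measurable]: "\<gamma>_quotient p \<in> borel_measurable borel"
  unfolding \<gamma>_quotient_def[abs_def] gamma_ratio_def by measurable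

lemma borel_measurable_F_line [measurable]: "(\<lambda>v. F (2 + \<i> * of_real T + \<i> * of_real v)) \<in> borel_measurable borel"
  unfolding F_on_line by measurable

lemma norm_line_integrand_le:
  "norm (\<gamma>_quotient (2 + \<i> * of_real T) v * F (2 + \<i> * of_real T + \<i> * of_real v)) \<le> F_bound * exp (quotient_rate * \<bar>v\<bar>)"
proof -
  have "norm (\<gamma>_quotient (2 + \<i> * of_real T) v) * norm (F (2 + \<i> * of_real T + \<i> * of_real v))
      \<le> exp (quotient_rate * \<bar>v\<bar>) * F_bound"
    by (intro mult_mono norm_gamma_quotient_le norm_F_le) auto
  then show ?thesis by (simp add: norm_mult mult.commute)
qed

text \<open>The integral in \<open>xi_t_on_moving_line\<close>: when \<open>Xi\<close> is integrable
  on the critical line, each zero of it gives a zero of \<open>xi_t Xi (- \<tau>)\<close> at the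
  shifted point.\<close>

definition line_integral :: "real \<Rightarrow> real \<Rightarrow> complex \<Rightarrow> complex"
  where "line_integral \<tau> T \<zeta> = (LINT v|lborel. \<gamma>_quotient (2 + \<i> * of_real T) v * F (2 + \<i> * of_real T + \<i> * of_real v)
    * exp ((\<i> * of_real v - \<zeta>)\<^sup>2 / of_real \<tau>))"

lemma holomorphic_line_integral:
  assumes "\<tau> > 0"
  shows "line_integral \<tau> T holomorphic_on UNIV"
  unfolding line_integral_def
  by (rule holomorphic_gaussian_kernel_integral[OF assms _ norm_line_integrand_le]) measurable

lemma quotient_rate_nonneg: "0 \<le> quotient_rate"
  unfolding quotient_rate_def gamma_tail_def
  by (intro add_nonneg_nonneg sum_nonneg mult_nonneg_nonneg suminf_nonneg summable_gamma_tail)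
    (use omega_pos Re_mu_nonneg in \<open>auto intro!: add_pos_nonneg less_imp_le[OF omega_pos]\<close>)

text \<open>\<zeta> enters only through the kernel, which is bounded uniformly on \<open>K\<close>.
  A single quantity free of \<zeta> therefore controls the difference, and dominated convergence
  sends it to 0.\<close>

lemma line_integral_uniform_limit:
  assumes "\<tau> > 0" and T: "filterlim T at_top sequentially"
    and lim: "\<And>n. (\<lambda>j. exp (- (\<i> * of_real (T j) * of_real (ln (real (Suc n)))))) \<longlonglongrightarrow> \<theta> n"
    and \<theta>: "\<And>n. norm (\<theta> n) = 1" and "compact K"
  shows "uniform_limit K (\<lambda>j. line_integral \<tau> (T j)) (\<lambda>\<zeta>. of_real (sqrt (pi * \<tau>)) * limit_series \<theta> \<tau> \<zeta>) sequentially"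
proof -
  define p where "p j = 2 + \<i> * of_real (T j)" for j
  define g where "g v = dirichlet_sum (\<lambda>n. coeff2 n * \<theta> n) (\<i> * of_real v)" for v
  define f where "f j v = \<gamma>_quotient (p j) v * F (p j + \<i> * of_real v)" for j v
  define E where "E \<zeta> v = exp ((\<i> * of_real v - \<zeta>)\<^sup>2 / of_real \<tau>)" for \<zeta> and v :: real
  have [measurable]: "f j \<in> borel_measurable borel" for j
    unfolding f_def[abs_def] p_def by measurable
  have [measurable]: "g \<in> borel_measurable borel" "E \<zeta> \<in> borel_measurable borel" for \<zeta>
    unfolding g_def[abs_def] E_def[abs_def] by measurable
  have f_le: "norm (f j v) \<le> F_bound * exp (quotient_rate * \<bar>v\<bar>)" for j v
    unfolding f_def p_def by (rule norm_line_integrand_le)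
  have g_le: "norm (g v) \<le> F_bound * exp (quotient_rate * \<bar>v\<bar>)" for v
  proof -
    have "norm (g v) \<le> (\<Sum>n. norm (coeff2 n * \<theta> n))"
      unfolding g_def by (rule norm_dirichlet_sum_imaginary_le[OF summable_twisted[OF \<theta>]])
    also have "\<dots> = F_bound * 1" by (simp add: norm_mult \<theta> norm_coeff2 F_bound_def)
    also have "\<dots> \<le> F_bound * exp (quotient_rate * \<bar>v\<bar>)"
      using F_bound_nonneg quotient_rate_nonneg by (intro mult_left_mono) auto
    finally show ?thesis .
  qed
  have f_lim: "(\<lambda>j. f j v) \<longlonglongrightarrow> g v" for v
  proof -
    have "(\<lambda>j. f j v) \<longlonglongrightarrow> 1 * g v"
      unfolding f_def g_def p_def
      by (intro tendsto_mult F_tendsto_twisted lim filterlim_compose[OF gamma_quotient_tendsto_1 T])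
    then show ?thesis by simp
  qed
  define D where "D j = (LINT v|lborel. norm (f j v - g v) * exp (- v\<^sup>2 / (2 * \<tau>)))" for j
  define w where "w v = 2 * F_bound * exp (quotient_rate * \<bar>v\<bar> - v\<^sup>2 / (2 * \<tau>))" for v
  have int_w: "integrable lborel w"
    unfolding w_def using integrable_exp_abs_gaussian[of "2 * \<tau>"] assms(1) by auto
  have le_w: "norm (f j v - g v) * exp (- v\<^sup>2 / (2 * \<tau>)) \<le> w v" for j v
  proof -
    have "norm (f j v - g v) \<le> 2 * F_bound * exp (quotient_rate * \<bar>v\<bar>)"
      using norm_triangle_ineq4[of "f j v" "g v"] f_le[of j v] g_le[of v] by linarith
    then have "norm (f j v - g v) * exp (- v\<^sup>2 / (2 * \<tau>)) \<le> 2 * F_bound * exp (quotient_rate * \<bar>v\<bar>) * exp (- v\<^sup>2 / (2 * \<tau>))"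
      by (intro mult_right_mono) auto
    also have "\<dots> = w v" unfolding w_def mult.assoc exp_add[symmetric] by simp
    finally show ?thesis .
  qed
  have "D \<longlonglongrightarrow> (LINT v::real|lborel. 0)"
    unfolding D_def
  proof (rule integral_dominated_convergence)
    show "integrable lborel w" by (rule int_w)
    show "AE v in lborel. (\<lambda>j. norm (f j v - g v) * exp (- v\<^sup>2 / (2 * \<tau>))) \<longlonglongrightarrow> 0"
      using f_lim by (intro AE_I2 tendsto_mult_left_zero tendsto_norm_zero) (simp add: LIM_zero)
    show "AE v in lborel. norm (norm (f j v - g v) * exp (- v\<^sup>2 / (2 * \<tau>))) \<le> w v" for j
      using le_w by simp
  qed measurable
  then have D0: "D \<longlonglongrightarrow> 0" by simp
  have int_D: "integrable lborel (\<lambda>v. norm (f j v - g v) * exp (- v\<^sup>2 / (2 * \<tau>)))" for j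
    by (rule Bochner_Integration.integrable_bound[OF int_w]) (use le_w in \<open>auto intro!: order_trans[OF _ abs_ge_self]\<close>)
  obtain R where R: "\<And>\<zeta>. \<zeta> \<in> K \<Longrightarrow> norm \<zeta> \<le> R"
    using compact_imp_bounded[OF \<open>compact K\<close>] unfolding bounded_iff by blast
  have diff_le: "norm (line_integral \<tau> (T j) \<zeta> - of_real (sqrt (pi * \<tau>)) * limit_series \<theta> \<tau> \<zeta>) \<le> exp (R\<^sup>2 / \<tau>) * D j"
    if "\<zeta> \<in> K" for j \<zeta>
  proof -
    have int_f: "integrable lborel (\<lambda>v. f j v * E \<zeta> v)" and int_g: "integrable lborel (\<lambda>v. g v * E \<zeta> v)"
      unfolding E_def by (rule integrable_gaussian_kernel_mult[OF assms(1) _ f_le], measurable)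
        (rule integrable_gaussian_kernel_mult[OF assms(1) _ g_le], measurable)
    have "line_integral \<tau> (T j) \<zeta> = (LINT v|lborel. f j v * E \<zeta> v)"
      by (simp add: line_integral_def f_def p_def E_def)
    moreover have "of_real (sqrt (pi * \<tau>)) * limit_series \<theta> \<tau> \<zeta> = (LINT v|lborel. g v * E \<zeta> v)"
      unfolding limit_series_def g_def E_def
      by (rule dirichlet_sum_gaussian_transform[OF assms(1) summable_twisted[OF \<theta>], symmetric])
    ultimately have "line_integral \<tau> (T j) \<zeta> - of_real (sqrt (pi * \<tau>)) * limit_series \<theta> \<tau> \<zeta> = (LINT v|lborel. (f j v - g v) * E \<zeta> v)"
      using int_f int_g by (simp add: left_diff_distrib)
    also have "norm \<dots> \<le> (LINT v|lborel. exp (R\<^sup>2 / \<tau>) * (norm (f j v - g v) * exp (- v\<^sup>2 / (2 * \<tau>))))"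
    proof (rule Bochner_Integration.integral_norm_bound_integral)
      show "integrable lborel (\<lambda>v. (f j v - g v) * E \<zeta> v)"
        using int_f int_g by (simp add: left_diff_distrib)
      show "integrable lborel (\<lambda>v. exp (R\<^sup>2 / \<tau>) * (norm (f j v - g v) * exp (- v\<^sup>2 / (2 * \<tau>))))"
        using int_D by simp
      fix v
      have "norm (f j v - g v) * norm (E \<zeta> v) \<le> norm (f j v - g v) * (exp (R\<^sup>2 / \<tau>) * exp (- v\<^sup>2 / (2 * \<tau>)))"
        unfolding E_def by (intro mult_left_mono norm_gaussian_kernel_le assms R that) auto
      then show "norm ((f j v - g v) * E \<zeta> v) \<le> exp (R\<^sup>2 / \<tau>) * (norm (f j v - g v) * exp (- v\<^sup>2 / (2 * \<tau>)))"
        by (simp add: norm_mult mult_ac)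
    qed
    also have "\<dots> = exp (R\<^sup>2 / \<tau>) * D j" by (simp add: D_def)
    finally show ?thesis .
  qed
  have lim0: "(\<lambda>j. exp (R\<^sup>2 / \<tau>) * D j) \<longlonglongrightarrow> 0"
    using tendsto_mult[OF tendsto_const D0] by simp
  show ?thesis
  proof (rule uniform_limitI)
    fix e :: real assume "e > 0"
    with lim0 have "\<forall>\<^sub>F j in sequentially. exp (R\<^sup>2 / \<tau>) * D j < e" by (rule order_tendstoD(2))
    then show "\<forall>\<^sub>F j in sequentially. \<forall>\<zeta>\<in>K. dist (line_integral \<tau> (T j) \<zeta>) (of_real (sqrt (pi * \<tau>)) * limit_series \<theta> \<tau> \<zeta>) < e"
      by eventually_elim (use diff_le in \<open>auto simp: dist_norm intro: le_less_trans\<close>)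
  qed
qed

end

section \<open>Location of the zeros\<close>

context selberg_data
begin

lemma coeff_not_all_zero: "\<exists>n. a (Suc n) \<noteq> 0"
proof (rule ccontr)
  assume "\<nexists>n. a (Suc n) \<noteq> 0"
  moreover obtain s where "1 < Re s" "F s \<noteq> 0" using F_nonzero by blast
  ultimately show False using F_eq[of s] by simp
qed

text \<open>A diagonal argument for countably many sequences on the unit circle, indexed by integer
  heights.\<close>

lemma phases_convergent:
  obtains r \<theta> where "strict_mono (r :: nat \<Rightarrow> nat)"
    "\<And>n. (\<lambda>j. exp (- (\<i> * of_real (real (r j)) * of_real (ln (real (Suc n)))))) \<longlonglongrightarrow> \<theta> n"
    "\<And>n. norm (\<theta> n) = 1"
proof -
  define f where "f j n = exp (- (\<i> * of_real (real j) * of_real (ln (real (Suc n)))))" for j n :: nat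
  have norm_f: "norm (f j n) = 1" for j n by (simp add: f_def)
  obtain r where r: "strict_mono (r :: nat \<Rightarrow> nat)" "\<And>n. n \<in> UNIV \<Longrightarrow> \<exists>l. (\<lambda>j. f (r j) n) \<longlonglongrightarrow> l"
    by (rule function_convergent_subsequence[of UNIV f 1]) (auto simp: norm_f)
  then obtain \<theta> where \<theta>: "\<And>n. (\<lambda>j. f (r j) n) \<longlonglongrightarrow> \<theta> n" by (metis UNIV_I)
  have "norm (\<theta> n) = 1" for n
    using tendsto_norm[OF \<theta>[of n]] by (simp add: norm_f LIMSEQ_const_iff)
  with r(1) \<theta> show thesis unfolding f_def by (rule that)
qed

text \<open>A zero here would be a zero of the deformed function with real part above 2: the drift
  to the right outweighs the norm of \<zeta>.\<close>

lemma line_integral_nonzero: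
  assumes "\<tau> > 0" and int: "integrable lborel (\<lambda>x. Xi ((1 + \<i> * of_real x) / 2))"
    and zeros: "\<And>s. xi_t Xi (- \<tau>) s = 0 \<Longrightarrow> Re s = 1 / 2"
    and T: "\<tau> * Re (\<gamma>_slope (2 + \<i> * of_real T)) / 2 > norm \<zeta>"
  shows "line_integral \<tau> T \<zeta> \<noteq> 0"
proof
  assume "line_integral \<tau> T \<zeta> = 0"
  then have "xi_t Xi (- \<tau>) (2 + \<i> * of_real T + of_real \<tau> * \<gamma>_slope (2 + \<i> * of_real T) / 2 + \<zeta>) = 0"
    unfolding xi_t_on_moving_line[OF assms(1) int] line_integral_def by simp
  then have "Re (2 + \<i> * of_real T + of_real \<tau> * \<gamma>_slope (2 + \<i> * of_real T) / 2 + \<zeta>) = 1 / 2"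
    by (rule zeros)
  moreover have "- norm \<zeta> \<le> Re \<zeta>" using abs_Re_le_cmod[of \<zeta>] by linarith
  moreover have "Re (2 + \<i> * of_real T + of_real \<tau> * w / 2 + \<zeta>) = 2 + \<tau> * Re w / 2 + Re \<zeta>" for w
    by simp
  ultimately have "2 + \<tau> * Re (\<gamma>_slope (2 + \<i> * of_real T)) / 2 + Re \<zeta> = 1 / 2" "- norm \<zeta> \<le> Re \<zeta>"
    by (simp_all only:)
  with T show False by linarith
qed

text \<open>Along a subsequence of heights the twists converge, and by Hurwitz the limit inherits
  the absence of zeros.\<close>

lemma limit_series_zero_free:
  assumes "\<tau> > 0" and int: "integrable lborel (\<lambda>x. Xi ((1 + \<i> * of_real x) / 2))"
    and zeros: "\<And>s. xi_t Xi (- \<tau>) s = 0 \<Longrightarrow> Re s = 1 / 2"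
    and r: "strict_mono (r :: nat \<Rightarrow> nat)"
    and lim: "\<And>n. (\<lambda>j. exp (- (\<i> * of_real (real (r j)) * of_real (ln (real (Suc n)))))) \<longlonglongrightarrow> \<theta> n"
    and \<theta>: "\<And>n. norm (\<theta> n) = 1"
  shows "limit_series \<theta> \<tau> \<zeta> \<noteq> 0"
proof
  assume zero: "limit_series \<theta> \<tau> \<zeta> = 0"
  define R where "R = norm \<zeta> + 1"
  define S where "S = ball (0 :: complex) R"
  define g where "g z = of_real (sqrt (pi * \<tau>)) * limit_series \<theta> \<tau> z" for z
  have hol: "limit_series \<theta> \<tau> holomorphic_on A" for A
    unfolding limit_series_def
    by (rule holomorphic_on_subset[OF holomorphic_dirichlet_sum_damped[OF assms(1) summable_twisted[OF \<theta>]] subset_UNIV])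
  have \<zeta>: "\<zeta> \<in> S" by (simp add: S_def R_def)
  have T: "filterlim (\<lambda>j. real (r j)) at_top sequentially"
    by (intro filterlim_compose[OF filterlim_real_sequentially] filterlim_subseq r)
  have "filterlim (\<lambda>j. Re (\<gamma>_slope (2 + \<i> * of_real (real (r j))))) at_top sequentially"
    by (rule filterlim_compose[OF Re_gamma_slope_at_top T])
  then have "\<forall>\<^sub>F j in sequentially. 2 * R / \<tau> \<le> Re (\<gamma>_slope (2 + \<i> * of_real (real (r j))))"
    unfolding filterlim_at_top by blast
  then obtain J where J: "\<And>j. j \<ge> J \<Longrightarrow> 2 * R / \<tau> \<le> Re (\<gamma>_slope (2 + \<i> * of_real (real (r j))))"
    unfolding eventually_sequentially by blast
  \<comment> \<open>The shift by \<open>J\<close> makes every member of the sequence zero-free on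
    the disc, as Hurwitz's theorem is stated for all indices.\<close>
  have nz: "line_integral \<tau> (real (r (j + J))) z \<noteq> 0" if "z \<in> S" for j z
  proof (rule line_integral_nonzero[OF assms(1) int zeros])
    have "norm z < R" using that by (simp add: S_def)
    also have "R \<le> \<tau> * Re (\<gamma>_slope (2 + \<i> * of_real (real (r (j + J))))) / 2"
      using J[of "j + J"] assms(1) by (simp add: field_simps)
    finally show "norm z < \<tau> * Re (\<gamma>_slope (2 + \<i> * of_real (real (r (j + J))))) / 2" .
  qed
  have unif: "uniform_limit K (\<lambda>j. line_integral \<tau> (real (r (j + J)))) g sequentially" if "compact K" for K
  proof -
    have "filterlim (\<lambda>j. j + J) sequentially sequentially" by (rule filterlim_add_const_nat_at_top)
    from filterlim_compose[OF line_integral_uniform_limit[OF assms(1) T lim \<theta> that] this]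
    show ?thesis by (simp add: g_def[abs_def])
  qed
  \<comment> \<open>Hurwitz's theorem excludes constant limits. Here a constant limit would be 0
    and, by analytic continuation and uniqueness of coefficients, would annihilate
    \<open>F\<close>.\<close>
  have "g constant_on S"
  proof (rule ccontr)
    assume "\<not> g constant_on S"
    then have "g \<zeta> \<noteq> 0"
    proof (rule Hurwitz_no_zeros[rotated 5])
      show "open S" "connected S" by (auto simp: S_def)
      show "line_integral \<tau> (real (r (j + J))) holomorphic_on S" for j
        by (rule holomorphic_on_subset[OF holomorphic_line_integral[OF assms(1)] subset_UNIV])
      show "g holomorphic_on S" unfolding g_def by (intro holomorphic_intros hol)
    qed (use unif nz \<zeta> in auto)
    then show False using zero by (simp add: g_def)
  qed
  then obtain c where "\<And>z. z \<in> S \<Longrightarrow> g z = c" unfolding constant_on_def by blast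
  moreover have "g \<zeta> = 0" using zero by (simp add: g_def)
  ultimately have "g z = 0" if "z \<in> S" for z using \<zeta> that by metis
  then have zero_S: "limit_series \<theta> \<tau> z = 0" if "z \<in> S" for z using that assms(1) by (simp add: g_def)
  have zero_all: "limit_series \<theta> \<tau> z = 0" for z
  proof (rule analytic_continuation_open[of S UNIV "limit_series \<theta> \<tau>" "\<lambda>_. 0"])
    show "open S" by (simp add: S_def)
    show "S \<noteq> {}" using \<zeta> by blast
  qed (use hol connected_UNIV zero_S in auto)
  have "gaussian_damping \<tau> (\<lambda>n. coeff2 n * \<theta> n) n = 0" for n
  proof (rule dirichlet_sum_eq_0_imp)
    show "summable (\<lambda>n. norm (gaussian_damping \<tau> (\<lambda>n. coeff2 n * \<theta> n) n) * exp (\<sigma> * ln (real (Suc n))))" for \<sigma>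
      by (rule summable_gaussian_damping[OF assms(1) summable_twisted[OF \<theta>]])
    show "dirichlet_sum (gaussian_damping \<tau> (\<lambda>n. coeff2 n * \<theta> n)) z = 0" for z
      using zero_all[of z] unfolding limit_series_def .
  qed
  moreover have "\<theta> n \<noteq> 0" for n using \<theta>[of n] by auto
  ultimately have "a (Suc n) = 0" for n
    by (simp add: gaussian_damping_def coeff2_def)
  with coeff_not_all_zero show False by blast
qed

text \<open>The poles of the gamma factor must be cancelled by zeros of the Dirichlet series, and a
  single term has none.\<close>

lemma not_single_term:
  assumes "\<And>n. n \<noteq> N \<Longrightarrow> a (Suc n) = 0"
  shows "a (Suc N) = 0"
proof -
  define f where "f s = a (Suc N) * exp (- s * of_real (ln (real (Suc N))))" for s
  have F: "F s = f s" if "1 < Re s" for s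
  proof -
    have "F s = (\<Sum>n. if n = N then f s else 0)"
      unfolding F_eq[OF that] coeff_term_eq_exp f_def
      by (intro suminf_cong) (use assms in auto)
    also have "\<dots> = f s" by (rule sums_unique[OF sums_single, symmetric])
    finally show ?thesis .
  qed
  have eq: "Xi s * (\<Prod>i<k. rGamma (\<gamma>_arg i s)) = \<alpha> * s ^ m * of_real Q powr s * ((s - 1) ^ m * f s)" for s
  proof (rule completed_continuation)
    show "(\<lambda>s. (s - 1) ^ m * f s) holomorphic_on UNIV" unfolding f_def by (intro holomorphic_intros)
  qed (simp add: F)
  have \<omega>: "0 < \<omega> 0" "0 \<le> Re (\<mu> 0)" using omega_pos[of 0] Re_mu_nonneg[of 0] k_pos by auto
  \<comment> \<open>The argument of the first Gamma is sent to the pole -1 and not to 0: as Re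
    (\<mu> 0) \<ge> 0, this forces Re s < 0, whereas the pole 0 may lie at s = 0, where s^m can
    vanish.\<close>
  define s where "s = - (1 + \<mu> 0) / of_real (\<omega> 0)"
  have "\<gamma>_arg 0 s = - 1" using \<omega> by (simp add: s_def)
  then have "rGamma (\<gamma>_arg 0 s) = 0" by (simp add: rGamma_eq_zero_iff)
  then have prod_0: "(\<Prod>i<k. rGamma (\<gamma>_arg i s)) = 0" using k_pos by (intro prod_zero) auto
  have "\<alpha> * s ^ m * of_real Q powr s * ((s - 1) ^ m * f s) = 0"
    unfolding eq[symmetric] prod_0 by (rule mult_zero_right)
  moreover have "s \<noteq> 0" "s - 1 \<noteq> 0"
  proof -
    have "Re s = - (1 + Re (\<mu> 0)) / \<omega> 0" by (simp add: s_def Re_divide_of_real)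
    then have "Re s < 0" using \<omega> by (simp add: divide_neg_pos)
    then show "s \<noteq> 0" "s - 1 \<noteq> 0" by auto
  qed
  ultimately have "f s = 0" using alpha_nonzero Q_pos by simp
  then show ?thesis by (simp add: f_def)
qed

lemma xi_t_zero_off_critical_line:
  assumes "t < 0"
  shows "\<exists>s. xi_t Xi t s = 0 \<and> Re s \<noteq> 1 / 2"
proof (cases "integrable lborel (\<lambda>x. Xi ((1 + \<i> * of_real x) / 2))")
  case False
  \<comment> \<open>The deformed function is identically 0, so any point off the line
    serves.\<close>
  then show ?thesis using xi_t_eq_0_if_not_integrable by (intro exI[of _ 0]) auto
next
  case True
  define \<tau> where "\<tau> = - t"
  have \<tau>: "\<tau> > 0" "t = - \<tau>" using assms by (auto simp: \<tau>_def)
  show ?thesis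
  proof (rule ccontr)
    assume "\<nexists>s. xi_t Xi t s = 0 \<and> Re s \<noteq> 1 / 2"
    then have zeros: "Re s = 1 / 2" if "xi_t Xi (- \<tau>) s = 0" for s
      using that \<tau>(2) by blast
    obtain r \<theta> where r: "strict_mono (r :: nat \<Rightarrow> nat)"
      "\<And>n. (\<lambda>j. exp (- (\<i> * of_real (real (r j)) * of_real (ln (real (Suc n)))))) \<longlonglongrightarrow> \<theta> n"
      and \<theta>: "\<And>n. norm (\<theta> n) = 1"
      using phases_convergent by blast
    define b where "b = gaussian_damping \<tau> (\<lambda>n. coeff2 n * \<theta> n)"
    have sum: "summable (\<lambda>n. norm (coeff2 n * \<theta> n))" by (rule summable_twisted[OF \<theta>])
    have "\<exists>N. b N \<noteq> 0 \<and> (\<forall>n. n \<noteq> N \<longrightarrow> b n = 0)"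
    proof (rule zero_free_dirichlet_sum[of b])
      show "summable (\<lambda>n. norm (b n) * exp (\<sigma> * ln (real (Suc n))))" for \<sigma>
        unfolding b_def by (rule summable_gaussian_damping[OF \<tau>(1) sum])
      show "dirichlet_sum b holomorphic_on UNIV"
        unfolding b_def by (rule holomorphic_dirichlet_sum_damped[OF \<tau>(1) sum])
      show "dirichlet_sum b \<zeta> \<noteq> 0" for \<zeta>
        using limit_series_zero_free[OF \<tau>(1) True zeros r \<theta>] by (simp add: b_def limit_series_def)
      show "norm (dirichlet_sum b \<zeta>) \<le> (\<Sum>n. norm (coeff2 n * \<theta> n)) * exp (1 / \<tau> * (norm \<zeta>)\<^sup>2)" for \<zeta>
        unfolding b_def by (rule norm_dirichlet_sum_damped_le[OF \<tau>(1) sum])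
    qed (use \<tau> in auto)
    then obtain N where N: "b N \<noteq> 0" "\<And>n. n \<noteq> N \<Longrightarrow> b n = 0" by blast
    \<comment> \<open>Phases and damping factors never vanish, so the twist has the same support as
      the original coefficients.\<close>
    have "b n = 0 \<longleftrightarrow> a (Suc n) = 0" for n
      using \<theta>[of n] by (auto simp: b_def gaussian_damping_def coeff2_def)
    with N not_single_term[of N] show False by auto
  qed
qed

end

theorem theorem2:
  fixes F :: "complex \<Rightarrow> complex" and a :: "nat \<Rightarrow> complex" and m :: nat
    and \<alpha> :: complex and Q :: real and k :: nat
    and \<omega> :: "nat \<Rightarrow> real" and \<mu> :: "nat \<Rightarrow> complex" and Xi :: "complex \<Rightarrow> complex"
    and t :: real
  assumes "selberg_sharp F a m \<alpha> Q k \<omega> \<mu> Xi"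
    and "t < 0"
  shows "\<exists>s. xi_t Xi t s = 0 \<and> Re s \<noteq> 1 / 2"
proof -
  interpret selberg_data F a m \<alpha> Q k \<omega> \<mu> Xi
    by unfold_locales (rule assms(1))
  show ?thesis by (rule xi_t_zero_off_critical_line[OF assms(2)])
qed

end
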